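(* Let $n_0$ be a nonzero integer, and let $h:=\frac{1}{n_0}L_0$ and $e:=M_{n_0}$ in $\mathcal{L}$, so that $[h,e]=e$. Then there exists a structure of noncommutative and noncocommutative Hopf algebra $(U(\mathcal{L})[[t]],m,\iota,\Delta,S,\epsilon)$ on $U(\mathcal{L})[[t]]$ over $\mathbb{F}[[t]]$, with $U(\mathcal{L})[[t]]/tU(\mathcal{L})[[t]]\cong U(\mathcal{L})$, which leaves the product $m$ (with unit $\iota$) and the counit $\epsilon$ of $U(\mathcal{L})[[t]]$ undeformed, and whose comultiplication $\Delta$ and antipode $S$ are given, for all $n,k\in\mathbb{Z}$ and $p\in\frac12+\mathbb{Z}$, by $$\Delta(L_n)=1\otimes L_n+L_n\otimes(1-et)^{\frac{n}{n_0}}+n_0h\otimes(1-et)^{-1}M_{n+n_0}t,$$ $$\Delta(M_k)=1\otimes M_k+M_k\otimes(1-et)^{\frac{k}{n_0}},$$ $$\Delta(Y_p)=1\otimes Y_p+Y_p\otimes(1-et)^{\frac{p}{n_0}},$$ $$S(L_n)=-(1-et)^{-\frac{n}{n_0}}\big(L_n-n_0M_{n+n_0}h^{[1]}_1t\big),$$ $$S(M_k)=-(1-et)^{-\frac{k}{n_0}}M_k,\qquad S(Y_p)=-(1-et)^{-\frac{p}{n_0}}Y_p.$$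
   Context: $\mathbb{F}$ is a field of characteristic zero. The Schrödinger-Virasoro Lie algebra $\mathcal{L}$ is the Lie algebra over $\mathbb{F}$ with basis $\{L_n,Y_p,M_n : n\in\mathbb{Z},\ p\in\frac12+\mathbb{Z}\}$ and nonvanishing brackets (all brackets of basis elements not determined by these and antisymmetry are zero) $$[L_m,L_n]=(n-m)L_{n+m},\quad [L_m,M_n]=nM_{n+m},\quad [L_n,Y_p]=\left(p-\tfrac n2\right)Y_{p+n},\quad [Y_p,Y_q]=(q-p)M_{p+q}.$$ $U(\mathcal{L})$ is its universal enveloping algebra with the standard Hopf algebra structure $(U(\mathcal{L}),m,\iota,\Delta_0,S_0,\epsilon)$: $\Delta_0(X)=X\otimes1+1\otimes X$, $S_0(X)=-X$, $\epsilon(X)=0$ for $X\in\mathcal{L}$. $U(\mathcal{L})[[t]]$ is the topologically free $\mathbb{F}[[t]]$-algebra of formal power series in a central variable $t$ with coefficients in $U(\mathcal{L})$, with the induced Hopf structure; Hopf algebras over $\mathbb{F}[[t]]$ are understood in the topological sense, with tensor products completed $t$-adically, so that $U(\mathcal{L})[[t]]\otimes U(\mathcal{L})[[t]]$ means $(U(\mathcal{L})\otimes U(\mathcal{L}))[[t]]$. As usual, $\Delta$ is an algebra homomorphism and $S$ an algebra anti-homomorphism, so they are determined by their values on the basis of $\mathcal{L}$. For $c\in\mathbb{F}$, $(1-et)^c:=\sum_{m\ge0}(-1)^m\binom{c}{m}e^mt^m\in U(\mathcal{L})[[t]]$. For $a\in\mathbb{F}$ and $n\in\mathbb{Z}_+$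 (nonnegative integers), $x_a^{[n]}:=(x+a)(x+a-1)\cdots(x+a-n+1)$; in particular $h_1^{[1]}=h+1$. *)

theory Defs
  imports
    "HOL-Library.Poly_Mapping"
    "HOL-Library.Product_Plus"
    "HOL-Computational_Algebra.Formal_Power_Series"
begin

section \<open>Monoid algebras and quotients by two-sided ideals\<close>

text \<open>
  The type \<open>'m \<Rightarrow>\<^sub>0 'a\<close> of finitely supported functions is the monoid algebra of the additively
  written monoid \<open>'m\<close>. Two monoids are written additively for this purpose:
  lists under concatenation (the monoid algebra is then the free associative algebra), and
  the multiplicative monoid of a ring.
\<close>

datatype 'b word = Word "'b list"

instantiation word :: (type) monoid_add
begin

definition zero_word :: "'a word" where "0 = Word []"

fun plus_word :: "'a word \<Rightarrow> 'a word \<Rightarrow> 'a word" where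
  "Word xs + Word ys = Word (xs @ ys)"

instance
proof
  fix a b c :: "'a word"
  show "a + b + c = a + (b + c)" by (cases a; cases b; cases c) simp
  show "0 + a = a" by (cases a) (simp add: zero_word_def)
  show "a + 0 = a" by (cases a) (simp add: zero_word_def)
qed

end

datatype 'u mon = Mon 'u

instantiation mon :: (monoid_mult) monoid_add
begin

definition zero_mon :: "'a mon" where "0 = Mon 1"

fun plus_mon :: "'a mon \<Rightarrow> 'a mon \<Rightarrow> 'a mon" where
  "Mon x + Mon y = Mon (x * y)"

instance
proof
  fix a b c :: "'a mon"
  show "a + b + c = a + (b + c)" by (cases a; cases b; cases c) (simp add: mult.assoc)
  show "0 + a = a" by (cases a) (simp add: zero_mon_def)
  show "a + 0 = a" by (cases a) (simp add: zero_mon_def)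
qed

end

inductive_set ideal_gen :: "'r::ring_1 set \<Rightarrow> 'r set" for R where
  zero: "0 \<in> ideal_gen R"
| gen: "r \<in> R \<Longrightarrow> r \<in> ideal_gen R"
| add: "x \<in> ideal_gen R \<Longrightarrow> y \<in> ideal_gen R \<Longrightarrow> x + y \<in> ideal_gen R"
| mult: "x \<in> ideal_gen R \<Longrightarrow> a * x * b \<in> ideal_gen R"

definition ideal_cong :: "'r::ring_1 set \<Rightarrow> 'r \<Rightarrow> 'r \<Rightarrow> bool" where
  "ideal_cong R x y \<longleftrightarrow> x - y \<in> ideal_gen R"

lemma ideal_gen_uminus: "x \<in> ideal_gen R \<Longrightarrow> - x \<in> ideal_gen R"
  using ideal_gen.mult[of x R "-1" 1] by simp

lemma equivp_ideal_cong: "equivp (ideal_cong R)"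
proof (rule equivpI)
  show "reflp (ideal_cong R)" by (simp add: reflp_def ideal_cong_def ideal_gen.zero)
  show "symp (ideal_cong R)"
    by (metis ideal_cong_def ideal_gen_uminus minus_diff_eq sympI)
  show "transp (ideal_cong R)"
  proof (rule transpI)
    fix x y z assume "ideal_cong R x y" "ideal_cong R y z"
    then have "(x - y) + (y - z) \<in> ideal_gen R"
      unfolding ideal_cong_def by (rule ideal_gen.add)
    then show "ideal_cong R x z" by (simp add: ideal_cong_def)
  qed
qed

lemma ideal_cong_gen: "r \<in> R \<Longrightarrow> ideal_cong R r 0"
  by (simp add: ideal_cong_def ideal_gen.gen)

lemma ideal_cong_add:
  assumes "ideal_cong R x y" "ideal_cong R u v" shows "ideal_cong R (x + u) (y + v)"
  using ideal_gen.add[of "x - y" R "u - v"] assms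
  by (simp add: ideal_cong_def algebra_simps)

lemma ideal_cong_uminus:
  assumes "ideal_cong R x y" shows "ideal_cong R (- x) (- y)"
  using ideal_gen_uminus[of "x - y" R] assms by (simp add: ideal_cong_def)

lemma ideal_cong_diff:
  assumes "ideal_cong R x y" "ideal_cong R u v" shows "ideal_cong R (x - u) (y - v)"
  using ideal_cong_add[OF assms(1) ideal_cong_uminus[OF assms(2)]] by simp

lemma ideal_cong_mult:
  assumes "ideal_cong R x y" "ideal_cong R u v" shows "ideal_cong R (x * u) (y * v)"
proof -
  have "(x - y) * u \<in> ideal_gen R" "y * (u - v) \<in> ideal_gen R"
    using ideal_gen.mult[of "x - y" R 1 u] ideal_gen.mult[of "u - v" R y 1] assms
    by (simp_all add: ideal_cong_def)
  then have "(x - y) * u + y * (u - v) \<in> ideal_gen R" by (rule ideal_gen.add)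
  then show ?thesis by (simp add: ideal_cong_def algebra_simps)
qed

lemma ideal_gen_vanish:
  assumes "x \<in> ideal_gen R"
    and "\<And>x y. F (x + y) = F x + F y" "F 0 = 0"
    and "(\<forall>x y. F (x * y) = F x * F y) \<or> (\<forall>x y. F (x * y) = F y * F x)"
    and "\<And>r. r \<in> R \<Longrightarrow> F r = (0::'s::ring_1)"
  shows "F x = 0"
  using assms(1)
proof induction
  case (mult x a b)
  then show ?case using assms(4) by auto
qed (use assms in auto)

section \<open>Algebra maps out of monoid algebras\<close>

text \<open>
  An algebra over the field \<open>'a\<close> is a ring together with a ring homomorphism \<open>sc\<close> from \<open>'a\<close> into
  its centre; multiplication by the scalar \<open>c\<close> is multiplication by \<open>sc c\<close>.
\<close>

definition scalar_map :: "('a::field \<Rightarrow> 'r::ring_1) \<Rightarrow> bool" where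
  "scalar_map sc \<longleftrightarrow>
    (\<forall>a b. sc (a + b) = sc a + sc b) \<and> (\<forall>a b. sc (a * b) = sc a * sc b) \<and> sc 1 = 1 \<and>
    (\<forall>a x. sc a * x = x * sc a)"

definition lin_ext :: "('a::field \<Rightarrow> 'r::ring_1) \<Rightarrow> ('m \<Rightarrow> 'r) \<Rightarrow> ('m \<Rightarrow>\<^sub>0 'a) \<Rightarrow> 'r" where
  "lin_ext sc \<phi> p = (\<Sum>m\<in>Poly_Mapping.keys p. sc (Poly_Mapping.lookup p m) * \<phi> m)"

lemma scalar_map_0: "scalar_map sc \<Longrightarrow> sc 0 = 0"
  unfolding scalar_map_def by (metis add_cancel_left_left add_0)

lemma lin_ext_superset:
  assumes "scalar_map sc" "finite A" "Poly_Mapping.keys p \<subseteq> A"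
  shows "lin_ext sc \<phi> p = (\<Sum>m\<in>A. sc (Poly_Mapping.lookup p m) * \<phi> m)"
  unfolding lin_ext_def using assms
  by (intro sum.mono_neutral_left) (auto simp: in_keys_iff scalar_map_0)

lemma lin_ext_add:
  assumes "scalar_map sc"
  shows "lin_ext sc \<phi> (p + q) = lin_ext sc \<phi> p + lin_ext sc \<phi> q"
proof -
  let ?A = "Poly_Mapping.keys p \<union> Poly_Mapping.keys q"
  have "Poly_Mapping.keys (p + q) \<subseteq> ?A" by (rule Poly_Mapping.keys_add)
  moreover have "finite ?A" by simp
  moreover have "sc (a + b) = sc a + sc b" for a b using assms by (simp add: scalar_map_def)
  ultimately show ?thesis
    by (simp add: lin_ext_superset[OF assms, of ?A] lookup_add distrib_right sum.distrib)
qed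

lemma lin_ext_0 [simp]: "lin_ext sc \<phi> 0 = 0"
  by (simp add: lin_ext_def)

lemma lin_ext_uminus:
  assumes "scalar_map sc" shows "lin_ext sc \<phi> (- p) = - lin_ext sc \<phi> p"
  using lin_ext_add[OF assms, of \<phi> p "- p"] by (simp add: eq_neg_iff_add_eq_0 add.commute)

lemma lin_ext_diff:
  assumes "scalar_map sc" shows "lin_ext sc \<phi> (p - q) = lin_ext sc \<phi> p - lin_ext sc \<phi> q"
  using lin_ext_add[OF assms, of \<phi> p "- q"] lin_ext_uminus[OF assms] by simp

lemma lin_ext_sum:
  assumes "scalar_map sc" shows "lin_ext sc \<phi> (sum f A) = (\<Sum>x\<in>A. lin_ext sc \<phi> (f x))"
  by (induction A rule: infinite_finite_induct) (simp_all add: lin_ext_add[OF assms])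

lemma lin_ext_single:
  assumes "scalar_map sc" shows "lin_ext sc \<phi> (Poly_Mapping.single m c) = sc c * \<phi> m"
  using lin_ext_superset[OF assms, of "{m}" "Poly_Mapping.single m c" \<phi>]
  by (auto simp: in_keys_iff lookup_single when_def split: if_splits)

lemma poly_mapping_expand:
  "p = (\<Sum>m\<in>Poly_Mapping.keys p. Poly_Mapping.single m (Poly_Mapping.lookup p m))"
  by (rule poly_mapping_eqI)
     (auto simp: lookup_sum lookup_single when_def in_keys_iff sum.delta')

lemma lin_ext_mult:
  assumes "scalar_map sc" "\<And>m n. \<phi> (m + n) = \<phi> m * \<phi> n"
  shows "lin_ext sc \<phi> (p * q) = lin_ext sc \<phi> p * lin_ext sc \<phi> q"
proof -
  have sc: "sc (a * b) = sc a * sc b" "sc a * x = x * sc a" for a b x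
    using assms(1) unfolding scalar_map_def by blast+
  have comm: "sc (a * b) * (x * y) = (sc a * x) * (sc b * y)" for a b x y
    by (simp add: sc(1) mult.assoc) (metis mult.assoc sc(2))
  have "p * q = (\<Sum>m\<in>Poly_Mapping.keys p. \<Sum>n\<in>Poly_Mapping.keys q.
      Poly_Mapping.single (m + n) (Poly_Mapping.lookup p m * Poly_Mapping.lookup q n))"
    by (subst (1) poly_mapping_expand[of p], subst (1) poly_mapping_expand[of q])
       (simp add: sum_product mult_single)
  then have "lin_ext sc \<phi> (p * q) = (\<Sum>m\<in>Poly_Mapping.keys p. \<Sum>n\<in>Poly_Mapping.keys q.
      sc (Poly_Mapping.lookup p m * Poly_Mapping.lookup q n) * (\<phi> m * \<phi> n))"
    by (simp add: lin_ext_sum[OF assms(1)] lin_ext_single[OF assms(1)] assms(2))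
  also have "\<dots> = lin_ext sc \<phi> p * lin_ext sc \<phi> q"
    by (simp add: lin_ext_def sum_product comm)
  finally show ?thesis .
qed

lemma lin_ext_mult_anti:
  assumes "scalar_map sc" "\<And>m n. \<phi> (m + n) = \<phi> n * \<phi> m"
  shows "lin_ext sc \<phi> (p * q) = lin_ext sc \<phi> q * lin_ext sc \<phi> p"
proof -
  have sc: "sc (a * b) = sc a * sc b" "sc a * x = x * sc a" for a b x
    using assms(1) unfolding scalar_map_def by blast+
  have comm: "sc (a * b) * (y * x) = (sc b * y) * (sc a * x)" for a b x y
    by (simp add: sc(1) mult.assoc) (metis mult.assoc sc(2))
  have "p * q = (\<Sum>m\<in>Poly_Mapping.keys p. \<Sum>n\<in>Poly_Mapping.keys q.
      Poly_Mapping.single (m + n) (Poly_Mapping.lookup p m * Poly_Mapping.lookup q n))"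
    by (subst (1) poly_mapping_expand[of p], subst (1) poly_mapping_expand[of q])
       (simp add: sum_product mult_single)
  then have "lin_ext sc \<phi> (p * q) = (\<Sum>m\<in>Poly_Mapping.keys p. \<Sum>n\<in>Poly_Mapping.keys q.
      sc (Poly_Mapping.lookup p m * Poly_Mapping.lookup q n) * (\<phi> n * \<phi> m))"
    by (simp add: lin_ext_sum[OF assms(1)] lin_ext_single[OF assms(1)] assms(2))
  also have "\<dots> = (\<Sum>n\<in>Poly_Mapping.keys q. \<Sum>m\<in>Poly_Mapping.keys p.
      sc (Poly_Mapping.lookup p m * Poly_Mapping.lookup q n) * (\<phi> n * \<phi> m))" by (rule sum.swap)
  also have "\<dots> = lin_ext sc \<phi> q * lin_ext sc \<phi> p"
    by (simp add: lin_ext_def sum_product comm)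
  finally show ?thesis .
qed

section \<open>Universal enveloping algebras\<close>

text \<open>
  A Lie algebra with basis \<open>'b\<close> is carried by \<open>'b \<Rightarrow>\<^sub>0 'a\<close>, and the monoid algebra of \<open>'b word\<close> is its
  tensor algebra, containing the Lie algebra as the span of the words of length one.
\<close>

definition tensor_alg_incl :: "('b \<Rightarrow>\<^sub>0 'a::field) \<Rightarrow> ('b word \<Rightarrow>\<^sub>0 'a)" where
  "tensor_alg_incl x = (\<Sum>g\<in>Poly_Mapping.keys x. Poly_Mapping.single (Word [g]) (Poly_Mapping.lookup x g))"

definition uea_rels ::
  "(('b \<Rightarrow>\<^sub>0 'a::field) \<Rightarrow> ('b \<Rightarrow>\<^sub>0 'a) \<Rightarrow> ('b \<Rightarrow>\<^sub>0 'a)) \<Rightarrow> ('b word \<Rightarrow>\<^sub>0 'a) set" where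
  "uea_rels br =
    {tensor_alg_incl x * tensor_alg_incl y - tensor_alg_incl y * tensor_alg_incl x
      - tensor_alg_incl (br x y) | x y. True}"

definition bilinear_ext ::
  "('b \<Rightarrow> 'b \<Rightarrow> ('b \<Rightarrow>\<^sub>0 'a::field)) \<Rightarrow> ('b \<Rightarrow>\<^sub>0 'a) \<Rightarrow> ('b \<Rightarrow>\<^sub>0 'a) \<Rightarrow> ('b \<Rightarrow>\<^sub>0 'a)" where
  "bilinear_ext br x y =
    (\<Sum>g\<in>Poly_Mapping.keys x. \<Sum>k\<in>Poly_Mapping.keys y.
      Poly_Mapping.map ((*) (Poly_Mapping.lookup x g * Poly_Mapping.lookup y k)) (br g k))"

fun word_prod :: "('b \<Rightarrow> 'r::monoid_mult) \<Rightarrow> 'b word \<Rightarrow> 'r" where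
  "word_prod f (Word gs) = prod_list (map f gs)"

fun word_prod_rev :: "('b \<Rightarrow> 'r::monoid_mult) \<Rightarrow> 'b word \<Rightarrow> 'r" where
  "word_prod_rev f (Word gs) = prod_list (map f (rev gs))"

lemma word_prod_add: "word_prod f (v + w) = word_prod f v * word_prod f w"
  by (cases v; cases w) simp

lemma word_prod_rev_add: "word_prod_rev f (v + w) = word_prod_rev f w * word_prod_rev f v"
  by (cases v; cases w) simp

lemma tensor_alg_incl_superset:
  assumes "finite A" "Poly_Mapping.keys x \<subseteq> A"
  shows "tensor_alg_incl x = (\<Sum>g\<in>A. Poly_Mapping.single (Word [g]) (Poly_Mapping.lookup x g))"
  unfolding tensor_alg_incl_def using assms
  by (intro sum.mono_neutral_left) (auto simp: in_keys_iff)

lemma tensor_alg_incl_add: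
  "tensor_alg_incl (x + y) = tensor_alg_incl x + tensor_alg_incl y"
proof -
  let ?A = "Poly_Mapping.keys x \<union> Poly_Mapping.keys y"
  have "Poly_Mapping.keys (x + y) \<subseteq> ?A" by (rule Poly_Mapping.keys_add)
  moreover have "finite ?A" by simp
  ultimately show ?thesis
    by (simp add: tensor_alg_incl_superset[of ?A] lookup_add single_add sum.distrib)
qed

lemma tensor_alg_incl_sum: "tensor_alg_incl (sum f A) = (\<Sum>i\<in>A. tensor_alg_incl (f i))"
  by (induction A rule: infinite_finite_induct)
     (simp_all add: tensor_alg_incl_add, simp_all add: tensor_alg_incl_def)

lemma tensor_alg_incl_smult:
  "tensor_alg_incl (Poly_Mapping.map ((*) c) x) = Poly_Mapping.single 0 c * tensor_alg_incl x"
proof -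
  have l: "Poly_Mapping.lookup (Poly_Mapping.map ((*) c) x) g = c * Poly_Mapping.lookup x g" for g
    by (simp add: Poly_Mapping.map.rep_eq when_def)
  have "Poly_Mapping.keys (Poly_Mapping.map ((*) c) x) \<subseteq> Poly_Mapping.keys x" by (auto simp: in_keys_iff l)
  then have "tensor_alg_incl (Poly_Mapping.map ((*) c) x)
      = (\<Sum>g\<in>Poly_Mapping.keys x. Poly_Mapping.single (Word [g]) (c * Poly_Mapping.lookup x g))"
    by (simp add: tensor_alg_incl_superset[of "Poly_Mapping.keys x"] l)
  also have "\<dots> = Poly_Mapping.single 0 c * tensor_alg_incl x"
    by (simp add: tensor_alg_incl_def sum_distrib_left mult_single)
  finally show ?thesis .
qed

lemma lin_ext_tensor_alg_incl:
  assumes "scalar_map sc"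
  shows "lin_ext sc \<phi> (tensor_alg_incl x) = (\<Sum>g\<in>Poly_Mapping.keys x. sc (Poly_Mapping.lookup x g) * \<phi> (Word [g]))"
  by (simp add: tensor_alg_incl_def lin_ext_sum[OF assms] lin_ext_single[OF assms])

lemma lin_ext_bracket:
  assumes sc: "scalar_map sc"
    and m: "(\<forall>m n. \<phi> (m + n) = \<phi> m * \<phi> n) \<or> (\<forall>m n. \<phi> (m + n) = \<phi> n * \<phi> m)" and one: "\<phi> 0 = 1"
  shows "lin_ext sc \<phi> (tensor_alg_incl (bilinear_ext br x y)) =
    (\<Sum>g\<in>Poly_Mapping.keys x. \<Sum>k\<in>Poly_Mapping.keys y.
      sc (Poly_Mapping.lookup x g * Poly_Mapping.lookup y k) * lin_ext sc \<phi> (tensor_alg_incl (br g k)))"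
proof -
  have *: "lin_ext sc \<phi> (Poly_Mapping.single 0 c * p) = sc c * lin_ext sc \<phi> p" for c p
    using m
  proof (elim disjE)
    assume "\<forall>m n. \<phi> (m + n) = \<phi> m * \<phi> n"
    then show ?thesis by (simp add: lin_ext_mult[OF sc] lin_ext_single[OF sc] one)
  next
    assume "\<forall>m n. \<phi> (m + n) = \<phi> n * \<phi> m"
    then show ?thesis
      using sc by (simp add: lin_ext_mult_anti[OF sc] lin_ext_single[OF sc] one scalar_map_def)
  qed
  show ?thesis
    by (simp add: bilinear_ext_def tensor_alg_incl_sum tensor_alg_incl_smult
        lin_ext_sum[OF sc] *)
qed

lemma scalar_map_sum_comm:
  fixes sc :: "'a::field \<Rightarrow> 'r::ring_1"
  assumes sc: "scalar_map sc"
  shows "(\<Sum>g\<in>A. sc (a g) * f g) * (\<Sum>k\<in>B. sc (b k) * f k)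
      - (\<Sum>k\<in>B. sc (b k) * f k) * (\<Sum>g\<in>A. sc (a g) * f g)
    = (\<Sum>g\<in>A. \<Sum>k\<in>B. sc (a g * b k) * (f g * f k - f k * f g))"
proof -
  have sm: "sc (a * b) = sc a * sc b" "sc a * x = x * sc a" for a b x
    using sc unfolding scalar_map_def by blast+
  have 1: "(sc a * x) * (sc b * y) = sc (a * b) * (x * y)" for a b x y
    by (simp add: sm(1) mult.assoc) (metis mult.assoc sm(2))
  have 2: "(\<Sum>k\<in>B. sc (b k) * f k) * (\<Sum>g\<in>A. sc (a g) * f g)
     = (\<Sum>g\<in>A. \<Sum>k\<in>B. sc (a g * b k) * (f k * f g))"
    by (subst sum.swap) (simp add: sum_product 1 mult.commute)
  show ?thesis
    by (simp add: 2) (simp add: sum_product 1 right_diff_distrib sum_subtractf)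
qed

lemma lin_ext_uea_rels:
  assumes sc: "scalar_map sc"
    and rel: "\<And>g k. lin_ext sc (word_prod f) (tensor_alg_incl (br g k)) = f g * f k - f k * f g"
    and r: "r \<in> uea_rels (bilinear_ext br)"
  shows "lin_ext sc (word_prod f) r = 0"
proof -
  have one: "word_prod f 0 = 1" by (simp add: zero_word_def)
  obtain x y where r: "r = tensor_alg_incl x * tensor_alg_incl y
      - tensor_alg_incl y * tensor_alg_incl x - tensor_alg_incl (bilinear_ext br x y)"
    using r unfolding uea_rels_def by blast
  show ?thesis
    unfolding r using scalar_map_sum_comm[OF sc, where A = "Poly_Mapping.keys x"
        and a = "Poly_Mapping.lookup x" and f = f
        and B = "Poly_Mapping.keys y" and b = "Poly_Mapping.lookup y"]
    by (simp add: lin_ext_diff[OF sc] lin_ext_mult[OF sc] word_prod_add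
        lin_ext_tensor_alg_incl[OF sc, of _ x] lin_ext_tensor_alg_incl[OF sc, of _ y]
        lin_ext_bracket[OF sc, of "word_prod f"] one rel)
qed

lemma lin_ext_uea_rels_anti:
  assumes sc: "scalar_map sc"
    and rel: "\<And>g k. lin_ext sc (word_prod_rev f) (tensor_alg_incl (br g k)) = f k * f g - f g * f k"
    and r: "r \<in> uea_rels (bilinear_ext br)"
  shows "lin_ext sc (word_prod_rev f) r = 0"
proof -
  have one: "word_prod_rev f 0 = 1" by (simp add: zero_word_def)
  obtain x y where r: "r = tensor_alg_incl x * tensor_alg_incl y
      - tensor_alg_incl y * tensor_alg_incl x - tensor_alg_incl (bilinear_ext br x y)"
    using r unfolding uea_rels_def by blast
  define B where "B = (\<Sum>g\<in>Poly_Mapping.keys x. \<Sum>k\<in>Poly_Mapping.keys y.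
      sc (Poly_Mapping.lookup x g * Poly_Mapping.lookup y k) * (f g * f k - f k * f g))"
  let ?F = "lin_ext sc (word_prod_rev f)"
  have "?F (tensor_alg_incl (bilinear_ext br x y)) = - B"
    by (simp add: lin_ext_bracket[OF sc, of "word_prod_rev f"] word_prod_rev_add one rel B_def
        sum_negf[symmetric] right_diff_distrib)
  moreover have "?F (tensor_alg_incl x) * ?F (tensor_alg_incl y)
      - ?F (tensor_alg_incl y) * ?F (tensor_alg_incl x) = B"
    using scalar_map_sum_comm[OF sc, where A = "Poly_Mapping.keys x"
        and a = "Poly_Mapping.lookup x" and f = f
        and B = "Poly_Mapping.keys y" and b = "Poly_Mapping.lookup y"]
    by (simp add: lin_ext_tensor_alg_incl[OF sc] B_def)
  ultimately show ?thesis
    unfolding r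
    by (simp add: lin_ext_diff[OF sc] lin_ext_mult_anti[OF sc] word_prod_rev_add) (simp add: algebra_simps)
qed

section \<open>The Schroedinger--Virasoro Lie algebra and its enveloping algebra\<close>

text \<open>\<open>GenY j\<close> stands for $Y_p$ with $p = j + 1/2$.\<close>

datatype sv_gen = GenL int | GenY int | GenM int

definition half :: "int \<Rightarrow> 'a::field_char_0" where
  "half j = of_int j + 1 / 2"

fun sv_gen_bracket :: "sv_gen \<Rightarrow> sv_gen \<Rightarrow> (sv_gen \<Rightarrow>\<^sub>0 'a::field_char_0)" where
  "sv_gen_bracket (GenL m) (GenL n) = Poly_Mapping.single (GenL (n + m)) (of_int (n - m))"
| "sv_gen_bracket (GenL m) (GenM n) = Poly_Mapping.single (GenM (n + m)) (of_int n)"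
| "sv_gen_bracket (GenM n) (GenL m) = Poly_Mapping.single (GenM (n + m)) (- of_int n)"
| "sv_gen_bracket (GenL n) (GenY j) = Poly_Mapping.single (GenY (j + n)) (half j - of_int n / 2)"
| "sv_gen_bracket (GenY j) (GenL n) = Poly_Mapping.single (GenY (j + n)) (- (half j - of_int n / 2))"
| "sv_gen_bracket (GenY i) (GenY j) = Poly_Mapping.single (GenM (i + j + 1)) (half j - half i)"
| "sv_gen_bracket (GenM _) (GenM _) = 0"
| "sv_gen_bracket (GenM _) (GenY _) = 0"
| "sv_gen_bracket (GenY _) (GenM _) = 0"

definition sv_bracket ::
  "(sv_gen \<Rightarrow>\<^sub>0 'a::field_char_0) \<Rightarrow> (sv_gen \<Rightarrow>\<^sub>0 'a) \<Rightarrow> (sv_gen \<Rightarrow>\<^sub>0 'a)" where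
  "sv_bracket = bilinear_ext sv_gen_bracket"

lemma lookup_smult:
  "Poly_Mapping.lookup (Poly_Mapping.map ((*) (c::'a::field)) x) g = c * Poly_Mapping.lookup x g"
  by (simp add: Poly_Mapping.map.rep_eq when_def)

lemma smult_single:
  "Poly_Mapping.map ((*) c) (Poly_Mapping.single g d) = Poly_Mapping.single g (c * d :: 'a::field)"
  by (rule poly_mapping_eqI) (simp add: lookup_smult lookup_single when_def)

lemma smult_0: "Poly_Mapping.map ((*) (0::'a::field)) x = 0"
  by (rule poly_mapping_eqI) (simp add: lookup_smult)

lemma smult_1: "Poly_Mapping.map ((*) (1::'a::field)) x = x"
  by (rule poly_mapping_eqI) (simp add: lookup_smult)

lemma smult_zero: "Poly_Mapping.map ((*) (c::'a::field)) 0 = 0"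
  by (rule poly_mapping_eqI) (simp add: lookup_smult)

lemma bilinear_ext_single:
  "bilinear_ext br (Poly_Mapping.single g c) (Poly_Mapping.single k d)
    = Poly_Mapping.map ((*) (c * d)) (br g k)"
  by (cases "c = 0"; cases "d = 0") (simp_all add: bilinear_ext_def smult_0)

lemma bilinear_ext_0_right: "bilinear_ext br x 0 = 0"
  by (simp add: bilinear_ext_def)

lemma sv_bracket_single:
  "sv_bracket (Poly_Mapping.single a 1) (Poly_Mapping.single b 1) = sv_gen_bracket a b"
  by (simp add: sv_bracket_def bilinear_ext_single smult_1)

lemma sv_gen_bracket_antisym: "sv_gen_bracket b a = - sv_gen_bracket a b"
  by (cases a; cases b)
     (simp_all add: single_uminus[symmetric] algebra_simps)

lemma sv_gen_bracket_jacobi: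
  fixes a b c :: sv_gen
  defines "x \<equiv> Poly_Mapping.single a (1::'a::field_char_0)"
    and "y \<equiv> Poly_Mapping.single b (1::'a)" and "z \<equiv> Poly_Mapping.single c (1::'a)"
  shows "sv_bracket x (sv_bracket y z) + sv_bracket y (sv_bracket z x)
    + sv_bracket z (sv_bracket x y) = 0"
  unfolding x_def y_def z_def
  by (cases a; cases b; cases c)
     (simp_all add: sv_bracket_single, simp_all add: sv_bracket_def bilinear_ext_single
       bilinear_ext_0_right smult_single smult_zero single_add[symmetric] half_def field_simps)

quotient_type (overloaded) 'a sv_uea =
  "sv_gen word \<Rightarrow>\<^sub>0 'a::field_char_0" / "ideal_cong (uea_rels sv_bracket)"
  by (rule equivp_ideal_cong)

lemma scalar_map_id: "scalar_map (\<lambda>c. c)"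
  by (simp add: scalar_map_def mult.commute)

lemma sv_counit_rels:
  "r \<in> uea_rels sv_bracket \<Longrightarrow> lin_ext (\<lambda>c. c) (word_prod (\<lambda>_. 0)) r = (0 :: 'a::field_char_0)"
  unfolding sv_bracket_def
  by (rule lin_ext_uea_rels[OF scalar_map_id])
     (simp_all add: lin_ext_tensor_alg_incl[OF scalar_map_id])

lemma lin_ext_one:
  assumes "scalar_map sc" "\<phi> 0 = 1" shows "lin_ext sc \<phi> 1 = 1"
  using lin_ext_single[OF assms(1), of \<phi> 0 1] assms by (simp add: scalar_map_def)

lemma lin_ext_cong:
  assumes "ideal_cong R p q" and sc: "scalar_map sc"
    and m: "(\<forall>m n. \<phi> (m + n) = \<phi> m * \<phi> n) \<or> (\<forall>m n. \<phi> (m + n) = \<phi> n * \<phi> m)"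
    and "\<And>r. r \<in> R \<Longrightarrow> lin_ext sc \<phi> r = 0"
  shows "lin_ext sc \<phi> p = lin_ext sc \<phi> q"
proof -
  have "lin_ext sc \<phi> (p - q) = 0"
  proof (rule ideal_gen_vanish[where F = "lin_ext sc \<phi>"])
    show "p - q \<in> ideal_gen R" using assms(1) by (simp add: ideal_cong_def)
    show "(\<forall>x y. lin_ext sc \<phi> (x * y) = lin_ext sc \<phi> x * lin_ext sc \<phi> y) \<or>
        (\<forall>x y. lin_ext sc \<phi> (x * y) = lin_ext sc \<phi> y * lin_ext sc \<phi> x)"
      using m lin_ext_mult[OF sc, of \<phi>] lin_ext_mult_anti[OF sc, of \<phi>] by blast
  qed (use assms lin_ext_add[OF sc] in auto)
  then show ?thesis by (simp add: lin_ext_diff[OF sc])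
qed

lemma ideal_cong_refl: "ideal_cong R x x"
  by (simp add: ideal_cong_def ideal_gen.zero)

instantiation sv_uea :: (field_char_0) ring_1
begin

lift_definition zero_sv_uea :: "'a sv_uea" is 0 .
lift_definition one_sv_uea :: "'a sv_uea" is 1 .
lift_definition plus_sv_uea :: "'a sv_uea \<Rightarrow> 'a sv_uea \<Rightarrow> 'a sv_uea" is "(+)"
  by (rule ideal_cong_add)
lift_definition uminus_sv_uea :: "'a sv_uea \<Rightarrow> 'a sv_uea" is uminus
  by (rule ideal_cong_uminus)
lift_definition minus_sv_uea :: "'a sv_uea \<Rightarrow> 'a sv_uea \<Rightarrow> 'a sv_uea" is "(-)"
  by (rule ideal_cong_diff)
lift_definition times_sv_uea :: "'a sv_uea \<Rightarrow> 'a sv_uea \<Rightarrow> 'a sv_uea" is "(*)"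
  by (rule ideal_cong_mult)

instance
proof
  show "(0::'a sv_uea) \<noteq> 1"
  proof (transfer, rule notI)
    let ?F = "lin_ext (\<lambda>c. c) (word_prod (\<lambda>_. 0)) :: (sv_gen word \<Rightarrow>\<^sub>0 'a) \<Rightarrow> 'a"
    assume "ideal_cong (uea_rels sv_bracket) (0 :: sv_gen word \<Rightarrow>\<^sub>0 'a) 1"
    then have "?F 0 = ?F 1"
      by (rule lin_ext_cong)
         (use sv_counit_rels in \<open>auto simp: scalar_map_id word_prod_add\<close>)
    moreover have "?F 1 = 1"
      by (rule lin_ext_one) (simp_all add: scalar_map_id zero_word_def)
    ultimately show False by simp
  qed
qed (transfer, simp add: algebra_simps ideal_cong_refl)+

end

lift_definition uea_scalar :: "'a::field_char_0 \<Rightarrow> 'a sv_uea" is "\<lambda>c. Poly_Mapping.single 0 c" .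

lift_definition sv_incl :: "(sv_gen \<Rightarrow>\<^sub>0 'a::field_char_0) \<Rightarrow> 'a sv_uea" is tensor_alg_incl .

lemma single_0_central:
  "Poly_Mapping.single 0 c * p = p * Poly_Mapping.single 0 (c::'a::field)"
  by (subst (1 2) poly_mapping_expand[of p])
     (simp add: sum_distrib_left sum_distrib_right mult_single mult.commute)

lemma scalar_map_uea_scalar: "scalar_map uea_scalar"
  unfolding scalar_map_def
  by (intro conjI allI; transfer)
     (simp_all add: single_add mult_single ideal_cong_refl single_0_central)

text \<open>
  \<open>sv_counit\<close>, \<open>sv_antipode\<close> and \<open>sv_coproduct\<close> form the standard Hopf algebra structure; they are
  identified by their values on scalars and on the image of \<open>sv_incl\<close> together with (anti-)multiplicativity.
\<close>

lift_definition sv_counit :: "'a::field_char_0 sv_uea \<Rightarrow> 'a" is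
  "lin_ext (\<lambda>c. c) (word_prod (\<lambda>_. 0))"
  by (rule lin_ext_cong) (use sv_counit_rels in \<open>auto simp: scalar_map_id word_prod_add\<close>)

lemma sv_counit_simps:
  "sv_counit 0 = 0" "sv_counit 1 = 1"
  "sv_counit (u + v) = sv_counit u + sv_counit v"
  "sv_counit (u * v) = sv_counit u * sv_counit v"
  "sv_counit (uea_scalar c) = c" "sv_counit (sv_incl x) = 0"
  by (transfer, simp add: lin_ext_add lin_ext_mult lin_ext_single lin_ext_one scalar_map_id
      word_prod_add zero_word_def lin_ext_tensor_alg_incl)+

lemma sv_incl_expand:
  "sv_incl x = (\<Sum>g\<in>Poly_Mapping.keys x.
     uea_scalar (Poly_Mapping.lookup x g) * sv_incl (Poly_Mapping.single g 1))"
proof -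
  have *: "abs_sv_uea (sum f A) = (\<Sum>i\<in>A. abs_sv_uea (f i))" for f and A :: "sv_gen set"
    by (induction A rule: infinite_finite_induct)
       (simp_all add: zero_sv_uea.abs_eq plus_sv_uea.abs_eq[symmetric])
  have "sv_incl x = abs_sv_uea (tensor_alg_incl x)"
    by (simp add: sv_incl.abs_eq)
  also have "\<dots> = (\<Sum>g\<in>Poly_Mapping.keys x.
     abs_sv_uea (Poly_Mapping.single 0 (Poly_Mapping.lookup x g) * tensor_alg_incl (Poly_Mapping.single g 1)))"
    by (simp add: tensor_alg_incl_def * mult_single)
  finally show ?thesis
    by (simp add: uea_scalar.abs_eq sv_incl.abs_eq times_sv_uea.abs_eq)
qed

lemma sv_incl_commutator:
  "sv_incl x * sv_incl y - sv_incl y * sv_incl x = sv_incl (sv_bracket x y)"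
  by transfer (auto simp: ideal_cong_def uea_rels_def intro!: ideal_gen.gen)

lift_definition sv_antipode :: "'a::field_char_0 sv_uea \<Rightarrow> 'a sv_uea" is
  "lin_ext uea_scalar (word_prod_rev (\<lambda>g. - sv_incl (Poly_Mapping.single g 1)))"
proof (rule lin_ext_cong)
  fix r :: "sv_gen word \<Rightarrow>\<^sub>0 'a" assume "r \<in> uea_rels sv_bracket"
  then show "lin_ext uea_scalar (word_prod_rev (\<lambda>g. - sv_incl (Poly_Mapping.single g 1))) r = 0"
    unfolding sv_bracket_def
    by (rule lin_ext_uea_rels_anti[OF scalar_map_uea_scalar, rotated])
       (simp add: lin_ext_tensor_alg_incl[OF scalar_map_uea_scalar] sum_negf
          sv_incl_expand[symmetric] sv_bracket_single[symmetric] sv_incl_commutator[symmetric])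
qed (auto simp: scalar_map_uea_scalar word_prod_rev_add)

lemma sv_antipode_0: "sv_antipode 0 = 0"
  by (simp add: zero_sv_uea.abs_eq sv_antipode.abs_eq)

lemma sv_antipode_1: "sv_antipode 1 = 1"
  by (simp add: one_sv_uea.abs_eq sv_antipode.abs_eq) (simp add: lin_ext_one
      scalar_map_uea_scalar zero_word_def one_sv_uea.abs_eq)

lemma sv_antipode_add: "sv_antipode (u + v) = sv_antipode u + sv_antipode v"
  by transfer (simp add: lin_ext_add scalar_map_uea_scalar)

lemma sv_antipode_mult: "sv_antipode (u * v) = sv_antipode v * sv_antipode u"
  by transfer (simp add: lin_ext_mult_anti scalar_map_uea_scalar word_prod_rev_add)

lemma sv_antipode_scalar: "sv_antipode (uea_scalar c) = uea_scalar c"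
  by (subst (1) uea_scalar.abs_eq)
     (simp add: sv_antipode.abs_eq lin_ext_single scalar_map_uea_scalar zero_word_def)

lemma sv_antipode_incl: "sv_antipode (sv_incl x) = - sv_incl x"
  by (subst (1) sv_incl.abs_eq)
     (simp add: sv_antipode.abs_eq lin_ext_tensor_alg_incl scalar_map_uea_scalar sum_negf
       sv_incl_expand[symmetric])

section \<open>Tensor products\<close>

text \<open>
  The tensor product of two algebras: the free vector space on pairs, with the product
  \<open>(u, v) (u', v') = (u u', v v')\<close>, modulo bilinearity. A pair times a bilinearity relation is
  again such a relation, so the ideal generated by the relations is their linear span.
\<close>

definition tensor_gen :: "'u \<Rightarrow> 'v \<Rightarrow> ('u mon \<times> 'v mon \<Rightarrow>\<^sub>0 'a::field)" where
  "tensor_gen u v = Poly_Mapping.single (Mon u, Mon v) 1"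

definition tensor_rels ::
  "('a::field \<Rightarrow> 'u::ring_1) \<Rightarrow> ('a \<Rightarrow> 'v::ring_1) \<Rightarrow> ('u mon \<times> 'v mon \<Rightarrow>\<^sub>0 'a) set" where
  "tensor_rels sc1 sc2 =
    {tensor_gen (u + u') v - tensor_gen u v - tensor_gen u' v | u u' v. True} \<union>
    {tensor_gen u (v + v') - tensor_gen u v - tensor_gen u v' | u v v'. True} \<union>
    {tensor_gen (sc1 c * u) v - Poly_Mapping.single 0 c * tensor_gen u v | c u v. True} \<union>
    {tensor_gen u (sc2 c * v) - Poly_Mapping.single 0 c * tensor_gen u v | c u v. True}"

lemma tensor_relsI:
  "tensor_gen (u + u') v - tensor_gen u v - tensor_gen u' v \<in> tensor_rels sc1 sc2"
  "tensor_gen u (v + v') - tensor_gen u v - tensor_gen u v' \<in> tensor_rels sc1 sc2"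
  "tensor_gen (sc1 c * u) v - Poly_Mapping.single 0 c * tensor_gen u v \<in> tensor_rels sc1 sc2"
  "tensor_gen u (sc2 c * v) - Poly_Mapping.single 0 c * tensor_gen u v \<in> tensor_rels sc1 sc2"
  unfolding tensor_rels_def
     apply (rule UnI1, rule UnI1, rule UnI1, rule CollectI, intro exI conjI TrueI, rule refl)
    apply (rule UnI1, rule UnI1, rule UnI2, rule CollectI, intro exI conjI TrueI, rule refl)
   apply (rule UnI1, rule UnI2, rule CollectI, intro exI conjI TrueI, rule refl)
  apply (rule UnI2, rule CollectI, intro exI conjI TrueI, rule refl)
  done

fun mon_pair :: "('u \<Rightarrow> 'v \<Rightarrow> 'r) \<Rightarrow> 'u mon \<times> 'v mon \<Rightarrow> 'r" where
  "mon_pair \<beta> (Mon u, Mon v) = \<beta> u v"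

definition bilinear_over ::
  "('a::field \<Rightarrow> 'u::ring_1) \<Rightarrow> ('a \<Rightarrow> 'v::ring_1) \<Rightarrow> ('a \<Rightarrow> 'r::ring_1) \<Rightarrow> ('u \<Rightarrow> 'v \<Rightarrow> 'r) \<Rightarrow> bool" where
  "bilinear_over sc1 sc2 sc \<beta> \<longleftrightarrow>
    (\<forall>u u' v. \<beta> (u + u') v = \<beta> u v + \<beta> u' v) \<and> (\<forall>u v v'. \<beta> u (v + v') = \<beta> u v + \<beta> u v') \<and>
    (\<forall>c u v. \<beta> (sc1 c * u) v = sc c * \<beta> u v) \<and> (\<forall>c u v. \<beta> u (sc2 c * v) = sc c * \<beta> u v)"

lemma mon_pair_mult_add:
  assumes "\<And>u u' v v'. \<beta> (u * u') (v * v') = \<beta> u v * \<beta> u' v'"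
  shows "mon_pair \<beta> (m + n) = mon_pair \<beta> m * mon_pair \<beta> n"
proof (cases m; cases n)
  fix a b c d assume "m = (a, b)" "n = (c, d)"
  then show ?thesis by (cases a; cases b; cases c; cases d) (simp add: assms)
qed

lemma lin_ext_sandwich:
  assumes sc: "scalar_map sc"
    and *: "\<And>m n. lin_ext sc \<phi> (Poly_Mapping.single m 1 * r * Poly_Mapping.single n 1) = 0"
  shows "lin_ext sc \<phi> (a * r * b) = 0"
proof -
  have sandwich: "Poly_Mapping.single m c * r * Poly_Mapping.single n d =
      Poly_Mapping.single 0 c * (Poly_Mapping.single 0 d *
        (Poly_Mapping.single m 1 * r * Poly_Mapping.single n 1))" for m n c d
  proof -
    have "Poly_Mapping.single m c = Poly_Mapping.single 0 c * Poly_Mapping.single m 1"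
      and "Poly_Mapping.single n d = Poly_Mapping.single n 1 * Poly_Mapping.single 0 d"
      by (simp_all add: mult_single)
    then show ?thesis
      by (simp only: single_0_central[of d] mult.assoc)
  qed
  have s: "lin_ext sc \<phi> (Poly_Mapping.single 0 c * p) = sc c * lin_ext sc \<phi> p" for c p
  proof -
    have sm: "sc (a * b) = sc a * sc b" for a b using sc unfolding scalar_map_def by blast
    have "Poly_Mapping.single 0 c * p = (\<Sum>m\<in>Poly_Mapping.keys p.
        Poly_Mapping.single m (c * Poly_Mapping.lookup p m))"
      by (subst poly_mapping_expand[of p]) (simp add: sum_distrib_left mult_single)
    then have "lin_ext sc \<phi> (Poly_Mapping.single 0 c * p) = (\<Sum>m\<in>Poly_Mapping.keys p.
        sc (c * Poly_Mapping.lookup p m) * \<phi> m)"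
      by (simp add: lin_ext_sum[OF sc] lin_ext_single[OF sc])
    then show ?thesis
      by (simp add: sm lin_ext_def sum_distrib_left mult.assoc)
  qed
  have "a * r * b = (\<Sum>m\<in>Poly_Mapping.keys a. \<Sum>n\<in>Poly_Mapping.keys b.
     Poly_Mapping.single m (Poly_Mapping.lookup a m) * r * Poly_Mapping.single n (Poly_Mapping.lookup b n))"
    by (subst (1) poly_mapping_expand[of a], subst (1) poly_mapping_expand[of b])
       (simp add: sum_distrib_right sum_distrib_left mult.assoc, rule sum.swap)
  also have "\<dots> = (\<Sum>m\<in>Poly_Mapping.keys a. \<Sum>n\<in>Poly_Mapping.keys b.
     Poly_Mapping.single 0 (Poly_Mapping.lookup a m) * (Poly_Mapping.single 0 (Poly_Mapping.lookup b n) *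
      (Poly_Mapping.single m 1 * r * Poly_Mapping.single n 1)))"
    by (intro sum.cong refl sandwich)
  finally show ?thesis
    by (simp add: lin_ext_sum[OF sc] s *)
qed

lemma lin_ext_tensor_rels:
  fixes sc :: "'a::field \<Rightarrow> 'r::ring_1" and sc1 :: "'a \<Rightarrow> 'u::ring_1" and sc2 :: "'a \<Rightarrow> 'v::ring_1"
  assumes sc: "scalar_map sc" and sc1: "scalar_map sc1" and sc2: "scalar_map sc2"
    and b: "bilinear_over sc1 sc2 sc \<beta>" and r: "r \<in> ideal_gen (tensor_rels sc1 sc2)"
  shows "lin_ext sc (mon_pair \<beta>) r = 0"
proof -
  have sc_one: "sc 1 = 1" using sc by (simp add: scalar_map_def)
  have c1: "x * (sc1 c * y) = sc1 c * (x * y)" for x y c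
    using sc1 unfolding scalar_map_def by (metis mult.assoc)
  have c2: "x * (sc2 c * y) = sc2 c * (x * y)" for x y c
    using sc2 unfolding scalar_map_def by (metis mult.assoc)
  have "lin_ext sc (mon_pair \<beta>) (a * r * b) = 0" for a b
    using r
  proof (induction arbitrary: a b)
    case (gen r)
    show ?case
    proof (rule lin_ext_sandwich[OF sc])
      fix m n :: "'u mon \<times> 'v mon"
      obtain x y z w where "m = (Mon x, Mon y)" "n = (Mon z, Mon w)"
        by (metis mon.exhaust surj_pair)
      with gen b show "lin_ext sc (mon_pair \<beta>) (Poly_Mapping.single m 1 * r * Poly_Mapping.single n 1) = 0"
        unfolding tensor_rels_def tensor_gen_def bilinear_over_def
        by (auto simp: left_diff_distrib right_diff_distrib mult_single lin_ext_diff[OF sc]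
            lin_ext_single[OF sc] distrib_left distrib_right c1 c2 mult.assoc zero_prod_def
            zero_mon_def sc_one)
    qed
  next
    case (add x y)
    then show ?case by (simp add: distrib_left distrib_right lin_ext_add[OF sc])
  next
    case (mult x c d)
    from mult.IH[of "a * c" "d * b"] show ?case by (simp add: mult.assoc)
  qed simp
  from this[of 1 1] show ?thesis by simp
qed

lemma lin_ext_tensor_cong:
  assumes "ideal_cong (tensor_rels sc1 sc2) p q"
    and sc: "scalar_map sc" "scalar_map sc1" "scalar_map sc2" "bilinear_over sc1 sc2 sc \<beta>"
  shows "lin_ext sc (mon_pair \<beta>) p = lin_ext sc (mon_pair \<beta>) q"
  using lin_ext_tensor_rels[OF sc, of "p - q"] assms(1)
    lin_ext_diff[OF sc(1), of "mon_pair \<beta>" p q]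
  by (simp add: ideal_cong_def)

quotient_type (overloaded) 'a sv_uea2 =
  "'a sv_uea mon \<times> 'a sv_uea mon \<Rightarrow>\<^sub>0 'a::field_char_0" /
  "ideal_cong (tensor_rels uea_scalar uea_scalar)"
  by (rule equivp_ideal_cong)

lemma sv_counit_rels2:
  "r \<in> tensor_rels uea_scalar uea_scalar \<Longrightarrow>
    lin_ext (\<lambda>c. c) (mon_pair (\<lambda>u v. sv_counit u * sv_counit v)) r = 0"
  by (rule lin_ext_tensor_rels[OF scalar_map_id scalar_map_uea_scalar scalar_map_uea_scalar])
     (auto simp: bilinear_over_def sv_counit_simps algebra_simps intro: ideal_gen.gen)

instantiation sv_uea2 :: (field_char_0) ring_1
begin

lift_definition zero_sv_uea2 :: "'a sv_uea2" is 0 .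
lift_definition one_sv_uea2 :: "'a sv_uea2" is 1 .
lift_definition plus_sv_uea2 :: "'a sv_uea2 \<Rightarrow> 'a sv_uea2 \<Rightarrow> 'a sv_uea2" is "(+)"
  by (rule ideal_cong_add)
lift_definition uminus_sv_uea2 :: "'a sv_uea2 \<Rightarrow> 'a sv_uea2" is uminus
  by (rule ideal_cong_uminus)
lift_definition minus_sv_uea2 :: "'a sv_uea2 \<Rightarrow> 'a sv_uea2 \<Rightarrow> 'a sv_uea2" is "(-)"
  by (rule ideal_cong_diff)
lift_definition times_sv_uea2 :: "'a sv_uea2 \<Rightarrow> 'a sv_uea2 \<Rightarrow> 'a sv_uea2" is "(*)"
  by (rule ideal_cong_mult)

instance
proof
  show "(0::'a sv_uea2) \<noteq> 1"
  proof (transfer, rule notI)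
    let ?F = "lin_ext (\<lambda>c. c) (mon_pair (\<lambda>u v. sv_counit u * sv_counit v)) ::
      ('a sv_uea mon \<times> 'a sv_uea mon \<Rightarrow>\<^sub>0 'a) \<Rightarrow> 'a"
    assume "ideal_cong (tensor_rels uea_scalar uea_scalar)
      (0 :: 'a sv_uea mon \<times> 'a sv_uea mon \<Rightarrow>\<^sub>0 'a) 1"
    then have "?F 0 = ?F 1"
      by (rule lin_ext_cong)
         (use sv_counit_rels2 in \<open>auto simp: scalar_map_id sv_counit_simps
            mon_pair_mult_add mult_ac\<close>)
    moreover have "?F 1 = 1"
      by (rule lin_ext_one)
         (simp_all add: scalar_map_id zero_prod_def zero_mon_def sv_counit_simps)
    ultimately show False by simp
  qed
qed (transfer, simp add: algebra_simps ideal_cong_refl)+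

end

lift_definition uea2_scalar :: "'a::field_char_0 \<Rightarrow> 'a sv_uea2" is
  "\<lambda>c. Poly_Mapping.single 0 c" .

lemma scalar_map_uea2_scalar: "scalar_map uea2_scalar"
  unfolding scalar_map_def
  by (intro conjI allI; transfer)
     (simp_all add: single_add mult_single ideal_cong_refl single_0_central)

definition tensor2 :: "'a::field_char_0 sv_uea \<Rightarrow> 'a sv_uea \<Rightarrow> 'a sv_uea2" where
  "tensor2 u v = abs_sv_uea2 (tensor_gen u v)"

lemma tensor2_simps:
  fixes u u' :: "'a::field_char_0 sv_uea" and v v' :: "'a sv_uea"
  shows
  "tensor2 (u + u') v = tensor2 u v + tensor2 u' v"
  "tensor2 u (v + v') = tensor2 u v + tensor2 u v'"
  "tensor2 (uea_scalar c * u) v = uea2_scalar c * tensor2 u v"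
  "tensor2 u (uea_scalar c * v) = uea2_scalar c * tensor2 u v"
  "tensor2 u v * tensor2 u' v' = tensor2 (u * u') (v * v')"
  "tensor2 (1 :: 'a sv_uea) 1 = 1"
proof -
  show "tensor2 (u + u') v = tensor2 u v + tensor2 u' v"
    unfolding tensor2_def plus_sv_uea2.abs_eq uea2_scalar.abs_eq times_sv_uea2.abs_eq sv_uea2.abs_eq_iff
    unfolding ideal_cong_def diff_diff_eq[symmetric]
    by (rule ideal_gen.gen, rule tensor_relsI)
  show "tensor2 u (v + v') = tensor2 u v + tensor2 u v'"
    unfolding tensor2_def plus_sv_uea2.abs_eq uea2_scalar.abs_eq times_sv_uea2.abs_eq sv_uea2.abs_eq_iff
    unfolding ideal_cong_def diff_diff_eq[symmetric]
    by (rule ideal_gen.gen, rule tensor_relsI)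
  show "tensor2 (uea_scalar c * u) v = uea2_scalar c * tensor2 u v"
    unfolding tensor2_def plus_sv_uea2.abs_eq uea2_scalar.abs_eq times_sv_uea2.abs_eq sv_uea2.abs_eq_iff
    unfolding ideal_cong_def
    by (rule ideal_gen.gen, rule tensor_relsI)
  show "tensor2 u (uea_scalar c * v) = uea2_scalar c * tensor2 u v"
    unfolding tensor2_def plus_sv_uea2.abs_eq uea2_scalar.abs_eq times_sv_uea2.abs_eq sv_uea2.abs_eq_iff
    unfolding ideal_cong_def
    by (rule ideal_gen.gen, rule tensor_relsI)
  show "tensor2 u v * tensor2 u' v' = tensor2 (u * u') (v * v')"
    by (simp add: tensor2_def times_sv_uea2.abs_eq tensor_gen_def mult_single)
  have "tensor_gen (1 :: 'a sv_uea) (1 :: 'a sv_uea) = (1 :: _ \<Rightarrow>\<^sub>0 'a)"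
    by (simp add: tensor_gen_def zero_prod_def[symmetric] zero_mon_def[symmetric])
  then show "tensor2 (1 :: 'a sv_uea) 1 = 1"
    by (simp add: tensor2_def one_sv_uea2.abs_eq)
qed

text \<open>The linear map with \<open>u \<otimes> v \<mapsto> \<beta> u v\<close>; see \<open>tensor2_lift_tensor2\<close> for bilinear \<open>\<beta>\<close>.\<close>

definition tensor2_lift ::
  "('a::field_char_0 \<Rightarrow> 'r::ring_1) \<Rightarrow> ('a sv_uea \<Rightarrow> 'a sv_uea \<Rightarrow> 'r) \<Rightarrow> 'a sv_uea2 \<Rightarrow> 'r" where
  "tensor2_lift sc \<beta> w = lin_ext sc (mon_pair \<beta>) (rep_sv_uea2 w)"

lemma tensor2_lift_abs:
  assumes "scalar_map sc" "bilinear_over uea_scalar uea_scalar sc \<beta>"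
  shows "tensor2_lift sc \<beta> (abs_sv_uea2 p) = lin_ext sc (mon_pair \<beta>) p"
  unfolding tensor2_lift_def
  by (rule lin_ext_tensor_cong[OF _ assms(1) scalar_map_uea_scalar scalar_map_uea_scalar assms(2)])
     (metis Quotient3_sv_uea2 ideal_cong_refl rep_abs_rsp_left)

lemma tensor2_lift_tensor2:
  assumes "scalar_map sc" "bilinear_over uea_scalar uea_scalar sc \<beta>"
  shows "tensor2_lift sc \<beta> (tensor2 u v) = \<beta> u v"
proof -
  have "sc 1 = 1" using assms(1) by (simp add: scalar_map_def)
  then show ?thesis
    by (simp add: tensor2_def tensor2_lift_abs[OF assms] tensor_gen_def
        lin_ext_single[OF assms(1)])
qed

lemma tensor2_lift_add:
  assumes "scalar_map sc" "bilinear_over uea_scalar uea_scalar sc \<beta>"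
  shows "tensor2_lift sc \<beta> (w + w') = tensor2_lift sc \<beta> w + tensor2_lift sc \<beta> w'"
proof -
  obtain p q where "w = abs_sv_uea2 p" "w' = abs_sv_uea2 q"
    by (metis Quotient3_abs_rep Quotient3_sv_uea2)
  then show ?thesis
    by (simp add: plus_sv_uea2.abs_eq tensor2_lift_abs[OF assms] lin_ext_add[OF assms(1)])
qed

text \<open>
  The threefold tensor product is taken as $(U \otimes U) \otimes U$; the map \<open>tensor12\<close> below is
  \<open>u \<otimes> (a \<otimes> b) \<mapsto> (u \<otimes> a) \<otimes> b\<close>.
\<close>

quotient_type (overloaded) 'a sv_uea3 =
  "'a sv_uea2 mon \<times> 'a sv_uea mon \<Rightarrow>\<^sub>0 'a::field_char_0" /
  "ideal_cong (tensor_rels uea2_scalar uea_scalar)"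
  by (rule equivp_ideal_cong)

lift_definition sv_counit2 :: "'a::field_char_0 sv_uea2 \<Rightarrow> 'a" is
  "lin_ext (\<lambda>c. c) (mon_pair (\<lambda>u v. sv_counit u * sv_counit v))"
  by (rule lin_ext_cong)
     (use sv_counit_rels2 in \<open>auto simp: scalar_map_id sv_counit_simps mon_pair_mult_add mult_ac\<close>)

lemma sv_counit2_simps:
  "sv_counit2 0 = 0" "sv_counit2 1 = 1"
  "sv_counit2 (u + v) = sv_counit2 u + sv_counit2 v"
  "sv_counit2 (u * v) = sv_counit2 u * sv_counit2 v"
  "sv_counit2 (uea2_scalar c) = c"
  by (transfer, simp add: lin_ext_add lin_ext_mult lin_ext_single lin_ext_one scalar_map_id
      mon_pair_mult_add mult_ac zero_prod_def zero_mon_def sv_counit_simps)+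

lemma sv_counit_rels3:
  "r \<in> tensor_rels uea2_scalar uea_scalar \<Longrightarrow>
    lin_ext (\<lambda>c. c) (mon_pair (\<lambda>u v. sv_counit2 u * sv_counit v)) r = 0"
  by (rule lin_ext_tensor_rels[OF scalar_map_id scalar_map_uea2_scalar scalar_map_uea_scalar])
     (auto simp: bilinear_over_def sv_counit_simps sv_counit2_simps algebra_simps intro: ideal_gen.gen)

instantiation sv_uea3 :: (field_char_0) ring_1
begin

lift_definition zero_sv_uea3 :: "'a sv_uea3" is 0 .
lift_definition one_sv_uea3 :: "'a sv_uea3" is 1 .
lift_definition plus_sv_uea3 :: "'a sv_uea3 \<Rightarrow> 'a sv_uea3 \<Rightarrow> 'a sv_uea3" is "(+)"
  by (rule ideal_cong_add)
lift_definition uminus_sv_uea3 :: "'a sv_uea3 \<Rightarrow> 'a sv_uea3" is uminus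
  by (rule ideal_cong_uminus)
lift_definition minus_sv_uea3 :: "'a sv_uea3 \<Rightarrow> 'a sv_uea3 \<Rightarrow> 'a sv_uea3" is "(-)"
  by (rule ideal_cong_diff)
lift_definition times_sv_uea3 :: "'a sv_uea3 \<Rightarrow> 'a sv_uea3 \<Rightarrow> 'a sv_uea3" is "(*)"
  by (rule ideal_cong_mult)

instance
proof
  show "(0::'a sv_uea3) \<noteq> 1"
  proof (transfer, rule notI)
    let ?F = "lin_ext (\<lambda>c. c) (mon_pair (\<lambda>u v. sv_counit2 u * sv_counit v)) ::
      ('a sv_uea2 mon \<times> 'a sv_uea mon \<Rightarrow>\<^sub>0 'a) \<Rightarrow> 'a"
    assume "ideal_cong (tensor_rels uea2_scalar uea_scalar)
      (0 :: 'a sv_uea2 mon \<times> 'a sv_uea mon \<Rightarrow>\<^sub>0 'a) 1"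
    then have "?F 0 = ?F 1"
      by (rule lin_ext_cong)
         (use sv_counit_rels3 in \<open>auto simp: scalar_map_id sv_counit2_simps sv_counit_simps
            mon_pair_mult_add mult_ac\<close>)
    moreover have "?F 1 = 1"
      by (rule lin_ext_one)
         (simp_all add: scalar_map_id zero_prod_def zero_mon_def sv_counit2_simps sv_counit_simps)
    ultimately show False by simp
  qed
qed (transfer, simp add: algebra_simps ideal_cong_refl)+

end

lift_definition uea3_scalar :: "'a::field_char_0 \<Rightarrow> 'a sv_uea3" is
  "\<lambda>c. Poly_Mapping.single 0 c" .

lemma scalar_map_uea3_scalar: "scalar_map uea3_scalar"
  unfolding scalar_map_def
  by (intro conjI allI; transfer)
     (simp_all add: single_add mult_single ideal_cong_refl single_0_central)

definition tensor3 :: "'a::field_char_0 sv_uea2 \<Rightarrow> 'a sv_uea \<Rightarrow> 'a sv_uea3" where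
  "tensor3 u v = abs_sv_uea3 (tensor_gen u v)"

lemma tensor3_simps:
  fixes u u' :: "'a::field_char_0 sv_uea2" and v v' :: "'a sv_uea"
  shows
  "tensor3 (u + u') v = tensor3 u v + tensor3 u' v"
  "tensor3 u (v + v') = tensor3 u v + tensor3 u v'"
  "tensor3 (uea2_scalar c * u) v = uea3_scalar c * tensor3 u v"
  "tensor3 u (uea_scalar c * v) = uea3_scalar c * tensor3 u v"
  "tensor3 u v * tensor3 u' v' = tensor3 (u * u') (v * v')"
  "tensor3 (1 :: 'a sv_uea2) 1 = 1"
proof -
  show "tensor3 (u + u') v = tensor3 u v + tensor3 u' v"
    unfolding tensor3_def plus_sv_uea3.abs_eq uea3_scalar.abs_eq times_sv_uea3.abs_eq sv_uea3.abs_eq_iff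
    unfolding ideal_cong_def diff_diff_eq[symmetric]
    by (rule ideal_gen.gen, rule tensor_relsI)
  show "tensor3 u (v + v') = tensor3 u v + tensor3 u v'"
    unfolding tensor3_def plus_sv_uea3.abs_eq uea3_scalar.abs_eq times_sv_uea3.abs_eq sv_uea3.abs_eq_iff
    unfolding ideal_cong_def diff_diff_eq[symmetric]
    by (rule ideal_gen.gen, rule tensor_relsI)
  show "tensor3 (uea2_scalar c * u) v = uea3_scalar c * tensor3 u v"
    unfolding tensor3_def plus_sv_uea3.abs_eq uea3_scalar.abs_eq times_sv_uea3.abs_eq sv_uea3.abs_eq_iff
    unfolding ideal_cong_def
    by (rule ideal_gen.gen, rule tensor_relsI)
  show "tensor3 u (uea_scalar c * v) = uea3_scalar c * tensor3 u v"
    unfolding tensor3_def plus_sv_uea3.abs_eq uea3_scalar.abs_eq times_sv_uea3.abs_eq sv_uea3.abs_eq_iff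
    unfolding ideal_cong_def
    by (rule ideal_gen.gen, rule tensor_relsI)
  show "tensor3 u v * tensor3 u' v' = tensor3 (u * u') (v * v')"
    by (simp add: tensor3_def times_sv_uea3.abs_eq tensor_gen_def mult_single)
  have "tensor_gen (1 :: 'a sv_uea2) (1 :: 'a sv_uea) = (1 :: _ \<Rightarrow>\<^sub>0 'a)"
    by (simp add: tensor_gen_def zero_prod_def[symmetric] zero_mon_def[symmetric])
  then show "tensor3 (1 :: 'a sv_uea2) 1 = 1"
    by (simp add: tensor3_def one_sv_uea3.abs_eq)
qed

definition tensor12 :: "'a::field_char_0 sv_uea \<Rightarrow> 'a sv_uea2 \<Rightarrow> 'a sv_uea3" where
  "tensor12 u = tensor2_lift uea3_scalar (\<lambda>a b. tensor3 (tensor2 u a) b)"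

lemma tensor12_tensor2: "tensor12 u (tensor2 a b) = tensor3 (tensor2 u a) b"
  unfolding tensor12_def
  by (rule tensor2_lift_tensor2[OF scalar_map_uea3_scalar])
     (simp add: bilinear_over_def tensor2_simps tensor3_simps)

lemma sv_primitive_lin_ext:
  "lin_ext uea2_scalar (word_prod (\<lambda>g. tensor2 (sv_incl (Poly_Mapping.single g 1)) 1
      + tensor2 1 (sv_incl (Poly_Mapping.single g 1)))) (tensor_alg_incl x)
    = tensor2 (sv_incl x) 1 + tensor2 1 (sv_incl x)"
proof -
  have z: "tensor2 0 1 = 0" "tensor2 1 0 = 0"
    using tensor2_simps(1)[of 0 0 1] tensor2_simps(2)[of 1 0 0] by simp_all
  have sums: "tensor2 (sum f A) 1 = (\<Sum>i\<in>A. tensor2 (f i) 1)"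
    "tensor2 1 (sum f A) = (\<Sum>i\<in>A. tensor2 1 (f i))" for f and A :: "sv_gen set"
    by (induction A rule: infinite_finite_induct) (simp_all add: tensor2_simps z)
  have "tensor2 (sv_incl x) 1 = (\<Sum>g\<in>Poly_Mapping.keys x.
      uea2_scalar (Poly_Mapping.lookup x g) * tensor2 (sv_incl (Poly_Mapping.single g 1)) 1)"
    and "tensor2 1 (sv_incl x) = (\<Sum>g\<in>Poly_Mapping.keys x.
      uea2_scalar (Poly_Mapping.lookup x g) * tensor2 1 (sv_incl (Poly_Mapping.single g 1)))"
    by (simp_all add: sv_incl_expand[of x] sums tensor2_simps)
  then show ?thesis
    by (simp add: lin_ext_tensor_alg_incl scalar_map_uea2_scalar sum.distrib distrib_left)
qed

lift_definition sv_coproduct :: "'a::field_char_0 sv_uea \<Rightarrow> 'a sv_uea2" is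
  "lin_ext uea2_scalar (word_prod (\<lambda>g. tensor2 (sv_incl (Poly_Mapping.single g 1)) 1
      + tensor2 1 (sv_incl (Poly_Mapping.single g 1))))"
proof (rule lin_ext_cong)
  let ?f = "\<lambda>g. tensor2 (sv_incl (Poly_Mapping.single g (1::'a))) 1
      + tensor2 1 (sv_incl (Poly_Mapping.single g 1))"
  have z: "tensor2 0 1 = 0" "tensor2 1 0 = 0"
    using tensor2_simps(1)[of 0 0 1] tensor2_simps(2)[of 1 0 0] by simp_all
  have neg1: "tensor2 (- u) 1 = - tensor2 u 1" for u :: "'a sv_uea"
  proof -
    have "tensor2 u 1 + tensor2 (- u) 1 = 0"
      unfolding tensor2_simps(1)[symmetric] by (simp add: z)
    then show ?thesis by (rule minus_unique[symmetric])
  qed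
  have neg2: "tensor2 1 (- u) = - tensor2 1 u" for u :: "'a sv_uea"
  proof -
    have "tensor2 1 u + tensor2 1 (- u) = 0"
      unfolding tensor2_simps(2)[symmetric] by (simp add: z)
    then show ?thesis by (rule minus_unique[symmetric])
  qed
  have diff: "tensor2 (u - v) 1 = tensor2 u 1 - tensor2 v 1"
    "tensor2 1 (u - v) = tensor2 1 u - tensor2 1 v" for u v :: "'a sv_uea"
    using tensor2_simps(1)[of u "- v" 1] tensor2_simps(2)[of 1 u "- v"] by (simp_all add: neg1 neg2)
  fix r :: "sv_gen word \<Rightarrow>\<^sub>0 'a" assume "r \<in> uea_rels sv_bracket"
  then show "lin_ext uea2_scalar (word_prod ?f) r = 0"
    unfolding sv_bracket_def
    by (rule lin_ext_uea_rels[OF scalar_map_uea2_scalar, rotated])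
       (simp add: sv_primitive_lin_ext sv_bracket_single[symmetric] sv_incl_commutator[symmetric]
         diff distrib_left distrib_right tensor2_simps)
qed (auto simp: scalar_map_uea2_scalar word_prod_add)

lemma sv_coproduct_1: "sv_coproduct 1 = 1"
  by (simp add: one_sv_uea.abs_eq sv_coproduct.abs_eq lin_ext_one scalar_map_uea2_scalar
      zero_word_def)

lemma sv_coproduct_add: "sv_coproduct (u + v) = sv_coproduct u + sv_coproduct v"
  by transfer (simp add: lin_ext_add scalar_map_uea2_scalar)

lemma sv_coproduct_mult: "sv_coproduct (u * v) = sv_coproduct u * sv_coproduct v"
  by transfer (simp add: lin_ext_mult scalar_map_uea2_scalar word_prod_add)

lemma sv_coproduct_scalar: "sv_coproduct (uea_scalar c) = uea2_scalar c"
  by (simp add: uea_scalar.abs_eq sv_coproduct.abs_eq lin_ext_single scalar_map_uea2_scalar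
      zero_word_def)

lemma sv_coproduct_incl: "sv_coproduct (sv_incl x) = tensor2 (sv_incl x) 1 + tensor2 1 (sv_incl x)"
  by (subst (1) sv_incl.abs_eq) (simp add: sv_coproduct.abs_eq sv_primitive_lin_ext)

section \<open>Topological Hopf algebra structures over formal power series\<close>

text \<open>
  Maps that are linear over the power series in the central variable are automatically continuous
  for the adic topology, so additivity and compatibility with power series scalars suffice.
\<close>

definition fps_scalar :: "('a::field \<Rightarrow> 'r::ring_1) \<Rightarrow> 'a fps \<Rightarrow> 'r fps" where
  "fps_scalar sc c = Abs_fps (\<lambda>n. sc (fps_nth c n))"

definition fps_bilin :: "('u \<Rightarrow> 'v \<Rightarrow> 'w::comm_monoid_add) \<Rightarrow> 'u fps \<Rightarrow> 'v fps \<Rightarrow> 'w fps" where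
  "fps_bilin \<beta> f g = Abs_fps (\<lambda>n. \<Sum>i=0..n. \<beta> (fps_nth f i) (fps_nth g (n - i)))"

abbreviation fps_tensor ::
  "'a::field_char_0 sv_uea fps \<Rightarrow> 'a sv_uea fps \<Rightarrow> 'a sv_uea2 fps" (infixl "\<otimes>\<^sub>t" 68) where
  "f \<otimes>\<^sub>t g \<equiv> fps_bilin tensor2 f g"

text \<open>
  The linear map over power series with \<open>u \<otimes> v \<mapsto> B u v\<close> for \<open>u\<close>, \<open>v\<close> in the enveloping algebra;
  this gives the completed tensor product of maps.
\<close>

definition fps_tensor_lift ::
  "('a::field_char_0 \<Rightarrow> 'r::ring_1) \<Rightarrow> ('a sv_uea \<Rightarrow> 'a sv_uea \<Rightarrow> 'r fps) \<Rightarrow> 'a sv_uea2 fps \<Rightarrow> 'r fps" where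
  "fps_tensor_lift sc B w =
    Abs_fps (\<lambda>n. \<Sum>i=0..n. tensor2_lift sc (\<lambda>u v. fps_nth (B u v) i) (fps_nth w (n - i)))"

locale sv_topological_hopf_algebra =
  fixes comul :: "'a::field_char_0 sv_uea fps \<Rightarrow> 'a sv_uea2 fps"
    and counit :: "'a sv_uea fps \<Rightarrow> 'a fps"
    and antipode :: "'a sv_uea fps \<Rightarrow> 'a sv_uea fps"
  assumes comul_add: "comul (f + g) = comul f + comul g"
    and comul_scalar: "comul (fps_scalar uea_scalar c * f) = fps_scalar uea2_scalar c * comul f"
    and comul_one: "comul 1 = 1"
    and comul_mult: "comul (f * g) = comul f * comul g"
    and counit_add: "counit (f + g) = counit f + counit g"
    and counit_scalar: "counit (fps_scalar uea_scalar c * f) = c * counit f"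
    and counit_one: "counit 1 = 1"
    and counit_mult: "counit (f * g) = counit f * counit g"
    and antipode_add: "antipode (f + g) = antipode f + antipode g"
    and antipode_scalar: "antipode (fps_scalar uea_scalar c * f) = fps_scalar uea_scalar c * antipode f"
    and antipode_one: "antipode 1 = 1"
    and antipode_mult: "antipode (f * g) = antipode g * antipode f"
    and coassoc:
      "fps_tensor_lift uea3_scalar
         (\<lambda>u v. fps_bilin tensor3 (comul (fps_const u)) (fps_const v)) (comul f) =
       fps_tensor_lift uea3_scalar
         (\<lambda>u v. fps_bilin tensor12 (fps_const u) (comul (fps_const v))) (comul f)"
    and counit_left:
      "fps_tensor_lift uea_scalar
         (\<lambda>u v. fps_scalar uea_scalar (counit (fps_const u)) * fps_const v) (comul f) = f"
    and counit_right:
      "fps_tensor_lift uea_scalar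
         (\<lambda>u v. fps_const u * fps_scalar uea_scalar (counit (fps_const v))) (comul f) = f"
    and antipode_left:
      "fps_tensor_lift uea_scalar (\<lambda>u v. antipode (fps_const u) * fps_const v) (comul f) =
        fps_scalar uea_scalar (counit f)"
    and antipode_right:
      "fps_tensor_lift uea_scalar (\<lambda>u v. fps_const u * antipode (fps_const v)) (comul f) =
        fps_scalar uea_scalar (counit f)"

definition fps_flip :: "'a::field_char_0 sv_uea2 fps \<Rightarrow> 'a sv_uea2 fps" where
  "fps_flip = fps_tensor_lift uea2_scalar (\<lambda>u v. fps_const (tensor2 v u))"

definition cocommutative :: "('a::field_char_0 sv_uea fps \<Rightarrow> 'a sv_uea2 fps) \<Rightarrow> bool" where
  "cocommutative comul \<longleftrightarrow> (\<forall>f. fps_flip (comul f) = comul f)"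

text \<open>
  The quotient of the Hopf algebra by the ideal generated by the variable is isomorphic to the
  enveloping algebra with its standard Hopf structure: there is a surjective homomorphism of Hopf
  algebras, over the evaluation of scalars at zero, whose kernel is that ideal. In the condition on
  the comultiplication, \<open>tensor2_lift\<close> is $\pi \otimes \pi$; the latter vanishes on multiples of the
  variable, hence only depends on the constant coefficient.
\<close>

definition quotient_iso_standard_hopf ::
  "('a::field_char_0 sv_uea fps \<Rightarrow> 'a sv_uea2 fps) \<Rightarrow> ('a sv_uea fps \<Rightarrow> 'a fps) \<Rightarrow>
   ('a sv_uea fps \<Rightarrow> 'a sv_uea fps) \<Rightarrow> bool" where
  "quotient_iso_standard_hopf comul counit antipode \<longleftrightarrow>
    (\<exists>\<pi> :: 'a sv_uea fps \<Rightarrow> 'a sv_uea.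
      surj \<pi> \<and> (\<forall>f. \<pi> f = 0 \<longleftrightarrow> (\<exists>g. f = fps_X * g)) \<and>
      (\<forall>f g. \<pi> (f + g) = \<pi> f + \<pi> g) \<and> \<pi> 1 = 1 \<and> (\<forall>f g. \<pi> (f * g) = \<pi> f * \<pi> g) \<and>
      (\<forall>c f. \<pi> (fps_scalar uea_scalar c * f) = uea_scalar (fps_nth c 0) * \<pi> f) \<and>
      (\<forall>f. sv_coproduct (\<pi> f) =
        tensor2_lift uea2_scalar (\<lambda>u v. tensor2 (\<pi> (fps_const u)) (\<pi> (fps_const v)))
          (fps_nth (comul f) 0)) \<and>
      (\<forall>f. sv_counit (\<pi> f) = fps_nth (counit f) 0) \<and>
      (\<forall>f. sv_antipode (\<pi> f) = \<pi> (antipode f)))"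

section \<open>Elements of the deformed enveloping algebra\<close>

definition sv_L :: "int \<Rightarrow> 'a::field_char_0 sv_uea" where
  "sv_L n = sv_incl (Poly_Mapping.single (GenL n) 1)"

definition sv_Y :: "int \<Rightarrow> 'a::field_char_0 sv_uea" where
  "sv_Y j = sv_incl (Poly_Mapping.single (GenY j) 1)"

definition sv_M :: "int \<Rightarrow> 'a::field_char_0 sv_uea" where
  "sv_M n = sv_incl (Poly_Mapping.single (GenM n) 1)"

definition fps_sv_counit :: "'a::field_char_0 sv_uea fps \<Rightarrow> 'a fps" where
  "fps_sv_counit f = Abs_fps (\<lambda>n. sv_counit (fps_nth f n))"

text \<open>The series $(1 - e t)^c$.\<close>

definition one_minus_powr :: "'a::field_char_0 sv_uea \<Rightarrow> 'a \<Rightarrow> 'a sv_uea fps" where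
  "one_minus_powr e c = Abs_fps (\<lambda>m. uea_scalar ((-1) ^ m * (c gchoose m)) * e ^ m)"

text \<open>The product $x_a^{[n]} = (x + a)(x + a - 1) \cdots (x + a - n + 1)$.\<close>

definition shifted_falling :: "'a::field_char_0 sv_uea \<Rightarrow> 'a \<Rightarrow> nat \<Rightarrow> 'a sv_uea" where
  "shifted_falling x a n = prod_list (map (\<lambda>i. x + uea_scalar a - of_nat i) [0..<n])"

end

theory Submission
  imports Defs
begin

text \<open>
  The comultiplication \<open>\<Delta>\<close> is the algebra homomorphism with the prescribed values on the generators,
  and the antipode is \<open>S = \<rho> \<circ> S\<^sub>0\<close> for the algebra homomorphism \<open>\<rho>\<close> whose values on the generators are
  the negatives of those prescribed for \<open>S\<close>. Everything about $(1 - et)^c$ that is needed to check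
  the defining relations follows from
  $[L_m, (1 - et)^c] = - c n_0 t (1 - et)^{c-1} M_{m+n_0}$. The Hopf algebra axioms then only have to
  be checked on generators, where they reduce to
  $\Delta((1 - et)^c) = (1 - et)^c \otimes (1 - et)^c$ and $S((1 - et)^c) = (1 - et)^{-c}$.
  These two are instances of the rule $(1 + x)^c (1 + y)^c = ((1 + x)(1 + y))^c$ for commuting power
  series without constant term, because $\Delta(1 - et) = (1 - et) \otimes (1 - et)$ and
  $(1 - et) S(1 - et) = 1$.
\<close>

text \<open>Direct verification is feasible because e = M_{n0} commutes with every M_k and Y_p,
  while [L_m, e] = n0 M_{m+n0} again commutes with e. Hence the powers of 1 - et obey the chain rule
  under ad L_m, and among the generators only the L_m fail to commute with them. Moreover L_0 acts
  on each generator x by its degree, which up to the factor n0 is also the exponent accompanying x.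
  This is why the summand with n0 h = L_0 in \<open>\<Delta>\<close> cancels the terms x \<otimes>
  [L_m, (1 - et)^c] that arise from x \<otimes> (1 - et)^c. The universal property of the enveloping
  algebra yields homomorphisms only; composing with S_0 turns one into the antihomomorphism that the
  antipode has to be. The binomial rule for commuting series over a noncommutative ring is obtained
  from uniqueness for a linear differential equation in t, whose solutions are determined
  coefficient by coefficient after division by n + 1.\<close>

unbundle fps_syntax

section \<open>Substitution into power series over a noncommutative ring\<close>

text \<open>
  For \<open>z = fps_X\<close> these are the maps compatible with the variable, which are determined by their
  values on constants; another \<open>z\<close> occurs when \<open>z\<close> is substituted for the variable.
\<close>

definition fps_lin :: "'r::ring_1 fps \<Rightarrow> ('u::ring_1 fps \<Rightarrow> 'r fps) \<Rightarrow> bool" where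
  "fps_lin z F \<longleftrightarrow> (\<forall>f g. F (f + g) = F f + F g) \<and> (\<forall>f. F (fps_X * f) = z * F f)"

lemma fps_decomp: "f = fps_const (f $ 0) + fps_X * fps_shift 1 (f :: 'u::ring_1 fps)"
  by (rule fps_ext) simp

lemma mult_nth_cong_lower:
  assumes "z $ 0 = (0::'r::ring_1)" "\<And>k. k < n \<Longrightarrow> f $ k = g $ k"
  shows "(z * f) $ n = (z * g) $ n"
  unfolding fps_mult_nth
proof (rule sum.cong[OF refl])
  fix i assume "i \<in> {0..n}"
  then show "z $ i * f $ (n - i) = z $ i * g $ (n - i)"
    using assms by (cases "i = 0") auto
qed

text \<open>Write f = f_0 + X f'. Since z has no constant term, coefficient n of F f is determined
  by F on the constant f_0 and by the coefficients of F f' below n. The induction has to range over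
  all series at once, because f' replaces f.\<close>

lemma fps_lin_eqI:
  assumes z: "z $ 0 = 0" and F: "fps_lin z F" and G: "fps_lin z G"
    and c: "\<And>a. F (fps_const a) = G (fps_const a)"
  shows "F f = G f"
proof -
  have "\<forall>f. F f $ n = G f $ n" for n
  proof (induction n rule: less_induct)
    case (less n)
    show ?case
    proof
      fix f
      have "F f = F (fps_const (f $ 0)) + z * F (fps_shift 1 f)"
        "G f = G (fps_const (f $ 0)) + z * G (fps_shift 1 f)"
        using F G fps_decomp[of f] unfolding fps_lin_def by metis+
      then show "F f $ n = G f $ n"
        using mult_nth_cong_lower[of z n "F (fps_shift 1 f)" "G (fps_shift 1 f)"] less z c by simp
    qed
  qed
  then show ?thesis by (simp add: fps_eq_iff)
qed

lemma fps_lin_0: "fps_lin z F \<Longrightarrow> F 0 = 0"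
  unfolding fps_lin_def by (metis add_cancel_left_left add_0)

lemma fps_lin_uminus: "fps_lin z F \<Longrightarrow> F (- f) = - F f"
  using fps_lin_0[of z F] unfolding fps_lin_def by (metis add.right_inverse minus_unique)

lemma fps_lin_diff: "fps_lin z F \<Longrightarrow> F (f - g) = F f - F g"
  using fps_lin_uminus[of z F g] unfolding fps_lin_def by (metis add_uminus_conv_diff)

lemma fps_lin_add: "fps_lin z F \<Longrightarrow> F (f + g) = F f + F g"
  by (simp add: fps_lin_def)

lemma fps_lin_X: "fps_lin z F \<Longrightarrow> F (fps_X * f) = z * F f"
  by (simp add: fps_lin_def)

lemma fps_lin_comp: "fps_lin z F \<Longrightarrow> fps_lin fps_X G \<Longrightarrow> fps_lin z (\<lambda>f. F (G f))"
  by (simp add: fps_lin_def)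

lemma fps_lin_mult_right: "fps_lin z F \<Longrightarrow> fps_lin z (\<lambda>f. F f * g)"
  by (simp add: fps_lin_def algebra_simps)

lemma fps_lin_mult_left: "fps_lin z F \<Longrightarrow> z * g = g * z \<Longrightarrow> fps_lin z (\<lambda>f. g * F f)"
  by (simp add: fps_lin_def algebra_simps) (metis mult.assoc)

lemma X_central: "x * fps_X = fps_X * (x :: 'r::ring_1 fps)"
  by (simp add: fps_mult_fps_X_commute)

lemma X_left_commute: "x * (fps_X * y) = fps_X * (x * y :: 'r::ring_1 fps)"
  by (metis X_central mult.assoc)

lemma fps_lin_id: "fps_lin fps_X (\<lambda>f. f)"
  by (simp add: fps_lin_def)

text \<open>Two passes of \<open>fps_lin_eqI\<close>: the right factor varies while the left one is
  constant, then the left one varies. The first pass moves z across the image of a constant, which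
  is what \<open>zc\<close> is for.\<close>

lemma fps_lin_mult_hom:
  assumes z: "z $ 0 = 0" and F: "fps_lin z F"
    and zc: "\<And>a. F (fps_const a) * z = z * F (fps_const a)"
    and c: "\<And>a b. F (fps_const (a * b)) = F (fps_const a) * F (fps_const b)"
  shows "F (f * g) = F f * F g"
proof -
  have L: "fps_lin z (\<lambda>g. F (fps_const a * g))" for a
    unfolding fps_lin_def
    by (simp add: distrib_left fps_lin_add[OF F] X_left_commute fps_lin_X[OF F])
  have 1: "F (fps_const a * g) = F (fps_const a) * F g" for a g
    by (rule fps_lin_eqI[OF z L fps_lin_mult_left[OF F zc[symmetric]]]) (simp add: c)
  have R: "fps_lin z (\<lambda>f. F (f * g))"
    unfolding fps_lin_def
    by (simp add: distrib_right fps_lin_add[OF F] mult.assoc fps_lin_X[OF F])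
  show ?thesis
    by (rule fps_lin_eqI[OF z R fps_lin_mult_right[OF F]]) (rule 1)
qed

lemma fps_lin_mult_antihom:
  assumes F: "fps_lin fps_X F"
    and c: "\<And>a b. F (fps_const (a * b)) = F (fps_const b) * F (fps_const a)"
  shows "F (f * g) = F g * F f"
proof -
  have z: "fps_X $ 0 = 0" by simp
  have L: "fps_lin fps_X (\<lambda>g. F (fps_const a * g))" for a
    unfolding fps_lin_def
    by (simp add: distrib_left fps_lin_add[OF F] X_left_commute fps_lin_X[OF F])
  have 1: "F (fps_const a * g) = F g * F (fps_const a)" for a g
    by (rule fps_lin_eqI[OF z L fps_lin_mult_right[OF F]]) (simp add: c)
  have R: "fps_lin fps_X (\<lambda>f. F (f * g))"
    unfolding fps_lin_def
    by (simp add: distrib_right fps_lin_add[OF F] mult.assoc fps_lin_X[OF F])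
  show ?thesis
    by (rule fps_lin_eqI[OF z R fps_lin_mult_left[OF F X_central[symmetric]]]) (rule 1)
qed

text \<open>The extension of G that is linear over t: it sends the sum of the f_k t^k to the sum of
  the G(f_k) t^k. Each coefficient of the result is a finite sum, so no convergence is
  involved.\<close>

definition fps_extend :: "('u::ring_1 \<Rightarrow> 'r::ring_1 fps) \<Rightarrow> 'u fps \<Rightarrow> 'r fps" where
  "fps_extend G f = Abs_fps (\<lambda>n. \<Sum>i=0..n. G (f $ (n - i)) $ i)"

lemma fps_lin_extend:
  assumes G: "\<And>u v. G (u + v) = G u + G v"
  shows "fps_lin fps_X (fps_extend G)"
  unfolding fps_lin_def
proof (intro conjI allI)
  have G0: "G 0 = 0"
    using G[of 0 0] by simp
  fix f g
  show "fps_extend G (f + g) = fps_extend G f + fps_extend G g"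
    by (rule fps_ext) (simp add: fps_extend_def G sum.distrib)
  show "fps_extend G (fps_X * f) = fps_X * fps_extend G f"
  proof (rule fps_ext)
    fix n
    show "fps_extend G (fps_X * f) $ n = (fps_X * fps_extend G f) $ n"
    proof (cases n)
      case (Suc m)
      then show ?thesis
        by (simp add: fps_extend_def G0 Suc_diff_le)
    qed (simp add: fps_extend_def G0)
  qed
qed

lemma fps_extend_const:
  assumes G: "\<And>u v. G (u + v) = G u + G v"
  shows "fps_extend G (fps_const u) = G u"
proof (rule fps_ext)
  fix n
  have G0: "G 0 = 0" using G[of 0 0] by simp
  have "(\<Sum>i=0..n. G (fps_const u $ (n - i)) $ i) = (\<Sum>i=0..n. if i = n then G u $ i else 0)"
    by (rule sum.cong) (auto simp: G0)
  then show "fps_extend G (fps_const u) $ n = G u $ n"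
    by (simp add: fps_extend_def)
qed

text \<open>The coefficients come from the field and are embedded centrally. This keeps substitution
  multiplicative in the series although the target ring is noncommutative.\<close>

definition fps_eval :: "('a::field \<Rightarrow> 'r::ring_1) \<Rightarrow> 'r fps \<Rightarrow> 'a fps \<Rightarrow> 'r fps" where
  "fps_eval sc w f = fps_scalar sc f oo w"

lemma power_nth_eq_0:
  assumes "w $ 0 = (0::'r::ring_1)" "n < i" shows "(w ^ i) $ n = 0"
  using assms(2)
proof (induction i arbitrary: n)
  case (Suc i)
  have "w $ k * (w ^ i) $ (n - k) = 0" if "k \<le> n" for k
    using that Suc assms(1) by (cases "k = 0") auto
  then show ?case by (simp add: fps_mult_nth)
qed simp

text \<open>The free upper bound allows several coefficients to be written as sums over one common
  range, as the exchange of sums in \<open>fps_lin_eval\<close> requires.\<close>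

lemma fps_eval_nth:
  assumes "w $ 0 = 0" "n \<le> N"
  shows "fps_eval sc w f $ n = (\<Sum>i=0..N. sc (f $ i) * (w ^ i) $ n)"
  unfolding fps_eval_def fps_compose_nth fps_scalar_def
  using assms by (auto intro!: sum.mono_neutral_left simp: power_nth_eq_0)

lemma fps_lin_eval:
  assumes sc: "scalar_map sc" and w: "w $ 0 = 0"
  shows "fps_lin w (fps_eval sc w)"
  unfolding fps_lin_def
proof (intro conjI allI)
  have sa: "sc (a + b) = sc a + sc b" "sc a * x = x * sc a" for a b x
    using sc unfolding scalar_map_def by blast+
  fix f g
  show "fps_eval sc w (f + g) = fps_eval sc w f + fps_eval sc w g"
    by (rule fps_ext) (simp add: fps_eval_nth[OF w le_refl] sa(1) distrib_right sum.distrib)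
  show "fps_eval sc w (fps_X * f) = w * fps_eval sc w f"
  proof (rule fps_ext)
    fix n
    have "fps_eval sc w (fps_X * f) $ n = (\<Sum>i=0..Suc n. sc ((fps_X * f) $ i) * (w ^ i) $ n)"
      by (rule fps_eval_nth[OF w]) simp
    also have "\<dots> = (\<Sum>i=0..n. sc (f $ i) * (w ^ Suc i) $ n)"
      by (simp only: sum.atLeast0_atMost_Suc_shift) (simp add: scalar_map_0[OF sc])
    also have "\<dots> = (\<Sum>i=0..n. \<Sum>j=0..n. w $ j * (sc (f $ i) * (w ^ i) $ (n - j)))"
    proof (rule sum.cong[OF refl])
      fix i
      have "sc (f $ i) * (x * y) = x * (sc (f $ i) * y)" for x y
        by (metis sa(2) mult.assoc)
      then show "sc (f $ i) * (w ^ Suc i) $ n = (\<Sum>j=0..n. w $ j * (sc (f $ i) * (w ^ i) $ (n - j)))"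
        by (simp add: fps_mult_nth sum_distrib_left)
    qed
    also have "\<dots> = (\<Sum>j=0..n. w $ j * fps_eval sc w f $ (n - j))"
      by (subst sum.swap) (simp add: fps_eval_nth[OF w diff_le_self] sum_distrib_left)
    finally show "fps_eval sc w (fps_X * f) $ n = (w * fps_eval sc w f) $ n"
      by (simp add: fps_mult_nth)
  qed
qed

lemma fps_eval_const:
  assumes "scalar_map sc" "w $ 0 = 0"
  shows "fps_eval sc w (fps_const c) = fps_const (sc c)"
proof (rule fps_ext)
  fix n
  have "fps_eval sc w (fps_const c) $ n = (\<Sum>i=0..n. if i = 0 then sc c * (1 :: 'b fps) $ n else 0)"
    unfolding fps_eval_nth[OF assms(2) le_refl]
    by (rule sum.cong) (auto simp: scalar_map_0[OF assms(1)])
  then show "fps_eval sc w (fps_const c) $ n = fps_const (sc c) $ n"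
    by simp
qed

lemma scalar_mapD:
  assumes "scalar_map sc"
  shows "sc (a + b) = sc a + sc b" "sc (a * b) = sc a * sc b" "sc 1 = 1" "sc a * x = x * sc a"
  using assms unfolding scalar_map_def by blast+

lemma scalar_map_const:
  assumes "scalar_map sc" shows "scalar_map (\<lambda>c. fps_const (sc c))"
proof -
  have "fps_const (sc a) * x = x * fps_const (sc a)" for a x
    by (rule fps_ext) (simp, rule scalar_mapD(4)[OF assms])
  then show ?thesis
    unfolding scalar_map_def by (simp add: scalar_mapD(1-3)[OF assms])
qed

text \<open>Serves the case where two maps are not linear in the sense of \<open>fps_lin\<close> but
  their difference is: a derivation applied to w times a series produces an extra summand, which
  cancels against the same summand from \<open>fps_deriv\<close>.\<close>

lemma fps_lin_eq_0:
  fixes D :: "'u::ring_1 fps \<Rightarrow> 'r::ring_1 fps"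
  assumes z: "z $ 0 = 0" and D: "\<And>f g. D (f + g) = D f + D g"
    "\<And>f. D (fps_X * f) = z * D f" "\<And>a. D (fps_const a) = 0"
  shows "D f = 0"
proof -
  have "fps_lin z D" "fps_lin z (\<lambda>f. 0)" using D by (simp_all add: fps_lin_def)
  from fps_lin_eqI[OF z this] D show ?thesis by simp
qed

context
  fixes sc :: "'a::field \<Rightarrow> 'r::ring_1" and w :: "'r::ring_1 fps"
  assumes sc: "scalar_map sc" and w: "w $ 0 = 0"
begin

lemma fps_eval_commute:
  assumes "x * w = w * x" shows "x * fps_eval sc w f = fps_eval sc w f * x"
proof (rule fps_lin_eqI[OF w, where f = f])
  show "fps_lin w (\<lambda>f. x * fps_eval sc w f)"
    by (rule fps_lin_mult_left[OF fps_lin_eval[OF sc w]]) (use assms in simp)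
  show "fps_lin w (\<lambda>f. fps_eval sc w f * x)"
    by (rule fps_lin_mult_right[OF fps_lin_eval[OF sc w]])
  show "x * fps_eval sc w (fps_const a) = fps_eval sc w (fps_const a) * x" for a
    using scalar_mapD(4)[OF scalar_map_const[OF sc]] by (simp add: fps_eval_const[OF sc w])
qed

lemma fps_eval_mult: "fps_eval sc w (f * g) = fps_eval sc w f * fps_eval sc w g"
proof (rule fps_lin_mult_hom[OF w fps_lin_eval[OF sc w]])
  show "fps_eval sc w (fps_const a) * w = w * fps_eval sc w (fps_const a)" for a
    by (rule fps_eval_commute[symmetric]) simp
  show "fps_eval sc w (fps_const (a * b)) = fps_eval sc w (fps_const a) *
      fps_eval sc w (fps_const b)"
    for a b
    by (simp add: fps_eval_const[OF sc w] scalar_mapD(1-3)[OF sc])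
qed

lemma fps_eval_add: "fps_eval sc w (f + g) = fps_eval sc w f + fps_eval sc w g"
  using fps_lin_eval[OF sc w] by (rule fps_lin_add)

lemma fps_eval_1: "fps_eval sc w 1 = 1"
  using fps_eval_const[OF sc w, of 1] by (simp add: scalar_mapD(1-3)[OF sc])

lemma fps_eval_X: "fps_eval sc w fps_X = w"
  using fps_lin_X[OF fps_lin_eval[OF sc w], of 1] by (simp add: fps_eval_1)

text \<open>The chain rule, used both for d/dt and for ad of L_i. Noncommutativity enters only
  through the condition that w commutes with its own derivative.\<close>

lemma fps_eval_derivation:
  assumes add: "\<And>x y. \<delta> (x + y) = \<delta> x + \<delta> y"
    and leibniz: "\<And>x y. \<delta> (x * y) = x * \<delta> y + \<delta> x * y"
    and scal: "\<And>c. \<delta> (fps_const (sc c)) = 0" and comm: "\<delta> w * w = w * \<delta> w"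
  shows "\<delta> (fps_eval sc w f) = \<delta> w * fps_eval sc w (fps_deriv f)"
proof -
  have "\<delta> (fps_eval sc w f) - \<delta> w * fps_eval sc w (fps_deriv f) = 0"
  proof (rule fps_lin_eq_0[OF w, where f = f])
    have dm: "\<delta> w * (w * x) = w * (\<delta> w * x)" for x
      by (metis comm mult.assoc)
    fix f g
    show "\<delta> (fps_eval sc w (f + g)) - \<delta> w * fps_eval sc w (fps_deriv (f + g)) =
       (\<delta> (fps_eval sc w f) - \<delta> w * fps_eval sc w (fps_deriv f)) +
       (\<delta> (fps_eval sc w g) - \<delta> w * fps_eval sc w (fps_deriv g))"
      by (simp add: fps_eval_add add algebra_simps)
    show "\<delta> (fps_eval sc w (fps_X * f)) - \<delta> w * fps_eval sc w (fps_deriv (fps_X * f)) =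
       w * (\<delta> (fps_eval sc w f) - \<delta> w * fps_eval sc w (fps_deriv f))"
      by (simp add: fps_eval_add fps_eval_mult fps_eval_X add leibniz algebra_simps dm)
    show "\<delta> (fps_eval sc w (fps_const a)) - \<delta> w * fps_eval sc w (fps_deriv (fps_const a)) = 0" for a
      by (simp add: fps_eval_const[OF sc w] scal fps_lin_0[OF fps_lin_eval[OF sc w]])
  qed
  then show ?thesis by simp
qed

text \<open>Homomorphisms and antihomomorphisms can be treated alike because w commutes with every
  series in w. The applications are to the comultiplication, the antipode, the counit and the two
  embeddings into the tensor square.\<close>

lemma fps_eval_hom:
  assumes H: "fps_lin fps_X H"
      and m: "(\<forall>f g. H (f * g) = H f * H g) \<or> (\<forall>f g. H (f * g) = H g * H f)"
    and c: "\<And>a. H (fps_const (sc a)) = fps_const (sc' a)"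
    and sc': "scalar_map sc'" and Hw: "H w $ 0 = 0"
  shows "H (fps_eval sc w f) = fps_eval sc' (H w) f"
proof (rule fps_lin_eqI[OF Hw, where f = f])
  have "w * fps_eval sc w f = fps_eval sc w f * w" for f
    by (rule fps_eval_commute) simp
  then have "H (w * fps_eval sc w f) = H w * H (fps_eval sc w f)" for f
    using m by metis
  then show "fps_lin (H w) (\<lambda>f. H (fps_eval sc w f))"
    using H fps_lin_eval[OF sc w] by (simp add: fps_lin_def)
  show "fps_lin (H w) (fps_eval sc' (H w))"
    by (rule fps_lin_eval[OF sc' Hw])
  show "H (fps_eval sc w (fps_const a)) = fps_eval sc' (H w) (fps_const a)" for a
    by (simp add: fps_eval_const[OF sc w] fps_eval_const[OF sc' Hw] c)
qed

end

section \<open>Binomial series and their differential equation\<close>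

lemma fps_binomial_ode: "(1 + fps_X) * fps_deriv (fps_binomial c) =
    fps_const c * fps_binomial (c::'a::field_char_0)"
proof -
  have "(1 + fps_X :: 'a fps) $ 0 \<noteq> 0" by simp
  then have "inverse (1 + fps_X :: 'a fps) * (1 + fps_X) = 1" by (rule inverse_mult_eq_1)
  then show ?thesis
    by (simp add: fps_binomial_deriv fps_divide_unit mult.commute mult.left_commute)
qed

lemma fps_eval_binomial_ode:
  fixes sc :: "'a::field_char_0 \<Rightarrow> 'r::ring_1"
  assumes sc: "scalar_map sc" and w: "w $ 0 = 0" and c: "fps_deriv w * w = w * fps_deriv w"
  shows "(1 + w) * fps_deriv (fps_eval sc w (fps_binomial c)) =
    fps_const (sc c) * fps_deriv w * fps_eval sc w (fps_binomial c)"
proof -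
  let ?E = "fps_eval sc w"
  have "(1 + w) * fps_deriv (?E (fps_binomial c)) =
      (1 + w) * (fps_deriv w * ?E (fps_deriv (fps_binomial c)))"
    by (subst fps_eval_derivation[OF sc w, of fps_deriv]) (use c in simp_all)
  also have "\<dots> = fps_deriv w * ((1 + w) * ?E (fps_deriv (fps_binomial c)))"
    using c by (simp add: algebra_simps) (metis mult.assoc)
  also have "(1 + w) * ?E (fps_deriv (fps_binomial c)) =
      ?E ((1 + fps_X) * fps_deriv (fps_binomial c))"
    by (simp only: fps_eval_mult[OF sc w] fps_eval_add[OF sc w] fps_eval_1[OF sc w]
        fps_eval_X[OF sc w])
  also have "\<dots> = fps_const (sc c) * ?E (fps_binomial c)"
    by (simp only: fps_binomial_ode fps_eval_mult[OF sc w] fps_eval_const[OF sc w])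
  finally show ?thesis
    by (metis mult.assoc scalar_mapD(4)[OF scalar_map_const[OF sc]])
qed

text \<open>Comparing coefficients of t^n expresses (n + 1) D_{n+1} through D_0, ..., D_n, which
  vanish by induction.\<close>

lemma fps_linear_ode_zero:
  fixes sc :: "'a::field_char_0 \<Rightarrow> 'r::ring_1" and w :: "'r fps"
  assumes sc: "scalar_map sc" and w: "w $ 0 = 0"
    and ode: "(1 + w) * fps_deriv D = q * D" and D0: "D $ 0 = 0"
  shows "D = 0"
proof -
  have "\<forall>k\<le>n. D $ k = 0" for n
  proof (induction n)
    case (Suc n)
    have "(w * fps_deriv D) $ n = (w * 0) $ n"
      by (rule mult_nth_cong_lower[OF w]) (use Suc in simp)
    moreover have "(q * D) $ n = 0"
      unfolding fps_mult_nth by (rule sum.neutral) (use Suc in simp)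
    moreover have "((1 + w) * fps_deriv D) $ n = fps_deriv D $ n + (w * fps_deriv D) $ n"
      by (simp add: distrib_right)
    ultimately have "of_nat (Suc n) * D $ Suc n = 0"
      using ode by simp
    moreover have "sc (of_nat k) = of_nat k" for k
      by (induction k) (simp_all add: scalar_mapD(1-3)[OF sc] scalar_map_0[OF sc])
    \<comment> \<open>The target is only a ring, so n + 1 is inverted through the image of the
      scalar field.\<close>
    ultimately have "sc (1 / of_nat (Suc n)) * (sc (of_nat (Suc n)) * D $ Suc n) = 0"
      by (metis mult_zero_right)
    moreover have "sc (1 / of_nat (Suc n)) * sc (of_nat (Suc n)) = 1"
      by (metis scalar_mapD(2,3)[OF sc] nonzero_eq_divide_eq of_nat_neq_0)
    ultimately have "D $ Suc n = 0"
      by (metis mult.assoc mult_1)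
    then show ?case using Suc by (simp add: le_Suc_eq)
  qed (use D0 in simp)
  then show ?thesis by (simp add: fps_eq_iff) blast
qed

text \<open>Both sides solve $(1 + w) F' = c w' F$ and have constant term $1$.\<close>

lemma fps_eval_binomial_mult:
  fixes sc :: "'a::field_char_0 \<Rightarrow> 'r::ring_1"
  assumes sc: "scalar_map sc" and x: "x $ 0 = 0" and y: "y $ 0 = 0"
    and c: "x * y = y * x" "fps_deriv x * x = x * fps_deriv x" "fps_deriv x * y = y * fps_deriv x"
    "fps_deriv y * x = x * fps_deriv y" "fps_deriv y * y = y * fps_deriv y"
    and cd: "fps_deriv x * fps_deriv y = fps_deriv y * fps_deriv x"
    and w: "1 + w = (1 + x) * (1 + y)"
  shows "fps_eval sc x (fps_binomial c) * fps_eval sc y (fps_binomial c) =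
      fps_eval sc w (fps_binomial c)"
proof -
  define P Q W where "P = fps_eval sc x (fps_binomial c)" and "Q = fps_eval sc y (fps_binomial c)"
    and "W = fps_eval sc w (fps_binomial c)"
  define k where "k = fps_const (sc c)"
  let ?d = fps_deriv
  have w': "w = x + y + x * y" using w by (simp add: algebra_simps)
  have w0: "w $ 0 = 0" using x y by (simp add: w')
  have dw: "?d w = (1 + x) * ?d y + ?d x * (1 + y)" by (simp add: w' algebra_simps)
  \<comment> \<open>Oriented rules with their left-commutative forms; they sort products into the
    order x, y, x', y'.\<close>
  have comms: "y * x = x * y" "?d x * x = x * ?d x" "?d x * y = y * ?d x"
    "?d y * x = x * ?d y" "?d y * y = y * ?d y" "?d y * ?d x = ?d x * ?d y"
    "y * (x * a) = x * (y * a)" "?d x * (x * a) = x * (?d x * a)" "?d x * (y * a) = y * (?d x * a)"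
    "?d y * (x * a) = x * (?d y * a)" "?d y * (y * a) = y * (?d y * a)"
    "?d y * (?d x * a) = ?d x * (?d y * a)" for a
    using c cd by simp_all (metis mult.assoc)+
  have dww: "?d w * w = w * ?d w"
    unfolding dw w' by (simp add: algebra_simps comms)
  have kc: "a * k = k * a" "a * (k * b) = k * (a * b)" for a b
    unfolding k_def using scalar_mapD(4)[OF scalar_map_const[OF sc]] by (metis mult.assoc)+
  have P: "(1 + x) * ?d P = k * ?d x * P" and Q: "(1 + y) * ?d Q = k * ?d y * Q"
    and W: "(1 + w) * ?d W = k * ?d w * W"
    unfolding P_def Q_def W_def k_def using fps_eval_binomial_ode[OF sc] x y w0 c dww by blast+
  \<comment> \<open>P commutes with whatever commutes with x. This moves 1 + y and y' across P, so
    that the equations for P and Q can be applied inside the Leibniz rule.\<close>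
  have Pc: "a * P = P * a" if "a * x = x * a" for a
    unfolding P_def by (rule fps_eval_commute[OF sc x that])
  have "(1 + w) * ?d (P * Q) = (1 + x) * ((1 + y) * P * ?d Q) + (1 + x) * (1 + y) * ?d P * Q"
    by (simp add: w algebra_simps)
  also have "(1 + y) * P = P * (1 + y)"
    by (rule Pc) (simp add: algebra_simps c(1))
  also have "(1 + x) * (1 + y) = (1 + y) * (1 + x)" by (simp add: algebra_simps c(1))
  also have "(1 + x) * (P * (1 + y) * ?d Q) = (1 + x) * P * ((1 + y) * ?d Q)"
    by (simp only: mult.assoc)
  also have "\<dots> = (1 + x) * (P * ?d y) * k * Q"
    by (simp only: Q kc mult.assoc)
  also have "P * ?d y = ?d y * P" by (rule Pc[symmetric]) (rule c)
  also have "(1 + y) * (1 + x) * ?d P * Q = (1 + y) * ((1 + x) * ?d P) * Q"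
    by (simp only: mult.assoc)
  also have "\<dots> = k * ((1 + y) * ?d x) * P * Q"
    by (simp only: P kc mult.assoc)
  also have "(1 + y) * ?d x = ?d x * (1 + y)" by (simp add: algebra_simps c)
  finally have "(1 + w) * ?d (P * Q) = k * ?d w * (P * Q)"
    by (simp only: dw distrib_left distrib_right mult.assoc kc)
  then have "(1 + w) * ?d (P * Q - W) = k * ?d w * (P * Q - W)"
    using W by (simp add: algebra_simps)
  moreover have "(P * Q - W) $ 0 = 0"
    by (simp add: P_def Q_def W_def fps_eval_def fps_scalar_def scalar_mapD(1-3)[OF sc])
  ultimately have "P * Q - W = 0"
    by (rule fps_linear_ode_zero[OF sc w0])
  then show ?thesis by (simp add: P_def Q_def W_def)
qed

section \<open>Maps out of the enveloping algebra and its tensor powers\<close>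

lemma sv_uea_induct [case_names scalar gen add mult]:
  fixes u :: "'a::field_char_0 sv_uea"
  assumes scalar: "\<And>c. P (uea_scalar c)" and gen: "\<And>g. P (sv_incl (Poly_Mapping.single g 1))"
    and add: "\<And>u v. P u \<Longrightarrow> P v \<Longrightarrow> P (u + v)" and mult: "\<And>u v. P u \<Longrightarrow> P v \<Longrightarrow> P (u * v)"
  shows "P u"
proof -
  have gs: "P (abs_sv_uea (Poly_Mapping.single (Word gs) 1))" for gs
  proof (induction gs)
    case Nil
    have "abs_sv_uea (Poly_Mapping.single (Word []) 1) = uea_scalar (1 :: 'a)"
      by (simp add: uea_scalar.abs_eq zero_word_def)
    then show ?case using scalar by metis
  next
    case (Cons g gs)
    have "abs_sv_uea (Poly_Mapping.single (Word (g # gs)) 1) =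
        sv_incl (Poly_Mapping.single g 1) * abs_sv_uea (Poly_Mapping.single (Word gs) (1 :: 'a))"
      by (simp add: sv_incl.abs_eq times_sv_uea.abs_eq tensor_alg_incl_def mult_single)
    then show ?case using mult gen Cons by metis
  qed
  have w: "P (abs_sv_uea (Poly_Mapping.single m c))" for m and c :: 'a
  proof (cases m)
    case (Word gs)
    have "abs_sv_uea (Poly_Mapping.single m c) =
        uea_scalar c * abs_sv_uea (Poly_Mapping.single (Word gs) 1)"
      by (simp add: uea_scalar.abs_eq times_sv_uea.abs_eq mult_single Word)
    then show ?thesis using mult scalar gs by metis
  qed
  have z: "P (abs_sv_uea 0)"
    using w[of 0 0] by simp
  have "P (abs_sv_uea (\<Sum>m\<in>A. Poly_Mapping.single m (f m)))" if "finite A"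
      for A and f :: "sv_gen word \<Rightarrow> 'a"
    using that
  proof induction
    case (insert x F)
    then show ?case
      using add[OF w insert.IH, of x "f x"] by (simp add: plus_sv_uea.abs_eq)
  qed (simp add: z)
  then have "P (abs_sv_uea p)" for p
    by (subst poly_mapping_expand) simp
  moreover obtain p where "u = abs_sv_uea p"
    by (metis Quotient3_abs_rep Quotient3_sv_uea)
  ultimately show ?thesis by simp
qed

lemma sv_gen_incl:
  "sv_incl (Poly_Mapping.single g 1) =
    (case g of GenL n \<Rightarrow> sv_L n | GenY j \<Rightarrow> sv_Y j | GenM n \<Rightarrow> sv_M n)"
  by (cases g) (simp_all add: sv_L_def sv_Y_def sv_M_def)

lemma sv_uea_hom_eqI:
  fixes u :: "'a::field_char_0 sv_uea"
  assumes add: "\<And>u v. F (u + v) = F u + F v" "\<And>u v. G (u + v) = G u + (G v :: 'r::semiring_1)"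
    and mult: "\<And>u v. F (u * v) = F u * F v" "\<And>u v. G (u * v) = G u * G v"
    and scalar: "\<And>c. F (uea_scalar c) = G (uea_scalar c)"
    and gen: "\<And>n. F (sv_L n) = G (sv_L n)" "\<And>j. F (sv_Y j) = G (sv_Y j)"
        "\<And>n. F (sv_M n) = G (sv_M n)"
  shows "F u = G u"
  by (induction u rule: sv_uea_induct) (simp_all add: add mult scalar gen sv_gen_incl split:
      sv_gen.split)

text \<open>No case for scalar multiples is required, since a coefficient can be absorbed into the
  first tensor factor.\<close>

lemma sv_uea2_induct [case_names tensor add]:
  fixes w :: "'a::field_char_0 sv_uea2"
  assumes t: "\<And>u v. P (tensor2 u v)" and add: "\<And>w w'. P w \<Longrightarrow> P w' \<Longrightarrow> P (w + w')"
  shows "P w"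
proof -
  have w: "P (abs_sv_uea2 (Poly_Mapping.single m c))" for m and c :: 'a
  proof -
    obtain u v where m: "m = (Mon u, Mon v)" by (metis mon.exhaust surj_pair)
    have "abs_sv_uea2 (Poly_Mapping.single m c) = uea2_scalar c * tensor2 u v"
      by (simp add: uea2_scalar.abs_eq tensor2_def tensor_gen_def times_sv_uea2.abs_eq mult_single
          m)
    then show ?thesis using t by (metis tensor2_simps(3))
  qed
  have z: "P (abs_sv_uea2 0)"
    using w[of 0 0] by simp
  have "P (abs_sv_uea2 (\<Sum>m\<in>A. Poly_Mapping.single m (f m)))"
    if "finite A" for A and f :: "'a sv_uea mon \<times> 'a sv_uea mon \<Rightarrow> 'a"
    using that
  proof induction
    case (insert x F)
    then show ?case
      using add[OF w insert.IH, of x "f x"] by (simp add: plus_sv_uea2.abs_eq)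
  qed (simp add: z)
  then have "P (abs_sv_uea2 p)" for p
    by (subst poly_mapping_expand) simp
  moreover obtain p where "w = abs_sv_uea2 p"
    by (metis Quotient3_abs_rep Quotient3_sv_uea2)
  ultimately show ?thesis by simp
qed

text \<open>The defining relations for candidate images of the generators in an arbitrary algebra.
  As \<open>y j\<close> stands for the image of Y_{j+1/2}, the bracket of \<open>y i\<close> and
  \<open>y j\<close> lands in index i + j + 1. The brackets in the opposite order follow by
  antisymmetry.\<close>

definition sv_relations ::
  "('a::field_char_0 \<Rightarrow> 'r::ring_1) \<Rightarrow> (int \<Rightarrow> 'r) \<Rightarrow> (int \<Rightarrow> 'r) \<Rightarrow> (int \<Rightarrow> 'r) \<Rightarrow> bool" where
  "sv_relations sc l y m \<longleftrightarrow>
    (\<forall>i j. l i * l j - l j * l i = sc (of_int (j - i)) * l (j + i)) \<and>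
    (\<forall>i j. l i * m j - m j * l i = sc (of_int j) * m (j + i)) \<and>
    (\<forall>i j. l i * y j - y j * l i = sc (half j - of_int i / 2) * y (j + i)) \<and>
    (\<forall>i j. y i * y j - y j * y i = sc (half j - half i) * m (i + j + 1)) \<and>
    (\<forall>i j. m i * m j = m j * m i) \<and> (\<forall>i j. m i * y j = y j * m i)"

text \<open>The universal property of the enveloping algebra. The choice of representative is
  immaterial once \<open>sv_relations\<close> holds, by \<open>uea_lift_abs\<close>.\<close>

definition uea_lift ::
  "('a::field_char_0 \<Rightarrow> 'r::ring_1) \<Rightarrow> (int \<Rightarrow> 'r) \<Rightarrow> (int \<Rightarrow> 'r) \<Rightarrow> (int \<Rightarrow> 'r) \<Rightarrow> 'a sv_uea \<Rightarrow> 'r" where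
  "uea_lift sc l y m u = lin_ext sc (word_prod (case_sv_gen l y m)) (rep_sv_uea u)"

context
  fixes sc :: "'a::field_char_0 \<Rightarrow> 'r::ring_1" and l y m :: "int \<Rightarrow> 'r"
  assumes sc: "scalar_map sc" and rel: "sv_relations sc l y m"
begin

lemma lin_ext_tensor_alg_incl_single:
  "lin_ext sc (word_prod f) (tensor_alg_incl (Poly_Mapping.single g c)) = sc c * f g"
  by (simp add: lin_ext_tensor_alg_incl[OF sc] scalar_map_0[OF sc])

lemma sv_relations_bracket:
  "lin_ext sc (word_prod (case_sv_gen l y m)) (tensor_alg_incl (sv_gen_bracket g k)) =
    case_sv_gen l y m g * case_sv_gen l y m k - case_sv_gen l y m k * case_sv_gen l y m g"
proof -
  have neg: "sc (- c) = - sc c" for c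
    using scalar_mapD(1)[OF sc, of c "- c"] scalar_map_0[OF sc]
    by (simp add: eq_neg_iff_add_eq_0 add.commute)
  have sw: "b - a = - x" if "a - b = x" for a b x :: 'r using that by auto
  have 0: "lin_ext sc (word_prod f) (tensor_alg_incl 0) = 0" for f
    using lin_ext_tensor_alg_incl_single[of f undefined 0] by (simp add: scalar_map_0[OF sc])
  note r = rel[unfolded sv_relations_def]
  have r1: "l i * l j - l j * l i = sc (of_int (j - i)) * l (j + i)"
    and r2: "l i * m j - m j * l i = sc (of_int j) * m (j + i)"
    and r3: "l i * y j - y j * l i = sc (half j - of_int i / 2) * y (j + i)"
    and r4: "y i * y j - y j * y i = sc (half j - half i) * m (i + j + 1)"
    and r5: "m i * m j = m j * m i" and r6: "m i * y j = y j * m i" for i j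
    using r by blast+
  have r2': "m j * l i - l i * m j = sc (- of_int j) * m (j + i)"
    and r3': "y j * l i - l i * y j = sc (- (half j - of_int i / 2)) * y (j + i)" for i j
    using sw[OF r2] sw[OF r3] by (simp_all only: neg minus_mult_left)
  show ?thesis
    by (cases g; cases k)
       (simp_all only: sv_gen_bracket.simps sv_gen.case lin_ext_tensor_alg_incl_single r1 r2 r3 r4
           r2' r3' 0,
        simp_all add: r5 r6)
qed

lemma uea_lift_abs: "uea_lift sc l y m (abs_sv_uea p) =
    lin_ext sc (word_prod (case_sv_gen l y m)) p"
  unfolding uea_lift_def
proof (rule lin_ext_cong)
  show "ideal_cong (uea_rels sv_bracket) (rep_sv_uea (abs_sv_uea p)) p"
    by (metis Quotient3_sv_uea ideal_cong_refl rep_abs_rsp_left)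
  show "lin_ext sc (word_prod (case_sv_gen l y m)) r = 0" if "r \<in> uea_rels sv_bracket" for r
    by (rule lin_ext_uea_rels[OF sc sv_relations_bracket]) (use that in \<open>simp add: sv_bracket_def\<close>)
qed (auto simp: sc word_prod_add)

lemma uea_lift_add: "uea_lift sc l y m (u + v) = uea_lift sc l y m u + uea_lift sc l y m v"
proof -
  obtain p q where "u = abs_sv_uea p" "v = abs_sv_uea q"
    by (metis Quotient3_abs_rep Quotient3_sv_uea)
  then show ?thesis by (simp add: plus_sv_uea.abs_eq uea_lift_abs lin_ext_add[OF sc])
qed

lemma uea_lift_mult: "uea_lift sc l y m (u * v) = uea_lift sc l y m u * uea_lift sc l y m v"
proof -
  obtain p q where "u = abs_sv_uea p" "v = abs_sv_uea q"
    by (metis Quotient3_abs_rep Quotient3_sv_uea)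
  then show ?thesis by (simp add: times_sv_uea.abs_eq uea_lift_abs lin_ext_mult[OF sc]
      word_prod_add)
qed

lemma uea_lift_scalar: "uea_lift sc l y m (uea_scalar c) = sc c"
  by (simp add: uea_scalar.abs_eq uea_lift_abs lin_ext_single[OF sc] zero_word_def)

lemma uea_lift_gen:
  "uea_lift sc l y m (sv_L n) = l n" "uea_lift sc l y m (sv_Y n) = y n"
  "uea_lift sc l y m (sv_M n) = m n"
  by (simp_all add: sv_L_def sv_Y_def sv_M_def sv_incl.abs_eq uea_lift_abs
      lin_ext_tensor_alg_incl_single scalar_mapD(3)[OF sc])

end

lemma sv_relations_uea: "sv_relations uea_scalar sv_L sv_Y (sv_M :: int \<Rightarrow> 'a::field_char_0 sv_uea)"
proof -
  have s: "sv_incl (Poly_Mapping.single g c) =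
      uea_scalar c * sv_incl (Poly_Mapping.single g (1::'a))" for g c
    by (simp add: uea_scalar.abs_eq sv_incl.abs_eq times_sv_uea.abs_eq tensor_alg_incl_def
        mult_single)
  have 0: "sv_incl 0 = (0 :: 'a sv_uea)"
    by (simp add: sv_incl.abs_eq tensor_alg_incl_def zero_sv_uea.abs_eq)
  have "sv_incl (Poly_Mapping.single g (1::'a)) * sv_incl (Poly_Mapping.single k 1)
    - sv_incl (Poly_Mapping.single k 1) * sv_incl (Poly_Mapping.single g 1) =
        sv_incl (sv_gen_bracket g k)" for g k
    by (simp add: sv_incl_commutator sv_bracket_single)
  note b = this
  show ?thesis
    unfolding sv_relations_def sv_L_def sv_Y_def sv_M_def
    by (intro conjI allI)
       (simp_all only: b sv_gen_bracket.simps s[symmetric],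
        (rule eq_iff_diff_eq_0[THEN iffD2], simp only: b sv_gen_bracket.simps 0)+)
qed

text \<open>Additivity in each argument already makes \<open>fps_bilin\<close> linear over the
  variable. Scalars act through different maps on the factors of \<open>tensor2\<close>,
  \<open>tensor3\<close> and \<open>tensor12\<close>, so they are handled separately.\<close>

definition biadditive :: "('u::ring_1 \<Rightarrow> 'v::ring_1 \<Rightarrow> 'w::ring_1) \<Rightarrow> bool" where
  "biadditive \<beta> \<longleftrightarrow> (\<forall>u u' v. \<beta> (u + u') v = \<beta> u v + \<beta> u' v) \<and> (\<forall>u v v'. \<beta> u (v + v') =
      \<beta> u v + \<beta> u v')"

lemma biadditive_0: assumes "biadditive \<beta>" shows "\<beta> 0 v = 0" "\<beta> u 0 = 0"
  using assms unfolding biadditive_def by (metis add_0 add_cancel_left_left)+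

lemma fps_bilin_lin:
  assumes \<beta>: "biadditive \<beta>"
  shows "fps_lin fps_X (\<lambda>f. fps_bilin \<beta> f g)" "fps_lin fps_X (\<lambda>g. fps_bilin \<beta> f g)"
proof -
  have add: "\<beta> (u + u') v = \<beta> u v + \<beta> u' v" "\<beta> u (v + v') = \<beta> u v + \<beta> u v'" for u u' v v'
    using \<beta> unfolding biadditive_def by blast+
  have "fps_bilin \<beta> (fps_X * f) g $ n = (fps_X * fps_bilin \<beta> f g) $ n" for f n
  proof (cases n)
    case (Suc k)
    have "fps_bilin \<beta> (fps_X * f) g $ n = (\<Sum>i=0..Suc k. \<beta> ((fps_X * f) $ i) (g $ (Suc k - i)))"
      by (simp add: fps_bilin_def Suc)
    also have "\<dots> = (\<Sum>i=0..k. \<beta> (f $ i) (g $ (k - i)))"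
      by (simp only: sum.atLeast0_atMost_Suc_shift) (simp add: biadditive_0[OF \<beta>])
    finally show ?thesis by (simp add: fps_bilin_def Suc)
  qed (simp add: fps_bilin_def biadditive_0[OF \<beta>])
  then show "fps_lin fps_X (\<lambda>f. fps_bilin \<beta> f g)"
    by (simp add: fps_lin_def fps_eq_iff) (simp add: fps_bilin_def add sum.distrib)
  have "fps_bilin \<beta> f (fps_X * g) $ n = (fps_X * fps_bilin \<beta> f g) $ n" for g n
    by (cases n) (simp_all add: fps_bilin_def biadditive_0[OF \<beta>] Suc_diff_le)
  then show "fps_lin fps_X (\<lambda>g. fps_bilin \<beta> f g)"
    by (simp add: fps_lin_def fps_eq_iff) (simp add: fps_bilin_def add sum.distrib)
qed

lemma fps_bilin_const:
  assumes \<beta>: "biadditive \<beta>"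
  shows "fps_bilin \<beta> (fps_const u) (fps_const v) = fps_const (\<beta> u v)"
proof (rule fps_ext)
  fix n
  have "fps_bilin \<beta> (fps_const u) (fps_const v) $ n = (\<Sum>i=0..n. if i =
      0 then fps_const (\<beta> u v) $ n else 0)"
    unfolding fps_bilin_def fps_nth_Abs_fps
    by (rule sum.cong) (auto simp: biadditive_0[OF \<beta>])
  then show "fps_bilin \<beta> (fps_const u) (fps_const v) $ n = fps_const (\<beta> u v) $ n" by simp
qed

lemma fps_bilin_eqI:
  assumes "\<And>g. fps_lin fps_X (\<lambda>f. B f g)" "\<And>f. fps_lin fps_X (\<lambda>g. B f g)"
    and "\<And>g. fps_lin fps_X (\<lambda>f. C f g)" "\<And>f. fps_lin fps_X (\<lambda>g. C f g)"
    and c: "\<And>u v. B (fps_const u) (fps_const v) = C (fps_const u) (fps_const v)"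
  shows "B f g = C f g"
proof -
  have 1: "B (fps_const u) g = C (fps_const u) g" for u g
    by (rule fps_lin_eqI[where F = "B (fps_const u)" and z = fps_X]) (use assms in simp_all)
  show ?thesis
    by (rule fps_lin_eqI[where F = "\<lambda>f. B f g" and z = fps_X]) (use assms 1 in simp_all)
qed

lemma fps_lin_postmult: "fps_lin fps_X F \<Longrightarrow> fps_lin fps_X (\<lambda>f. F (f * g))"
  by (simp add: fps_lin_def distrib_right mult.assoc)

lemma fps_lin_premult: "fps_lin fps_X F \<Longrightarrow> fps_lin fps_X (\<lambda>f. F (g * f))"
  by (simp add: fps_lin_def distrib_left X_left_commute)

lemma fps_bilin_mult:
  assumes \<beta>: "biadditive \<beta>" and m: "\<And>u u' v v'. \<beta> (u * u') (v * v') = \<beta> u v * \<beta> u' v'"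
  shows "fps_bilin \<beta> f g * fps_bilin \<beta> f' g' = fps_bilin \<beta> (f * f') (g * g')"
proof -
  note l = fps_bilin_lin[OF \<beta>]
  note s = fps_lin_postmult fps_lin_premult l fps_lin_mult_right fps_lin_mult_left
  have 1: "fps_bilin \<beta> (fps_const u) (fps_const v) * fps_bilin \<beta> f' g' =
      fps_bilin \<beta> (fps_const u * f') (fps_const v * g')" for u v
    by (rule fps_bilin_eqI[where B = "\<lambda>f' g'. fps_bilin \<beta> (fps_const u) (fps_const v) *
        fps_bilin \<beta> f' g'"])
       (simp_all add: s X_central fps_bilin_const[OF \<beta>] m
         fps_lin_premult[OF l(1)] fps_lin_premult[OF l(2)])
  show ?thesis
    by (rule fps_bilin_eqI[where B = "\<lambda>f g. fps_bilin \<beta> f g * fps_bilin \<beta> f' g'"])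
       (simp_all add: l fps_lin_mult_right 1 fps_lin_postmult[OF l(1)] fps_lin_postmult[OF l(2)])
qed

lemma fps_lin_tensor_eqI:
  fixes F G :: "'a::field_char_0 sv_uea2 fps \<Rightarrow> 'r::ring_1 fps"
  assumes F: "fps_lin fps_X F" and G: "fps_lin fps_X G"
    and c: "\<And>u v. F (fps_const (tensor2 u v)) = G (fps_const (tensor2 u v))"
  shows "F w = G w"
proof (rule fps_lin_eqI[OF _ F G])
  fix a :: "'a sv_uea2"
  show "F (fps_const a) = G (fps_const a)"
    by (induction a rule: sv_uea2_induct)
       (simp_all add: c fps_lin_add[OF F] fps_lin_add[OF G] flip: fps_const_add)
qed simp

lemma biadditive_tensor: "biadditive tensor2" "biadditive tensor3"
  by (simp_all add: biadditive_def tensor2_simps tensor3_simps)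

lemma tensor2_lift_scalar_bilinear:
  "bilinear_over uea_scalar uea_scalar uea3_scalar (\<lambda>a b. tensor3 (tensor2 u a) b)"
  by (simp add: bilinear_over_def tensor2_simps tensor3_simps)

lemma tensor12_add_right: "tensor12 u (w + w') = tensor12 u w + tensor12 u w'"
  unfolding tensor12_def
  by (rule tensor2_lift_add[OF scalar_map_uea3_scalar tensor2_lift_scalar_bilinear])

lemma tensor12_add_left: "tensor12 (u + u') w = tensor12 u w + tensor12 u' w"
  by (induction w rule: sv_uea2_induct)
     (simp_all add: tensor12_add_right tensor12_tensor2 tensor2_simps tensor3_simps algebra_simps)

lemma biadditive_tensor12: "biadditive tensor12"
  by (simp add: biadditive_def tensor12_add_left tensor12_add_right)

lemma tensor12_mult: "tensor12 (u * u') (w * w') = tensor12 u w * tensor12 u' w'"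
proof (induction w rule: sv_uea2_induct)
  case (tensor a b)
  show ?case
    by (induction w' rule: sv_uea2_induct)
       (simp_all add: tensor12_add_right tensor12_tensor2 tensor2_simps tensor3_simps distrib_left)
qed (simp add: tensor12_add_right distrib_right)

lemma fps_tensor_mult: "(f \<otimes>\<^sub>t g) * (f' \<otimes>\<^sub>t g') = (f * f') \<otimes>\<^sub>t (g * g')"
  by (rule fps_bilin_mult[OF biadditive_tensor(1)]) (simp add: tensor2_simps)

lemma fps_tensor3_mult:
  "fps_bilin tensor3 f g * fps_bilin tensor3 f' g' = fps_bilin tensor3 (f * f') (g * g')"
  by (rule fps_bilin_mult[OF biadditive_tensor(2)]) (simp add: tensor3_simps)

lemma fps_tensor12_mult:
  "fps_bilin tensor12 f g * fps_bilin tensor12 f' g' = fps_bilin tensor12 (f * f') (g * g')"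
  by (rule fps_bilin_mult[OF biadditive_tensor12]) (rule tensor12_mult)

text \<open>Rebracketing for series. It brings both sides of coassociativity into the form (f
  \<otimes> g) \<otimes> k.\<close>

lemma fps_tensor12_tensor: "fps_bilin tensor12 f (g \<otimes>\<^sub>t k) = fps_bilin tensor3 (f \<otimes>\<^sub>t g) k"
proof -
  note l = fps_bilin_lin[OF biadditive_tensor(1)] fps_bilin_lin[OF biadditive_tensor(2)]
    fps_bilin_lin[OF biadditive_tensor12]
  note c = fps_bilin_const[OF biadditive_tensor(1)] fps_bilin_const[OF biadditive_tensor(2)]
    fps_bilin_const[OF biadditive_tensor12]
  have 1: "fps_bilin tensor12 (fps_const u) (g \<otimes>\<^sub>t k) = fps_bilin tensor3 (fps_const u \<otimes>\<^sub>t g) k" for u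
    by (rule fps_bilin_eqI[where B = "\<lambda>g k. fps_bilin tensor12 (fps_const u) (g \<otimes>\<^sub>t k)"])
       ((rule fps_lin_comp[OF l(6) l(1)] fps_lin_comp[OF l(6) l(2)] fps_lin_comp[OF l(3) l(2)]
           l(4))+,
        simp add: c tensor12_tensor2)
  show ?thesis
    by (rule fps_lin_eqI[where z = fps_X])
       (simp, rule l(5), rule fps_lin_comp[OF l(3) l(1)], rule 1)
qed

lemma fps_tensor_lift_lin:
  fixes sc :: "'a::field_char_0 \<Rightarrow> 'r::ring_1"
  assumes sc: "scalar_map sc" and B: "bilinear_over uea_scalar uea_scalar (\<lambda>c. fps_const (sc c)) B"
  shows "fps_lin fps_X (fps_tensor_lift sc B)"
    and "fps_tensor_lift sc B (fps_const (tensor2 u v)) = B u v"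
proof -
  have B': "bilinear_over uea_scalar uea_scalar sc (\<lambda>u v. B u v $ i)" for i
    using B by (simp add: bilinear_over_def)
  let ?G = "\<lambda>w. Abs_fps (\<lambda>i. tensor2_lift sc (\<lambda>u v. B u v $ i) w)"
  have e: "fps_tensor_lift sc B = fps_extend ?G"
    by (simp add: fun_eq_iff fps_tensor_lift_def fps_extend_def)
  have add: "?G (u + v) = ?G u + ?G v" for u v
    by (rule fps_ext) (simp add: tensor2_lift_add[OF sc B'])
  show "fps_lin fps_X (fps_tensor_lift sc B)"
    unfolding e by (rule fps_lin_extend) (rule add)
  show "fps_tensor_lift sc B (fps_const (tensor2 u v)) = B u v"
    unfolding e by (subst fps_extend_const) (rule add, simp add: fps_eq_iff
        tensor2_lift_tensor2[OF sc B'])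
qed

definition fps_bilinear :: "('a::field_char_0 \<Rightarrow> 'r::ring_1) \<Rightarrow>
    ('a sv_uea fps \<Rightarrow> 'a sv_uea fps \<Rightarrow> 'r fps) \<Rightarrow> bool" where
  "fps_bilinear sc B \<longleftrightarrow> (\<forall>g. fps_lin fps_X (\<lambda>f. B f g)) \<and> (\<forall>f. fps_lin fps_X (\<lambda>g. B f g)) \<and>
    (\<forall>c f g. B (fps_const (uea_scalar c) * f) g = fps_const (sc c) * B f g) \<and>
    (\<forall>c f g. B f (fps_const (uea_scalar c) * g) = fps_const (sc c) * B f g)"

text \<open>The Hopf algebra axioms use lifts that are prescribed on constants only. This computes
  such a lift on f \<otimes> g for arbitrary series, in particular when a factor is a power of 1 -
  et.\<close>

lemma fps_tensor_lift_bilinear: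
  fixes sc :: "'a::field_char_0 \<Rightarrow> 'r::ring_1"
  assumes sc: "scalar_map sc" and B: "fps_bilinear sc B"
  shows "fps_lin fps_X (fps_tensor_lift sc (\<lambda>u v. B (fps_const u) (fps_const v)))"
    and "fps_tensor_lift sc (\<lambda>u v. B (fps_const u) (fps_const v)) (f \<otimes>\<^sub>t g) = B f g"
proof -
  note b = B[unfolded fps_bilinear_def]
  have b1: "fps_lin fps_X (\<lambda>f. B f g)" and b2: "fps_lin fps_X (\<lambda>g. B f g)" for f g using b by blast+
  have bo: "bilinear_over uea_scalar uea_scalar (\<lambda>c. fps_const (sc c)) (\<lambda>u v. B (fps_const u)
      (fps_const v))"
    unfolding bilinear_over_def
    using b by (simp add: fps_lin_add[OF b1] fps_lin_add[OF b2] flip: fps_const_add fps_const_mult)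
  note t = fps_tensor_lift_lin[OF sc bo]
  show "fps_lin fps_X (fps_tensor_lift sc (\<lambda>u v. B (fps_const u) (fps_const v)))" by (rule t)
  show "fps_tensor_lift sc (\<lambda>u v. B (fps_const u) (fps_const v)) (f \<otimes>\<^sub>t g) = B f g"
    by (rule fps_bilin_eqI[where B = "\<lambda>f g. fps_tensor_lift sc (\<lambda>u v. B (fps_const u) (fps_const v))
        (f \<otimes>\<^sub>t g)"])
       ((rule fps_lin_comp[OF t(1) fps_bilin_lin(1)[OF biadditive_tensor(1)]]
         fps_lin_comp[OF t(1) fps_bilin_lin(2)[OF biadditive_tensor(1)]] b1 b2)+,
        simp add: fps_bilin_const[OF biadditive_tensor(1)] t(2))
qed

section \<open>Commutators and scalars\<close>

text \<open>
  Multiplications by scalars and by the variable are wrapped in constants of their own, so that the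
  simplifier can move them out of products without looping on central factors.
\<close>

definition smul :: "('a::field \<Rightarrow> 'r::ring_1) \<Rightarrow> 'a \<Rightarrow> 'r fps \<Rightarrow> 'r fps" where
  "smul sc c x = fps_const (sc c) * x"

definition Xmul :: "'r::ring_1 fps \<Rightarrow> 'r fps" where
  "Xmul x = fps_X * x"

definition lie :: "'r::ring_1 \<Rightarrow> 'r \<Rightarrow> 'r" where
  "lie x y = x * y - y * x"

lemma lie_simps:
  "lie (x + y) z = lie x z + lie y z" "lie z (x + y) = lie z x + lie z y"
  "lie (x - y) z = lie x z - lie y z" "lie z (x - y) = lie z x - lie z y"
  "lie (- x) z = - lie x z" "lie z (- x) = - lie z x"
  "lie 0 x = 0" "lie x 0 = 0" "lie 1 x = 0" "lie x 1 = 0" "lie x x = 0"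
  "lie x (y * z) = lie x y * z + y * lie x z" "lie (x * y) z = x * lie y z + lie x z * y"
  by (simp_all add: lie_def algebra_simps)

lemma lie_swap: "lie x y = z \<Longrightarrow> lie y x = - z"
  by (auto simp: lie_def)

lemma Xmul_simps:
  "Xmul x * y = Xmul (x * y)" "x * Xmul y = Xmul (x * y)"
  "Xmul (x + y) = Xmul x + Xmul y" "Xmul (x - y) = Xmul x - Xmul y" "Xmul (- x) = - Xmul x"
  "Xmul 0 = 0" "lie (Xmul x) y = Xmul (lie x y)" "lie x (Xmul y) = Xmul (lie x y)"
  by (simp_all add: lie_def Xmul_def algebra_simps X_left_commute)

context
  fixes sc :: "'a::field_char_0 \<Rightarrow> 'r::ring_1"
  assumes sc: "scalar_map sc"
begin

lemma scalar_map_uminus: "sc (- a) = - sc a"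
  using scalar_mapD(1)[OF sc, of a "- a"] scalar_map_0[OF sc]
  by (simp add: eq_neg_iff_add_eq_0 add.commute)

lemma scalar_map_diff: "sc (a - b) = sc a - sc b"
  using scalar_mapD(1)[OF sc, of a "- b"] by (simp add: scalar_map_uminus)

lemma scalar_map_of_int: "sc (of_int k) = of_int k"
proof -
  have n: "sc (of_nat n) = of_nat n" for n
    by (induction n) (simp_all add: scalar_map_0[OF sc] scalar_mapD(1-3)[OF sc])
  show ?thesis by (cases k rule: int_diff_cases) (simp add: scalar_map_diff n)
qed

lemma smul_mult: "smul sc c x * y = smul sc c (x * y)" "x * smul sc c y = smul sc c (x * y)"
  using scalar_mapD(4)[OF scalar_map_const[OF sc]] unfolding smul_def by (metis mult.assoc)+

lemma smul_simps:
  "smul sc c (x + y) = smul sc c x + smul sc c y" "smul sc c (x - y) = smul sc c x - smul sc c y"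
  "smul sc c (- x) = - smul sc c x" "smul sc c 0 = 0"
  "smul sc (a + b) x = smul sc a x + smul sc b x" "smul sc (a - b) x = smul sc a x - smul sc b x"
  "smul sc (- a) x = - smul sc a x" "smul sc 0 x = 0" "smul sc 1 x = x"
  "smul sc a (smul sc b x) = smul sc (a * b) x"
  "smul sc c x * y = smul sc c (x * y)" "x * smul sc c y = smul sc c (x * y)"
  "Xmul (smul sc c x) = smul sc c (Xmul x)"
  "lie (smul sc c x) y = smul sc c (lie x y)" "lie x (smul sc c y) = smul sc c (lie x y)"
proof -
  show "lie (smul sc c x) y = smul sc c (lie x y)" "lie x (smul sc c y) = smul sc c (lie x y)"
    unfolding lie_def smul_mult by (simp_all add: smul_def right_diff_distrib)
  show "x * smul sc c y = smul sc c (x * y)" by (rule smul_mult)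
qed (simp_all add: smul_def distrib_left distrib_right right_diff_distrib left_diff_distrib
    scalar_mapD(1-3)[OF sc] scalar_map_0[OF sc] scalar_map_uminus scalar_map_diff mult.assoc
    Xmul_def X_left_commute flip: fps_const_add fps_const_sub fps_const_mult fps_const_neg)

end

lemmas smul1_simps = smul_simps[OF scalar_map_uea_scalar]
lemmas smul2_simps = smul_simps[OF scalar_map_uea2_scalar]

lemma tensor_smul:
  "smul uea_scalar c f \<otimes>\<^sub>t g = smul uea2_scalar c (f \<otimes>\<^sub>t g)"
  "f \<otimes>\<^sub>t smul uea_scalar c g = smul uea2_scalar c (f \<otimes>\<^sub>t g)"
proof -
  have s1: "smul uea2_scalar c 1 = fps_const (tensor2 (uea_scalar c) 1)"
    and s2: "smul uea2_scalar c 1 = fps_const (tensor2 1 (uea_scalar c))"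
    using tensor2_simps(3)[of c 1 1] tensor2_simps(4)[of 1 c 1]
    by (simp_all add: smul_def tensor2_simps(6))
  have "smul uea2_scalar c (f \<otimes>\<^sub>t g) = smul uea2_scalar c 1 * (f \<otimes>\<^sub>t g)" by (simp add: smul_def)
  moreover have "smul uea2_scalar c 1 = fps_const (uea_scalar c) \<otimes>\<^sub>t fps_const 1"
    "smul uea2_scalar c 1 = fps_const 1 \<otimes>\<^sub>t fps_const (uea_scalar c)"
    by (simp_all only: fps_bilin_const[OF biadditive_tensor(1)] s1[symmetric] s2[symmetric])
  ultimately show "smul uea_scalar c f \<otimes>\<^sub>t g = smul uea2_scalar c (f \<otimes>\<^sub>t g)"
    "f \<otimes>\<^sub>t smul uea_scalar c g = smul uea2_scalar c (f \<otimes>\<^sub>t g)"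
    by (metis fps_tensor_mult fps_const_1_eq_1 mult_1 smul_def)+
qed

lemma fps_bilin_simps:
  assumes "biadditive \<beta>"
  shows "fps_bilin \<beta> (f + f') g = fps_bilin \<beta> f g + fps_bilin \<beta> f' g"
    "fps_bilin \<beta> f (g + g') = fps_bilin \<beta> f g + fps_bilin \<beta> f g'"
    "fps_bilin \<beta> (f - f') g = fps_bilin \<beta> f g - fps_bilin \<beta> f' g"
    "fps_bilin \<beta> f (g - g') = fps_bilin \<beta> f g - fps_bilin \<beta> f g'"
    "fps_bilin \<beta> (- f) g = - fps_bilin \<beta> f g" "fps_bilin \<beta> f (- g) = - fps_bilin \<beta> f g"
    "fps_bilin \<beta> 0 g = 0" "fps_bilin \<beta> f 0 = 0"
    "fps_bilin \<beta> (Xmul f) g = Xmul (fps_bilin \<beta> f g)"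
    "fps_bilin \<beta> f (Xmul g) = Xmul (fps_bilin \<beta> f g)"
  unfolding Xmul_def
  by (rule fps_bilin_lin(1)[OF assms, THEN fps_lin_add]
      fps_bilin_lin(1)[OF assms, THEN fps_lin_diff]
    fps_bilin_lin(1)[OF assms, THEN fps_lin_uminus] fps_bilin_lin(1)[OF assms, THEN fps_lin_0]
    fps_bilin_lin(1)[OF assms, THEN fps_lin_X] fps_bilin_lin(2)[OF assms, THEN fps_lin_add]
    fps_bilin_lin(2)[OF assms, THEN fps_lin_diff] fps_bilin_lin(2)[OF assms, THEN fps_lin_uminus]
    fps_bilin_lin(2)[OF assms, THEN fps_lin_0] fps_bilin_lin(2)[OF assms, THEN fps_lin_X])+

lemmas tensor_simps = fps_bilin_simps[OF biadditive_tensor(1)] tensor_smul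

text \<open>In this form every commutator is one of single tensor factors, so that
  \<open>D_relations\<close> becomes a rewriting computation.\<close>

lemma lie_tensor: "lie (f \<otimes>\<^sub>t g) (f' \<otimes>\<^sub>t g') = lie f f' \<otimes>\<^sub>t (g * g') + (f' * f) \<otimes>\<^sub>t lie g g'"
  by (simp add: lie_def fps_tensor_mult tensor_simps algebra_simps)

lemma tensor_1: "1 \<otimes>\<^sub>t 1 = 1"
  using fps_bilin_const[OF biadditive_tensor(1), of 1 1] by (simp add: tensor2_simps(6))

text \<open>The sign (-1)^m is moved into the argument: (1 - et)^c is the binomial series at -et, to
  which the substitution rules apply.\<close>

lemma one_minus_powr_eval:
  "one_minus_powr e c = fps_eval uea_scalar (- Xmul (fps_const e)) (fps_binomial c)"
proof (rule fps_ext)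
  fix n
  let ?w = "- Xmul (fps_const e)"
  have w: "?w ^ i = fps_const ((- 1) ^ i * e ^ i) * fps_X ^ i" for i
  proof (induction i)
    case (Suc i)
    have "?w ^ Suc i = ?w * (fps_const ((- 1) ^ i * e ^ i) * fps_X ^ i)" by (simp add: Suc)
    also have "\<dots> = fps_const (- e * ((- 1) ^ i * e ^ i)) * (fps_X * fps_X ^ i)"
      by (simp add: Xmul_def fps_mult_fps_X_commute mult.assoc flip: fps_const_mult fps_const_neg)
    also have "- e * ((- 1) ^ i * e ^ i) = (- 1) ^ Suc i * e ^ Suc i"
      by (cases "even i") simp_all
    finally show ?case by simp
  qed simp
  have "fps_eval uea_scalar ?w (fps_binomial c) $ n =
      (\<Sum>i=0..n. if i = n then uea_scalar (c gchoose n) * ((- 1) ^ n * e ^ n) else 0)"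
    by (subst fps_eval_nth[OF _ le_refl], simp add: Xmul_def, unfold w, rule sum.cong)
       (simp_all add: fps_X_power_iff)
  also have "\<dots> = uea_scalar (c gchoose n) * ((- 1) ^ n * e ^ n)" by simp
  also have "\<dots> = uea_scalar ((- 1) ^ n * (c gchoose n)) * e ^ n"
    by (cases "even n") (simp_all add: scalar_map_uminus[OF scalar_map_uea_scalar])
  finally show "one_minus_powr e c $ n = fps_eval uea_scalar ?w (fps_binomial c) $ n"
    by (simp add: one_minus_powr_def)
qed

lemma fps_deriv_binomial: "fps_deriv (fps_binomial c) =
    fps_const c * fps_binomial (c - 1 :: 'a::field_char_0)"
proof -
  have "(1 + fps_X) * fps_deriv (fps_binomial c) =
      (1 + fps_X) * (fps_const c * fps_binomial (c - 1))"
    unfolding fps_binomial_ode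
    using fps_binomial_add_mult[of 1 "c - 1"] by (simp add: fps_binomial_1 mult.left_commute)
  moreover have "(1 + fps_X :: 'a fps) $ 0 \<noteq> 0 $ 0" by simp
  then have "(1 + fps_X :: 'a fps) \<noteq> 0" by metis
  ultimately show ?thesis by simp
qed

section \<open>The deformed relations\<close>

locale sv_twist =
  fixes n0 :: int
  assumes n0: "n0 \<noteq> 0"
begin

definition l :: "int \<Rightarrow> 'a::field_char_0 sv_uea fps" where "l n = fps_const (sv_L n)"
definition y :: "int \<Rightarrow> 'a::field_char_0 sv_uea fps" where "y n = fps_const (sv_Y n)"
definition m :: "int \<Rightarrow> 'a::field_char_0 sv_uea fps" where "m n = fps_const (sv_M n)"
text \<open>
  With the exponent scaled by \<open>n0\<close>, the power accompanying a generator is given by its degree.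
\<close>

definition E :: "'a::field_char_0 \<Rightarrow> 'a sv_uea fps" where
  "E c = one_minus_powr (sv_M n0) (c / of_int n0)"

lemma lie_const: "lie (fps_const a) (fps_const b) = fps_const (lie a b)"
  by (simp add: lie_def)

lemma lie_gen:
  "lie (l i) (l j :: 'a::field_char_0 sv_uea fps) = smul uea_scalar (of_int (j - i)) (l (j + i))"
  "lie (l i) (m j :: 'a sv_uea fps) = smul uea_scalar (of_int j) (m (j + i))"
  "lie (m j) (l i :: 'a sv_uea fps) = - smul uea_scalar (of_int j) (m (j + i))"
  "lie (l i) (y j :: 'a sv_uea fps) = smul uea_scalar (half j - of_int i / 2) (y (j + i))"
  "lie (y j) (l i :: 'a sv_uea fps) = - smul uea_scalar (half j - of_int i / 2) (y (j + i))"
  "lie (y i) (y j :: 'a sv_uea fps) = smul uea_scalar (half j - half i) (m (i + j + 1))"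
  "lie (m i) (m j :: 'a sv_uea fps) = 0" "lie (m i) (y j :: 'a sv_uea fps) = 0"
  "lie (y j) (m i :: 'a sv_uea fps) = 0"
proof -
  have r: "sv_L i * sv_L j - sv_L j * sv_L i =
      uea_scalar (of_int (j - i)) * (sv_L (j + i) :: 'a sv_uea)"
    "sv_L i * sv_M j - sv_M j * sv_L i = uea_scalar (of_int j) * (sv_M (j + i) :: 'a sv_uea)"
    "sv_L i * sv_Y j - sv_Y j * sv_L i = uea_scalar (half j - of_int i / 2) * (sv_Y (j +
        i) :: 'a sv_uea)"
    "sv_Y i * sv_Y j - sv_Y j * sv_Y i = uea_scalar (half j - half i) * (sv_M (i + j +
        1) :: 'a sv_uea)"
    "sv_M i * sv_M j - sv_M j * sv_M i = (0 :: 'a sv_uea)"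
    "sv_M i * sv_Y j - sv_Y j * sv_M i = (0 :: 'a sv_uea)"
    for i j
    using sv_relations_uea[where 'a = 'a, unfolded sv_relations_def] by simp_all
  show a: "lie (l i) (l j :: 'a sv_uea fps) = smul uea_scalar (of_int (j - i)) (l (j + i))"
    "lie (l i) (m j :: 'a sv_uea fps) = smul uea_scalar (of_int j) (m (j + i))"
    "lie (l i) (y j :: 'a sv_uea fps) = smul uea_scalar (half j - of_int i / 2) (y (j + i))"
    "lie (y i) (y j :: 'a sv_uea fps) = smul uea_scalar (half j - half i) (m (i + j + 1))"
    "lie (m i) (m j :: 'a sv_uea fps) = 0" "lie (m i) (y j :: 'a sv_uea fps) = 0" for i j
    unfolding l_def m_def y_def lie_const smul_def lie_def
    by (simp_all only: r fps_const_mult fps_const_sub fps_const_0_eq_0)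
  show "lie (m j) (l i :: 'a sv_uea fps) = - smul uea_scalar (of_int j) (m (j + i))"
    "lie (y j) (l i :: 'a sv_uea fps) = - smul uea_scalar (half j - of_int i / 2) (y (j + i))"
    "lie (y j) (m i :: 'a sv_uea fps) = 0"
    using lie_swap[OF a(2)] lie_swap[OF a(3)] lie_swap[OF a(6)] by simp_all
qed

abbreviation w :: "'a::field_char_0 sv_uea fps" where "w \<equiv> - Xmul (m n0)"

lemma w0: "w $ 0 = 0"
  by (simp add: Xmul_def)

lemma E_eval: "E c = fps_eval uea_scalar w (fps_binomial (c / of_int n0))"
  by (simp add: E_def one_minus_powr_eval m_def)

lemma E_0: "E 0 = 1"
  by (simp add: E_eval fps_binomial_0 fps_eval_1[OF scalar_map_uea_scalar w0])

lemma E_add: "E a * E b = E (a + b)"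
  by (simp add: E_eval add_divide_distrib fps_binomial_add_mult
      fps_eval_mult[OF scalar_map_uea_scalar w0])

lemma E_n0: "E (of_int n0) = 1 - Xmul (m n0)"
  using n0 by (simp add: E_eval fps_binomial_1 fps_eval_add[OF scalar_map_uea_scalar w0]
      fps_eval_1[OF scalar_map_uea_scalar w0] fps_eval_X[OF scalar_map_uea_scalar w0])

lemma lie_E_0: assumes "lie x (m n0) = 0" shows "lie x (E c) = 0" "lie (E c) x = 0"
proof -
  have "x * w = w * x"
    using assms by (simp add: Xmul_simps lie_def)
  then show 1: "lie x (E c) = 0"
    unfolding E_eval lie_def
    using fps_eval_commute[OF scalar_map_uea_scalar w0] by simp
  show "lie (E c) x = 0" using lie_swap[OF 1] by simp
qed

text \<open>Chain rule for ad L_i: the bracket [L_i, -et] = -n0 t M_{i+n0} commutes with e, and its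
  factor n0 cancels the division by n0 in the exponent of \<open>E c\<close>.\<close>

lemma lie_E_l: 
  "lie (l i) (E c) = - smul uea_scalar c (Xmul (E (c - of_int n0) * m (i + n0)))"
  "lie (E c) (l i) = smul uea_scalar c (Xmul (E (c - of_int n0) * m (i + n0)))"
proof -
  have lw: "lie (l i) w = - smul uea_scalar (of_int n0) (Xmul (m (i + n0)))"
    by (simp add: Xmul_simps lie_simps lie_gen smul1_simps add.commute)
  have "lie (smul uea_scalar (of_int n0) (Xmul (m (i + n0)))) w = 0"
    by (simp add: smul1_simps Xmul_simps lie_simps lie_gen)
  then have "smul uea_scalar (of_int n0) (Xmul (m (i + n0))) * w =
      w * smul uea_scalar (of_int n0) (Xmul (m (i + n0)))"
    unfolding lie_def by (simp only: right_minus_eq)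
  then have c: "lie (l i) w * w = w * lie (l i) w"
    unfolding lw by (simp only: mult_minus_left mult_minus_right neg_equal_iff_equal)
  have "lie (l i) (E c) = lie (l i) w * fps_eval uea_scalar w (fps_deriv (fps_binomial (c / of_int
      n0)))"
    unfolding E_eval
  proof (rule fps_eval_derivation[OF scalar_map_uea_scalar w0, of "lie (l i)"])
    show "lie (l i) (fps_const (uea_scalar c)) = 0" for c
      unfolding lie_def right_minus_eq
      by (rule scalar_mapD(4)[OF scalar_map_const[OF scalar_map_uea_scalar], symmetric])
  qed (simp_all only: c lie_simps(1,2) lie_simps(12) add.commute)
  also have "fps_eval uea_scalar w (fps_deriv (fps_binomial (c / of_int n0))) =
      smul uea_scalar (c / of_int n0) (E (c - of_int n0))"
    using n0 by (simp add: fps_deriv_binomial fps_eval_mult[OF scalar_map_uea_scalar w0]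
        fps_eval_const[OF scalar_map_uea_scalar w0] smul_def E_eval diff_divide_distrib)
  also have "lie (l i) w * \<dots> = - smul uea_scalar c (Xmul (m (i + n0) * E (c - of_int n0)))"
    using n0 by (simp add: lw smul1_simps Xmul_simps)
  also have "m (i + n0) * E (c - of_int n0) = E (c - of_int n0) * m (i + n0)"
    using lie_E_0(1)[OF lie_gen(7), of "i + n0" "c - of_int n0"] by (simp add: lie_def)
  finally show 1: "lie (l i) (E c) = - smul uea_scalar c (Xmul (E (c - of_int n0) * m (i + n0)))" .
  show "lie (E c) (l i) = smul uea_scalar c (Xmul (E (c - of_int n0) * m (i + n0)))"
    using lie_swap[OF 1] by simp
qed

lemma lie_E:
  "lie (m i) (E c) = 0" "lie (E c) (m i) = 0" "lie (y i) (E c) = 0" "lie (E c) (y i) = 0"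
  "lie (E c) (E d) = 0"
  by (rule lie_E_0[OF lie_gen(7)] lie_E_0[OF lie_gen(9)] lie_E_0(1)[OF lie_E_0(2)[OF lie_gen(7)]])+

lemma commuteI: assumes "lie a b = 0" shows "a * b = b * a" "a * (b * x) = b * (a * x)"
  using assms unfolding lie_def by (simp_all, metis mult.assoc)

text \<open>Sorts products so that powers \<open>E\<close> stand first, then \<open>m\<close>, then
  \<open>y\<close>. The \<open>l\<close> stay where they are, since moving them creates commutators,
  and products of two \<open>y\<close> keep their order because these do not commute.\<close>

lemma order_simps:
  "m i * E c = E c * m i" "m i * (E c * x) = E c * (m i * x)"
  "y i * E c = E c * y i" "y i * (E c * x) = E c * (y i * x)"
  "E c * (E d * x) = E (c + d) * x"
  "y i * m j = m j * y i" "y i * (m j * x) = m j * (y i * x)"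
  "m i * m j = m j * m i" "m i * (m j * x) = m j * (m i * x)"
  by (rule commuteI lie_E lie_gen)+ (simp add: E_add[symmetric]
      mult.assoc, (rule commuteI lie_E lie_gen)+)

lemma half_add: "half (j + i) = half j + (of_int i :: 'a::field_char_0)"
  by (simp add: half_def)

lemma half_half: "half i + half j = (of_int (i + j + 1) :: 'a::field_char_0)"
  by (simp add: half_def)

text \<open>The prescribed value, using n0 h = L_0 and (1 - et)^(-1) =
  \<open>E (- of_int n0)\<close>.\<close>

definition DL :: "int \<Rightarrow> 'a::field_char_0 sv_uea2 fps" where
  "DL n = 1 \<otimes>\<^sub>t l n + l n \<otimes>\<^sub>t E (of_int n) + Xmul (l 0 \<otimes>\<^sub>t (E (- of_int n0) * m (n + n0)))"
definition DY :: "int \<Rightarrow> 'a::field_char_0 sv_uea2 fps" where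
  "DY p = 1 \<otimes>\<^sub>t y p + y p \<otimes>\<^sub>t E (half p)"
definition DM :: "int \<Rightarrow> 'a::field_char_0 sv_uea2 fps" where
  "DM k = 1 \<otimes>\<^sub>t m k + m k \<otimes>\<^sub>t E (of_int k)"

lemmas calc = lie_simps lie_tensor Xmul_simps tensor_simps smul1_simps smul2_simps
  lie_gen lie_E lie_E_l order_simps E_add

text \<open>For a generator x of degree d, the bracket of 1 \<otimes> L_i with x \<otimes>
  \<open>E d\<close> is the unwanted term -d t x \<otimes> \<open>E (d - of_int n0)\<close>
  M_{i+n0}. The third summand of \<open>DL i\<close> cancels it, since [L_0, x] = d x. In the
  bracket of Y_p and Y_q the exponents p and q add up to the degree of M_{p+q}.\<close>

lemma D_relations: "sv_relations (\<lambda>c. fps_const (uea2_scalar c)) DL DY (DM :: int \<Rightarrow> 'a::field_char_0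
    sv_uea2 fps)"
  unfolding sv_relations_def lie_def[symmetric] smul_def[symmetric]
proof (intro conjI allI)
  fix i j :: int
  show "lie (DL i) (DL j) = smul uea2_scalar (of_int (j - i)) (DL (j + i) :: 'a sv_uea2 fps)"
    unfolding DL_def by (simp add: calc algebra_simps)
  show "lie (DL i) (DM j) = smul uea2_scalar (of_int j) (DM (j + i) :: 'a sv_uea2 fps)"
    unfolding DL_def DM_def by (simp add: calc algebra_simps)
  show "lie (DL i) (DY j) = smul uea2_scalar (half j - of_int i / 2) (DY (j + i) :: 'a sv_uea2 fps)"
    unfolding DL_def DY_def half_add by (simp add: calc algebra_simps)
  show "lie (DY i) (DY j) = smul uea2_scalar (half j - half i) (DM (i + j + 1) :: 'a sv_uea2 fps)"
    unfolding DM_def DY_def by (simp add: calc half_half algebra_simps)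
  have "lie (DM i) (DM j) = (0 :: 'a sv_uea2 fps)" "lie (DM i) (DY j) = (0 :: 'a sv_uea2 fps)"
    unfolding DM_def DY_def by (simp_all add: calc)
  then show "DM i * DM j = DM j * (DM i :: 'a sv_uea2 fps)"
      "DM i * DY j = DY j * (DM i :: 'a sv_uea2 fps)"
    by (simp_all add: lie_def)
qed

section \<open>Relations for the negated values of the antipode\<close>

definition RM :: "int \<Rightarrow> 'a::field_char_0 sv_uea fps" where "RM k = E (- of_int k) * m k"
definition RY :: "int \<Rightarrow> 'a::field_char_0 sv_uea fps" where "RY p = E (- half p) * y p"
text \<open>The second factor of the prescribed S(L_n), rewritten with n0 (h + 1) = L_0 +
  n0.\<close>

definition A :: "int \<Rightarrow> 'a::field_char_0 sv_uea fps" where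
  "A n = l n - Xmul (m (n + n0) * (l 0 + smul uea_scalar (of_int n0) 1))"
definition RL :: "int \<Rightarrow> 'a::field_char_0 sv_uea fps" where "RL n = E (- of_int n) * A n"

text \<open>Since \<open>E (of_int n0)\<close> is 1 - et, a factor et can be traded for a shift of
  the exponent. This is how terms of different order in t are made to cancel.\<close>

lemma Xmul_E_m: "Xmul (E (c - of_int n0) * m n0) = E (c - of_int n0) - E c"
proof -
  have "E c = E (c - of_int n0) * E (of_int n0)" by (simp add: E_add)
  then show ?thesis unfolding E_n0 by (simp add: algebra_simps Xmul_simps)
qed

lemma Xmul_E_mm: "Xmul (E (c - of_int n0) * (m n0 * x)) = E (c - of_int n0) * x - E c * x"
proof -
  have "Xmul (E (c - of_int n0) * (m n0 * x)) = Xmul (E (c - of_int n0) * m n0) * x"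
    by (simp add: Xmul_simps mult.assoc)
  then show ?thesis by (simp add: Xmul_E_m left_diff_distrib)
qed

text \<open>The summand L_n of \<open>A\<close> lowers the exponent by n0. The summand with L_0
  contributes a term of second order in t that multiplies this result by 1 - et, which restores the
  exponent c.\<close>

lemma lie_A_E: "lie (A i) (E c) = - smul uea_scalar c (Xmul (E c * m (i + n0)))"
proof -
  have "lie (A i) (E c) = - smul uea_scalar c (Xmul (E (c - of_int n0) * m (i + n0)))
      + smul uea_scalar c (Xmul (Xmul (E (c - of_int n0) * (m n0 * m (i + n0)))))"
    unfolding A_def by (simp add: calc)
  then show ?thesis
    by (simp only: Xmul_E_mm Xmul_simps smul1_simps) simp
qed

lemma lie_A_m: "lie (A i) (m j) = smul uea_scalar (of_int j) (m (j + i)) -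
    smul uea_scalar (of_int j) (Xmul (m (i + n0) * m j))"
  unfolding A_def by (simp add: calc)

lemma lie_A_y: "lie (A i) (y j) = smul uea_scalar (half j - of_int i / 2) (y (j + i)) -
    smul uea_scalar (half j) (Xmul (m (i + n0) * y j))"
  unfolding A_def by (simp add: calc)

lemma lie_A_A: "lie (A i) (A j) = smul uea_scalar (of_int (j - i)) (A (j + i))
   + smul uea_scalar (of_int i) (Xmul (m (j + n0) * A i)) - smul uea_scalar (of_int j) (Xmul (m (i +
       n0) * A j))"
  unfolding A_def by (simp add: calc algebra_simps)

text \<open>The correction terms of order t in \<open>lie_A_m\<close>, \<open>lie_A_y\<close> and
  \<open>lie_A_A\<close> are exactly those that the commutators of \<open>A\<close> with the
  prefactors \<open>E\<close> cancel.\<close>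

lemma R_relations: "sv_relations (\<lambda>c. fps_const (uea_scalar c)) RL RY (RM :: int \<Rightarrow> 'a::field_char_0
    sv_uea fps)"
  unfolding sv_relations_def lie_def[symmetric] smul_def[symmetric]
proof (intro conjI allI)
  fix i j :: int
  have EA: "lie (E c) (A i) = smul uea_scalar c (Xmul (E c * m (i + n0)))" for c :: 'a and i
    using lie_swap[OF lie_A_E] by simp
  note calcR = lie_simps Xmul_simps smul1_simps lie_E order_simps E_add lie_A_E EA
  show "lie (RL i) (RL j) = smul uea_scalar (of_int (j - i)) (RL (j + i) :: 'a sv_uea fps)"
    unfolding RL_def by (simp add: calcR lie_A_A algebra_simps)
  show "lie (RL i) (RM j) = smul uea_scalar (of_int j) (RM (j + i) :: 'a sv_uea fps)"
    unfolding RL_def RM_def by (simp add: calcR lie_A_m algebra_simps)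
  show "lie (RL i) (RY j) = smul uea_scalar (half j - of_int i / 2) (RY (j + i) :: 'a sv_uea fps)"
    unfolding RL_def RY_def half_add by (simp add: calcR lie_A_y algebra_simps)
  show "lie (RY i) (RY j) = smul uea_scalar (half j - half i) (RM (i + j + 1) :: 'a sv_uea fps)"
    unfolding RM_def RY_def half_half[symmetric] by (simp add: calcR lie_gen algebra_simps)
  have "lie (RM i) (RM j) = (0 :: 'a sv_uea fps)" "lie (RM i) (RY j) = (0 :: 'a sv_uea fps)"
    unfolding RM_def RY_def by (simp_all add: calc)
  then show "RM i * RM j = RM j * (RM i :: 'a sv_uea fps)"
      "RM i * RY j = RY j * (RM i :: 'a sv_uea fps)"
    by (simp_all add: lie_def)
qed

end

section \<open>The comultiplication and the antipode\<close>

lemma fps_eval_0: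
  assumes "scalar_map sc" shows "fps_eval sc 0 f = fps_const (sc (f $ 0))"
proof (rule fps_ext)
  fix n
  have "fps_eval sc 0 f $ n = (\<Sum>i=0..n. if i = 0 then sc (f $ 0) * (1 :: 'b fps) $ n else 0)"
    by (subst fps_eval_nth[OF _ le_refl], simp, intro sum.cong refl) (simp add: power_0_left)
  then show "fps_eval sc 0 f $ n = fps_const (sc (f $ 0)) $ n" by simp
qed

lemma fps_scalar_lin: assumes "scalar_map sc" shows "fps_lin fps_X (fps_scalar sc)"
  unfolding fps_lin_def fps_scalar_def
  by (auto simp: fps_eq_iff scalar_mapD(1)[OF assms] scalar_map_0[OF assms])

lemma fps_scalar_const: assumes "scalar_map sc"
    shows "fps_scalar sc (fps_const c) = fps_const (sc c)"
  by (auto simp: fps_eq_iff fps_scalar_def scalar_map_0[OF assms])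

lemma fps_scalar_mult:
  assumes sc: "scalar_map sc" shows "fps_scalar sc (f * g) = fps_scalar sc f * fps_scalar sc g"
  by (rule fps_lin_mult_hom[OF _ fps_scalar_lin[OF sc]])
     (simp_all add: fps_scalar_const[OF sc] scalar_mapD(2)[OF sc] X_central)

lemma fps_scalar_central: assumes sc: "scalar_map sc"
    shows "x * fps_scalar sc c = fps_scalar sc c * x"
proof (rule fps_lin_eqI[where z = fps_X and f = c])
  show "fps_lin fps_X (\<lambda>c. x * fps_scalar sc c)"
    by (rule fps_lin_mult_left[OF fps_scalar_lin[OF sc]]) (simp add: X_central)
  show "fps_lin fps_X (\<lambda>c. fps_scalar sc c * x)"
    by (rule fps_lin_mult_right[OF fps_scalar_lin[OF sc]])
  show "x * fps_scalar sc (fps_const a) = fps_scalar sc (fps_const a) * x" for a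
    using scalar_mapD(4)[OF scalar_map_const[OF sc], of a x] by (simp add: fps_scalar_const[OF sc])
qed simp

lemma fps_scalar_1: assumes sc: "scalar_map sc" shows "fps_scalar sc 1 = 1"
  using fps_scalar_const[OF sc, of 1] by (simp add: scalar_mapD(3)[OF sc])

lemma fps_lin_counit: "fps_lin fps_X fps_sv_counit"
  by (auto simp: fps_lin_def fps_eq_iff fps_sv_counit_def sv_counit_simps)

lemma fps_counit_const: "fps_sv_counit (fps_const u) = fps_const (sv_counit u)"
  by (auto simp: fps_eq_iff fps_sv_counit_def sv_counit_simps)

lemma fps_counit_mult: "fps_sv_counit (f * g) = fps_sv_counit f * fps_sv_counit g"
  by (rule fps_lin_mult_hom[OF _ fps_lin_counit])
     (simp_all add: fps_counit_const sv_counit_simps X_central)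

lemma fps_counit_1: "fps_sv_counit 1 = 1"
  using fps_counit_const[of 1] by (simp add: sv_counit_simps)

lemma const_tensor2: "fps_const (tensor2 u v) = fps_const u \<otimes>\<^sub>t fps_const v"
  by (simp add: fps_bilin_const[OF biadditive_tensor(1)])

lemma const_scalar2:
  "fps_const (uea2_scalar c) = fps_const (uea_scalar c) \<otimes>\<^sub>t 1"
  "fps_const (uea2_scalar c) = 1 \<otimes>\<^sub>t fps_const (uea_scalar c)"
proof -
  have "tensor2 (uea_scalar c) 1 = uea2_scalar c" "tensor2 1 (uea_scalar c) = uea2_scalar c"
    using tensor2_simps(3)[of c 1 1] tensor2_simps(4)[of 1 c 1] by (simp_all add: tensor2_simps(6))
  then show "fps_const (uea2_scalar c) = fps_const (uea_scalar c) \<otimes>\<^sub>t 1"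
    "fps_const (uea2_scalar c) = 1 \<otimes>\<^sub>t fps_const (uea_scalar c)"
    by (metis const_tensor2 fps_const_1_eq_1)+
qed

lemma fps_lin_tensor_hom:
  fixes T :: "'a::field_char_0 sv_uea2 fps \<Rightarrow> 'r::ring_1 fps"
  assumes T: "fps_lin fps_X T"
    and m: "\<And>f g f' g'. T ((f * f') \<otimes>\<^sub>t (g * g')) = T (f \<otimes>\<^sub>t g) * T (f' \<otimes>\<^sub>t g')"
  shows "T (w * w') = T w * T w'"
proof -
  have 1: "T (fps_const (tensor2 u v) * w') = T (fps_const (tensor2 u v)) * T w'" for u v w'
    by (rule fps_lin_tensor_eqI[OF fps_lin_premult[OF T] fps_lin_mult_left[OF T]])
       (rule X_central[symmetric], simp only: const_tensor2 fps_tensor_mult m)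
  show ?thesis
    by (rule fps_lin_tensor_eqI[OF fps_lin_postmult[OF T] fps_lin_mult_right[OF T]]) (rule 1)
qed

context sv_twist
begin

definition \<Delta> :: "'a::field_char_0 sv_uea fps \<Rightarrow> 'a sv_uea2 fps" where
  "\<Delta> = fps_extend (uea_lift (\<lambda>c. fps_const (uea2_scalar c)) DL DY DM)"

definition \<rho> :: "'a::field_char_0 sv_uea \<Rightarrow> 'a sv_uea fps" where
  "\<rho> = uea_lift (\<lambda>c. fps_const (uea_scalar c)) RL RY RM"

definition S :: "'a::field_char_0 sv_uea fps \<Rightarrow> 'a sv_uea fps" where
  "S = fps_extend (\<lambda>u. \<rho> (sv_antipode u))"

lemmas D_lift = scalar_map_const[OF scalar_map_uea2_scalar] D_relations
lemmas R_lift = scalar_map_const[OF scalar_map_uea_scalar] R_relations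

lemma Delta_lin: "fps_lin fps_X \<Delta>"
  unfolding \<Delta>_def by (rule fps_lin_extend) (rule uea_lift_add[OF D_lift])

lemma Delta_const: "\<Delta> (fps_const u) = uea_lift (\<lambda>c. fps_const (uea2_scalar c)) DL DY DM u"
  unfolding \<Delta>_def by (rule fps_extend_const) (rule uea_lift_add[OF D_lift])

lemma Delta_scalar: "\<Delta> (fps_const (uea_scalar c)) = fps_const (uea2_scalar c)"
  by (simp only: Delta_const uea_lift_scalar[OF D_lift])

lemma Delta_gen: "\<Delta> (l n) = DL n" "\<Delta> (y n) = DY n" "\<Delta> (m n) = DM n"
  by (simp_all only: Delta_const l_def y_def m_def uea_lift_gen[OF D_lift])

lemma Delta_mult: "\<Delta> (f * g) = \<Delta> f * \<Delta> g"
  by (rule fps_lin_mult_hom[OF _ Delta_lin])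
     (simp, rule X_central, simp only: Delta_const uea_lift_mult[OF D_lift])

lemma Delta_1: "\<Delta> 1 = 1"
  using Delta_scalar[of 1] by (simp add: scalar_mapD(3) scalar_map_uea_scalar
      scalar_map_uea2_scalar)

lemma rho_add: "\<rho> (u + v) = \<rho> u + \<rho> v" and rho_mult: "\<rho> (u * v) = \<rho> u * \<rho> v"
  and rho_scalar: "\<rho> (uea_scalar c) = fps_const (uea_scalar c)"
  and rho_gen: "\<rho> (sv_L n) = RL n" "\<rho> (sv_Y n) = RY n" "\<rho> (sv_M n) = RM n"
  unfolding \<rho>_def
  by (rule uea_lift_add[OF R_lift] uea_lift_mult[OF R_lift] uea_lift_scalar[OF R_lift]
      uea_lift_gen[OF R_lift])+

lemma rho_uminus: "\<rho> (- u) = - \<rho> u"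
proof -
  have "\<rho> 0 = \<rho> 0 + \<rho> (0 :: 'a sv_uea)" using rho_add[of 0 0] by simp
  then have "\<rho> u + \<rho> (- u) = 0" using rho_add[of u "- u"] by simp
  then show ?thesis by (rule minus_unique[symmetric])
qed

lemma S_lin: "fps_lin fps_X S"
  unfolding S_def by (rule fps_lin_extend) (simp only: sv_antipode_add rho_add)

lemma S_const: "S (fps_const u) = \<rho> (sv_antipode u)"
  unfolding S_def by (rule fps_extend_const) (simp only: sv_antipode_add rho_add)

lemma S_scalar: "S (fps_const (uea_scalar c)) = fps_const (uea_scalar c)"
  by (simp only: S_const sv_antipode_scalar rho_scalar)

lemma S_gen: "S (l n) = - RL n" "S (y n) = - RY n" "S (m n) = - RM n"
  by (simp_all only: S_const l_def y_def m_def sv_L_def sv_Y_def sv_M_def sv_antipode_incl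
      rho_uminus,
      simp_all only: flip: sv_L_def sv_Y_def sv_M_def, simp_all only: rho_gen)

lemma S_mult: "S (f * g) = S g * S f"
  by (rule fps_lin_mult_antihom[OF S_lin]) (simp only: S_const sv_antipode_mult rho_mult)

lemma S_1: "S 1 = 1"
  using S_scalar[of 1] by (simp add: scalar_mapD(3) scalar_map_uea_scalar)

lemma counit_gen: "fps_sv_counit (l n) = 0" "fps_sv_counit (y n) = 0" "fps_sv_counit (m n) = 0"
  by (simp_all add: l_def y_def m_def sv_L_def sv_Y_def sv_M_def fps_counit_const sv_counit_simps)

lemma lin_Xmul: "fps_lin fps_X F \<Longrightarrow> F (Xmul f) = Xmul (F f)"
  by (simp add: Xmul_def fps_lin_X)

lemma Xmul_nth_0: "Xmul f $ 0 = 0"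
  by (simp add: Xmul_def)

lemma counit_E: "fps_sv_counit (E c) = 1"
proof -
  have z: "fps_sv_counit w = 0"
    by (simp add: fps_lin_uminus[OF fps_lin_counit] lin_Xmul[OF fps_lin_counit]
        counit_gen Xmul_simps)
  have "fps_sv_counit (E c) = fps_eval (\<lambda>c. c) (fps_sv_counit w) (fps_binomial (c / of_int n0))"
    unfolding E_eval
    by (rule fps_eval_hom[OF scalar_map_uea_scalar w0 fps_lin_counit])
       (simp_all add: fps_counit_mult fps_counit_const sv_counit_simps scalar_map_id z del:
           mult_minus_left mult_minus_right)
  then show ?thesis by (simp add: z fps_eval_0[OF scalar_map_id])
qed

lemma E_inv: "E (- c) * E c = 1" "E c * E (- c) = 1"
  by (simp_all add: E_add E_0)

lemma Delta_E: "\<Delta> (E c) = E c \<otimes>\<^sub>t E c"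
proof -
  let ?b = "fps_binomial (c / of_int n0)" and ?ev = "fps_eval uea2_scalar"
  define a b where "a = fps_const (tensor2 (sv_M n0) (1 :: 'a sv_uea))"
      and "b = fps_const (tensor2 1 (sv_M n0 :: 'a sv_uea))"
  have ab: "m n0 \<otimes>\<^sub>t 1 = a" "1 \<otimes>\<^sub>t m n0 = b"
    by (simp_all add: a_def b_def m_def const_tensor2)
  have c: "a * b = b * a"
    by (simp add: a_def b_def tensor2_simps)
  have d: "fps_deriv a = 0" "fps_deriv b = 0" by (simp_all add: a_def b_def)
  have dX: "fps_deriv (Xmul a) = a" "fps_deriv (Xmul b) = b"
    by (simp_all add: Xmul_def d)
  have Dw: "\<Delta> w = - Xmul (DM n0)"
    by (simp add: fps_lin_uminus[OF Delta_lin] lin_Xmul[OF Delta_lin] Delta_gen)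
  have Dw0: "\<Delta> w $ 0 = 0" unfolding Dw by (simp add: Xmul_def)
  have "\<Delta> (E c) = ?ev (\<Delta> w) ?b"
    unfolding E_eval
    by (rule fps_eval_hom[OF scalar_map_uea_scalar w0 Delta_lin _ Delta_scalar
        scalar_map_uea2_scalar Dw0])
       (simp add: Delta_mult)
  \<comment> \<open>Since \<Delta>(e) = 1 \<otimes> e + e \<otimes> (1 - et) = a + b - t a b, the
    base 1 + \<Delta>(w) factors as (1 - ta)(1 - tb). The derivatives a and b of the two arguments
    commute with everything involved.\<close>
  moreover have "?ev (- Xmul a) ?b * ?ev (- Xmul b) ?b = ?ev (\<Delta> w) ?b"
  proof (rule fps_eval_binomial_mult[OF scalar_map_uea2_scalar])
    have "a * b = m n0 \<otimes>\<^sub>t m n0" by (simp add: ab[symmetric] fps_tensor_mult)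
    then show "1 + \<Delta> w = (1 + - Xmul a) * (1 + - Xmul b)"
      by (simp add: Dw DM_def E_n0 ab tensor_simps Xmul_simps algebra_simps)
  qed (simp_all add: dX Xmul_simps c Xmul_nth_0)
  moreover have "E c \<otimes>\<^sub>t 1 = ?ev (w \<otimes>\<^sub>t 1) ?b"
    unfolding E_eval
    by (rule fps_eval_hom[OF scalar_map_uea_scalar w0, where H = "\<lambda>f. f \<otimes>\<^sub>t 1"])
       (simp_all add: fps_bilin_lin[OF biadditive_tensor(1)]
           fps_tensor_mult const_scalar2(1)[symmetric]
         scalar_map_uea2_scalar tensor_simps ab Xmul_nth_0)
  moreover have "1 \<otimes>\<^sub>t E c = ?ev (1 \<otimes>\<^sub>t w) ?b"
    unfolding E_eval
    by (rule fps_eval_hom[OF scalar_map_uea_scalar w0, where H = "\<lambda>f. 1 \<otimes>\<^sub>t f"])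
       (simp_all add: fps_bilin_lin[OF biadditive_tensor(1)]
           fps_tensor_mult const_scalar2(2)[symmetric]
         scalar_map_uea2_scalar tensor_simps ab Xmul_nth_0)
  moreover have "w \<otimes>\<^sub>t 1 = - Xmul a" "1 \<otimes>\<^sub>t w = - Xmul b"
    by (simp_all add: tensor_simps ab)
  moreover have "E c \<otimes>\<^sub>t E c = (E c \<otimes>\<^sub>t 1) * (1 \<otimes>\<^sub>t E c)"
    by (simp add: fps_tensor_mult)
  ultimately show ?thesis by simp
qed

text \<open>Gives the derivative of S(w) in \<open>S_E\<close> explicitly, so that the commutation
  hypotheses of the binomial rule can be checked there.\<close>

lemma deriv_E: "fps_deriv (E c) = - (smul uea_scalar (c / of_int n0) (m n0 * E (c - of_int n0)))"
proof -
  have dX: "fps_deriv (Xmul (m n0)) = m n0" by (simp add: Xmul_def m_def)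
  have "fps_deriv (E c) = fps_deriv w * fps_eval uea_scalar w (fps_deriv (fps_binomial (c / of_int
      n0)))"
    unfolding E_eval
    by (rule fps_eval_derivation[OF scalar_map_uea_scalar w0]) (simp_all add: dX Xmul_simps)
  also have "fps_eval uea_scalar w (fps_deriv (fps_binomial (c / of_int n0))) =
      smul uea_scalar (c / of_int n0) (E (c - of_int n0))"
    using n0 by (simp add: fps_deriv_binomial fps_eval_mult[OF scalar_map_uea_scalar w0]
        fps_eval_const[OF scalar_map_uea_scalar w0] smul_def E_eval diff_divide_distrib)
  finally show ?thesis by (simp add: dX smul1_simps)
qed

lemma S_E: "S (E c) = E (- c)"
proof -
  let ?b = "fps_binomial (c / of_int n0)" and ?ev = "fps_eval uea_scalar"
  \<comment> \<open>S(e) is -(1 - et)^(-1) e, hence S(w) = t e (1 - et)^(-1), and trading et for a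
    shift of the exponent shows that 1 + S(w) is the inverse of 1 + w.\<close>
  have Sw: "S w = E (- of_int n0) - 1"
    using Xmul_E_m[of 0]
    by (simp add: fps_lin_uminus[OF S_lin] lin_Xmul[OF S_lin] S_gen RM_def Xmul_simps E_0)
  have Sw0: "S w $ 0 = 0"
    by (simp add: fps_lin_uminus[OF S_lin] lin_Xmul[OF S_lin]) (simp add: Xmul_def)
  have "S (E c) = ?ev (S w) ?b"
    unfolding E_eval
    by (rule fps_eval_hom[OF scalar_map_uea_scalar w0 S_lin _ S_scalar scalar_map_uea_scalar Sw0])
       (simp add: S_mult)
  \<comment> \<open>The two bases have product 1 = 1 + 0, so the product of the powers is the series
    at 0, and S(\<open>E c\<close>) is inverse to \<open>E c\<close>.\<close>
  moreover have "?ev w ?b * ?ev (S w) ?b = ?ev 0 ?b"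
  proof (rule fps_eval_binomial_mult[OF scalar_map_uea_scalar w0 Sw0])
    have dX: "fps_deriv (Xmul (m n0)) = m n0" by (simp add: Xmul_def m_def)
    have dS: "fps_deriv (E (- of_int n0)) = m n0 * E (- of_int n0 - of_int n0)"
      using n0 by (simp add: deriv_E smul1_simps)
    show "1 + 0 = (1 + w) * (1 + S w)"
      using E_inv(2)[of "of_int n0"] by (simp add: Sw E_n0)
    show "w * S w = S w * w" "fps_deriv w * w = w * fps_deriv w"
        "fps_deriv w * S w = S w * fps_deriv w"
      "fps_deriv (S w) * w = w * fps_deriv (S w)" "fps_deriv (S w) * S w = S w * fps_deriv (S w)"
      "fps_deriv w * fps_deriv (S w) = fps_deriv (S w) * fps_deriv w"
      unfolding Sw by (simp_all add: dS dX Xmul_simps smul1_simps order_simps E_add algebra_simps)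
  qed
  moreover have "?ev 0 ?b = 1"
    by (simp add: fps_eval_0[OF scalar_map_uea_scalar] scalar_mapD(3)[OF scalar_map_uea_scalar])
  ultimately have "E c * S (E c) = 1" by (simp add: E_eval)
  then have "E (- c) * (E c * S (E c)) = E (- c)" by simp
  then show ?thesis by (simp add: E_inv mult.assoc[symmetric])
qed

section \<open>The Hopf algebra axioms\<close>

definition coassoc_left where
  "coassoc_left = fps_tensor_lift uea3_scalar (\<lambda>u v. fps_bilin tensor3 (\<Delta> (fps_const u)) (fps_const
      v))"
definition coassoc_right where
  "coassoc_right = fps_tensor_lift uea3_scalar (\<lambda>u v. fps_bilin tensor12 (fps_const u) (\<Delta> (fps_const
      v)))"

lemma tensor3_scalar:
  "fps_bilin tensor3 (fps_const (uea2_scalar c) * f) g =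
      fps_const (uea3_scalar c) * fps_bilin tensor3 f g"
  "fps_bilin tensor3 f (fps_const (uea_scalar c) * g) =
      fps_const (uea3_scalar c) * fps_bilin tensor3 f g"
proof -
  have 1: "tensor3 (uea2_scalar c) 1 = uea3_scalar c" "tensor3 1 (uea_scalar c) = uea3_scalar c"
    using tensor3_simps(3)[of c 1 1] tensor3_simps(4)[of 1 c 1] by (simp_all add: tensor3_simps(6))
  have 2: "fps_const (uea3_scalar c) = fps_bilin tensor3 (fps_const (uea2_scalar c)) 1"
    "fps_const (uea3_scalar c) = fps_bilin tensor3 1 (fps_const (uea_scalar c))"
    by (metis 1 fps_bilin_const[OF biadditive_tensor(2)] fps_const_1_eq_1)+
  show "fps_bilin tensor3 (fps_const (uea2_scalar c) * f) g =
      fps_const (uea3_scalar c) * fps_bilin tensor3 f g"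
    by (subst 2(1)) (simp add: fps_tensor3_mult)
  show "fps_bilin tensor3 f (fps_const (uea_scalar c) * g) =
      fps_const (uea3_scalar c) * fps_bilin tensor3 f g"
    by (subst 2(2)) (simp add: fps_tensor3_mult)
qed

lemma tensor12_scalar:
  "fps_bilin tensor12 (fps_const (uea_scalar c) * f) g =
      fps_const (uea3_scalar c) * fps_bilin tensor12 f g"
  "fps_bilin tensor12 f (fps_const (uea2_scalar c) * g) =
      fps_const (uea3_scalar c) * fps_bilin tensor12 f g"
proof -
  have e: "uea2_scalar c = tensor2 (uea_scalar c) 1" "uea2_scalar c = tensor2 1 (uea_scalar c)"
    using tensor2_simps(3)[of c 1 1] tensor2_simps(4)[of 1 c 1] by (simp_all add: tensor2_simps(6))
  have o: "tensor2 1 1 = (1 :: 'a sv_uea2)" by (rule tensor2_simps)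
  have 1: "tensor12 (uea_scalar c) 1 = uea3_scalar c" "tensor12 1 (uea2_scalar c) = uea3_scalar c"
    using tensor12_tensor2[of "uea_scalar c" 1 1] tensor12_tensor2[of 1 1 "uea_scalar c"]
      tensor3_simps(3)[of c 1 1] tensor3_simps(4)[of 1 c 1]
    by (simp_all add: o tensor3_simps(6) flip: e)
  have 2: "fps_const (uea3_scalar c) = fps_bilin tensor12 (fps_const (uea_scalar c)) 1"
    "fps_const (uea3_scalar c) = fps_bilin tensor12 1 (fps_const (uea2_scalar c))"
    by (metis 1 fps_bilin_const[OF biadditive_tensor12] fps_const_1_eq_1)+
  show "fps_bilin tensor12 (fps_const (uea_scalar c) * f) g =
      fps_const (uea3_scalar c) * fps_bilin tensor12 f g"
    by (subst 2(1)) (simp add: fps_tensor12_mult)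
  show "fps_bilin tensor12 f (fps_const (uea2_scalar c) * g) =
      fps_const (uea3_scalar c) * fps_bilin tensor12 f g"
    by (subst 2(2)) (simp add: fps_tensor12_mult)
qed

lemma coassoc_left:
  "fps_lin fps_X (coassoc_left :: 'a::field_char_0 sv_uea2 fps \<Rightarrow> _)"
  "coassoc_left (f \<otimes>\<^sub>t g :: 'a sv_uea2 fps) = fps_bilin tensor3 (\<Delta> f) g"
proof -
  have b: "fps_bilinear uea3_scalar (\<lambda>f g. fps_bilin tensor3 (\<Delta> f) (g :: 'a sv_uea fps))"
    unfolding fps_bilinear_def
    by (auto simp: fps_bilin_lin[OF biadditive_tensor(2)]
        fps_lin_comp[OF fps_bilin_lin(1)[OF biadditive_tensor(2)] Delta_lin]
        Delta_mult Delta_scalar tensor3_scalar)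
  show "fps_lin fps_X (coassoc_left :: 'a sv_uea2 fps \<Rightarrow> _)"
    "coassoc_left (f \<otimes>\<^sub>t g :: 'a sv_uea2 fps) = fps_bilin tensor3 (\<Delta> f) g"
    unfolding coassoc_left_def by (rule fps_tensor_lift_bilinear[OF scalar_map_uea3_scalar b])+
qed

lemma coassoc_right:
  "fps_lin fps_X (coassoc_right :: 'a::field_char_0 sv_uea2 fps \<Rightarrow> _)"
  "coassoc_right (f \<otimes>\<^sub>t g :: 'a sv_uea2 fps) = fps_bilin tensor12 f (\<Delta> g)"
proof -
  have b: "fps_bilinear uea3_scalar (\<lambda>f g. fps_bilin tensor12 f (\<Delta> (g :: 'a sv_uea fps)))"
    unfolding fps_bilinear_def
    by (auto simp: fps_bilin_lin[OF biadditive_tensor12]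
        fps_lin_comp[OF fps_bilin_lin(2)[OF biadditive_tensor12] Delta_lin]
        Delta_mult Delta_scalar tensor12_scalar)
  show "fps_lin fps_X (coassoc_right :: 'a sv_uea2 fps \<Rightarrow> _)"
    "coassoc_right (f \<otimes>\<^sub>t g :: 'a sv_uea2 fps) = fps_bilin tensor12 f (\<Delta> g)"
    unfolding coassoc_right_def by (rule fps_tensor_lift_bilinear[OF scalar_map_uea3_scalar b])+
qed

text \<open>With the multiplicativity of \<Delta>, this reduces coassociativity to scalars and
  generators.\<close>

lemma coassoc_mult:
  "coassoc_left (x * x') = coassoc_left x * coassoc_left x'"
  "coassoc_right (x * x') = coassoc_right x * coassoc_right x'"
  by (rule fps_lin_tensor_hom[OF coassoc_left(1)], simp add: coassoc_left(2) fps_tensor3_mult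
      Delta_mult)
     (rule fps_lin_tensor_hom[OF coassoc_right(1)], simp add: coassoc_right(2) fps_tensor12_mult
         Delta_mult)

text \<open>The third summand telescopes: t L_0 \<otimes> (1 - et)^(-1) e is L_0 \<otimes> (1 -
  et)^(-1) - L_0 \<otimes> 1, and the last term cancels L_0 \<otimes> \<open>E 0\<close>.\<close>

lemma DL_0: "DL 0 = 1 \<otimes>\<^sub>t (l 0 :: 'a::field_char_0 sv_uea fps) + l 0 \<otimes>\<^sub>t E (- of_int n0)"
proof -
  have "(l 0 :: 'a sv_uea fps) \<otimes>\<^sub>t Xmul (E (0 - of_int n0) * m n0) = l 0 \<otimes>\<^sub>t (E (- of_int n0) - 1)"
    by (simp only: Xmul_E_m E_0) simp
  then have "Xmul ((l 0 :: 'a sv_uea fps) \<otimes>\<^sub>t (E (- of_int n0) * m n0)) =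
      l 0 \<otimes>\<^sub>t E (- of_int n0) - l 0 \<otimes>\<^sub>t 1"
    by (simp add: tensor_simps)
  then show ?thesis by (simp add: DL_def E_0)
qed

text \<open>Splits the unit in the first slot so that all three tensor factors become
  explicit.\<close>

lemma tensor3_1: "fps_bilin tensor3 1 f = fps_bilin tensor3 (1 \<otimes>\<^sub>t 1) f"
  by (simp add: tensor_1)

lemmas coassoc_simps = fps_lin_add[OF coassoc_left(1)] lin_Xmul[OF coassoc_left(1)] coassoc_left(2)
  fps_lin_add[OF coassoc_right(1)] lin_Xmul[OF coassoc_right(1)] coassoc_right(2)
  Delta_1 Delta_gen Delta_E fps_tensor_mult fps_tensor12_tensor tensor_simps
  fps_bilin_simps[OF biadditive_tensor(2)] fps_bilin_simps[OF biadditive_tensor12]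

lemma coassoc: "coassoc_left (\<Delta> f) = coassoc_right (\<Delta> f)"
proof (rule fps_lin_eqI[OF _ fps_lin_comp[OF coassoc_left(1) Delta_lin]
    fps_lin_comp[OF coassoc_right(1) Delta_lin]])
  fix u :: "'a sv_uea"
  have M: "coassoc_left (DM n) = coassoc_right (DM n)" for n
    unfolding DM_def by (simp add: coassoc_simps DM_def tensor3_1)
  have Y: "coassoc_left (DY n) = coassoc_right (DY n)" for n
    unfolding DY_def by (simp add: coassoc_simps DY_def tensor3_1)
  have L: "coassoc_left (DL n) = coassoc_right (DL n)" for n
  proof -
    \<comment> \<open>Only the outer \<open>DL\<close> is unfolded. The \<Delta>(L_0) coming from
      the third summand stays as \<open>DL 0\<close>, so that the short form \<open>DL_0\<close> can
      replace it.\<close>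
    have "coassoc_left (DL n) = fps_bilin tensor3 1 (l n) + fps_bilin tensor3 (DL n) (E (of_int n))
        + Xmul (fps_bilin tensor3 (DL 0) (E (- of_int n0) * m (n + n0)))"
      by (subst DL_def) (simp add: coassoc_simps)
    also have "\<dots> = coassoc_right (DL n)"
      unfolding DL_0 by (simp add: coassoc_simps DL_def DM_def tensor3_1 Delta_mult distrib_left
          Xmul_simps E_add order_simps)
    finally show ?thesis .
  qed
  show "coassoc_left (\<Delta> (fps_const u)) = coassoc_right (\<Delta> (fps_const u))"
  proof (induction u rule: sv_uea_hom_eqI)
    fix c
    have "fps_const (uea2_scalar c) = fps_const (uea_scalar c) \<otimes>\<^sub>t 1" by (rule const_scalar2)
    moreover have "fps_bilin tensor3 (fps_const (uea_scalar c) \<otimes>\<^sub>t 1) 1 =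
        fps_bilin tensor12 (fps_const (uea_scalar c)) (1 \<otimes>\<^sub>t 1)"
      by (rule fps_tensor12_tensor[symmetric])
    ultimately show "coassoc_left (\<Delta> (fps_const (uea_scalar c))) =
        coassoc_right (\<Delta> (fps_const (uea_scalar c)))"
      by (simp add: Delta_scalar coassoc_left(2) coassoc_right(2) Delta_1 tensor_1)
  qed (simp_all only: fps_const_add[symmetric] fps_const_mult[symmetric] Delta_mult coassoc_mult
        fps_lin_add[OF Delta_lin] fps_lin_add[OF coassoc_left(1)] fps_lin_add[OF coassoc_right(1)]
        l_def[symmetric] y_def[symmetric] m_def[symmetric] Delta_gen L M Y)
qed simp

section \<open>The maps of the counit and antipode axioms\<close>

definition counit_left where
  "counit_left = fps_tensor_lift uea_scalar (\<lambda>u v. fps_scalar uea_scalar (fps_sv_counit (fps_const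
      u)) * fps_const v)"
definition counit_right where
  "counit_right = fps_tensor_lift uea_scalar (\<lambda>u v. fps_const u *
      fps_scalar uea_scalar (fps_sv_counit (fps_const v)))"
definition antipode_left where
  "antipode_left = fps_tensor_lift uea_scalar (\<lambda>u v. S (fps_const u) * fps_const v)"
definition antipode_right where
  "antipode_right = fps_tensor_lift uea_scalar (\<lambda>u v. fps_const u * S (fps_const v))"

lemma const_scalar_left: "x * (fps_const (uea_scalar c) * z) = fps_const (uea_scalar c) * (x * z)"
  by (metis mult.assoc scalar_mapD(4)[OF scalar_map_const[OF scalar_map_uea_scalar]])

lemma scalar_counit: 
  "fps_scalar uea_scalar (fps_sv_counit (fps_const (uea_scalar c) * f)) =
    fps_const (uea_scalar c) * fps_scalar uea_scalar (fps_sv_counit f)"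
  by (simp add: fps_counit_mult fps_counit_const sv_counit_simps
      fps_scalar_mult[OF scalar_map_uea_scalar]
      fps_scalar_const[OF scalar_map_uea_scalar])

lemma S_scalar_mult: "S (fps_const (uea_scalar c) * f) = fps_const (uea_scalar c) * S f"
  by (simp add: S_mult S_scalar scalar_mapD(4)[OF scalar_map_const[OF scalar_map_uea_scalar]])

lemmas scalar_counit_lin = fps_lin_comp[OF fps_scalar_lin[OF scalar_map_uea_scalar] fps_lin_counit]

lemma counit_antipode_maps:
  "fps_lin fps_X (counit_left :: 'a::field_char_0 sv_uea2 fps \<Rightarrow> _)"
  "counit_left (f \<otimes>\<^sub>t g :: 'a sv_uea2 fps) = fps_scalar uea_scalar (fps_sv_counit f) * g"
  "fps_lin fps_X (counit_right :: 'a::field_char_0 sv_uea2 fps \<Rightarrow> _)"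
  "counit_right (f \<otimes>\<^sub>t g :: 'a sv_uea2 fps) = f * fps_scalar uea_scalar (fps_sv_counit g)"
  "fps_lin fps_X (antipode_left :: 'a::field_char_0 sv_uea2 fps \<Rightarrow> _)"
  "antipode_left (f \<otimes>\<^sub>t g :: 'a sv_uea2 fps) = S f * g"
  "fps_lin fps_X (antipode_right :: 'a::field_char_0 sv_uea2 fps \<Rightarrow> _)"
  "antipode_right (f \<otimes>\<^sub>t g :: 'a sv_uea2 fps) = f * S g"
proof -
  have 1: "fps_bilinear uea_scalar (\<lambda>f g. fps_scalar uea_scalar (fps_sv_counit f) *
      (g :: 'a sv_uea fps))"
    unfolding fps_bilinear_def
    by (intro conjI allI fps_lin_mult_right[OF scalar_counit_lin] fps_lin_mult_left[OF fps_lin_id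
        X_central[symmetric]])
       (simp_all add: scalar_counit mult.assoc const_scalar_left)
  have 2: "fps_bilinear uea_scalar (\<lambda>f g. (f :: 'a sv_uea fps) *
      fps_scalar uea_scalar (fps_sv_counit g))"
    unfolding fps_bilinear_def
    by (intro conjI allI fps_lin_mult_right[OF fps_lin_id] fps_lin_mult_left[OF scalar_counit_lin
        X_central[symmetric]])
       (simp_all add: scalar_counit mult.assoc const_scalar_left)
  have 3: "fps_bilinear uea_scalar (\<lambda>f g. S f * (g :: 'a sv_uea fps))"
    unfolding fps_bilinear_def
    by (intro conjI allI fps_lin_mult_right[OF S_lin] fps_lin_mult_left[OF fps_lin_id
        X_central[symmetric]])
       (simp_all add: S_scalar_mult mult.assoc const_scalar_left)
  have 4: "fps_bilinear uea_scalar (\<lambda>f g. (f :: 'a sv_uea fps) * S g)"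
    unfolding fps_bilinear_def
    by (intro conjI allI fps_lin_mult_right[OF fps_lin_id] fps_lin_mult_left[OF S_lin
        X_central[symmetric]])
       (simp_all add: S_scalar_mult mult.assoc const_scalar_left)
  note t = fps_tensor_lift_bilinear[OF scalar_map_uea_scalar]
  show "fps_lin fps_X (counit_left :: 'a::field_char_0 sv_uea2 fps \<Rightarrow> _)"
    "counit_left (f \<otimes>\<^sub>t g :: 'a sv_uea2 fps) = fps_scalar uea_scalar (fps_sv_counit f) * g"
    unfolding counit_left_def by (rule t[OF 1])+
  show "fps_lin fps_X (counit_right :: 'a::field_char_0 sv_uea2 fps \<Rightarrow> _)"
    "counit_right (f \<otimes>\<^sub>t g :: 'a sv_uea2 fps) = f * fps_scalar uea_scalar (fps_sv_counit g)"
    unfolding counit_right_def by (rule t[OF 2])+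
  show "fps_lin fps_X (antipode_left :: 'a::field_char_0 sv_uea2 fps \<Rightarrow> _)"
    "antipode_left (f \<otimes>\<^sub>t g :: 'a sv_uea2 fps) = S f * g"
    unfolding antipode_left_def by (rule t[OF 3])+
  show "fps_lin fps_X (antipode_right :: 'a::field_char_0 sv_uea2 fps \<Rightarrow> _)"
    "antipode_right (f \<otimes>\<^sub>t g :: 'a sv_uea2 fps) = f * S g"
    unfolding antipode_right_def by (rule t[OF 4])+
qed

end

section \<open>The adjoint representation\<close>

text \<open>
  The adjoint representation, on functions on the basis that need not have finite support,
  separates the \<open>M\<^sub>k\<close> with \<open>k \<noteq> 0\<close> in the enveloping algebra. This makes the theorem of
  Poincare, Birkhoff and Witt unnecessary.
\<close>

typedef (overloaded) 'a sv_endo = "{T :: (sv_gen \<Rightarrow> 'a::field_char_0) \<Rightarrow> sv_gen \<Rightarrow> 'a.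
    (\<forall>f g. T (\<lambda>k. f k + g k) = (\<lambda>k. T f k + T g k)) \<and> (\<forall>c f. T (\<lambda>k. c * f k) = (\<lambda>k. c * T f k))}"
  morphisms endo_apply Endo
  by (rule exI[of _ "\<lambda>f. f"]) simp

setup_lifting type_definition_sv_endo

instantiation sv_endo :: (field_char_0) ring_1
begin

lift_definition zero_sv_endo :: "'a sv_endo" is "\<lambda>f k. 0" by simp
lift_definition one_sv_endo :: "'a sv_endo" is "\<lambda>f. f" by simp
lift_definition plus_sv_endo :: "'a sv_endo \<Rightarrow> 'a sv_endo \<Rightarrow> 'a sv_endo" is "\<lambda>S T f k. S f k + T f k"
  by (simp add: algebra_simps)
lift_definition uminus_sv_endo :: "'a sv_endo \<Rightarrow> 'a sv_endo" is "\<lambda>S f k. - S f k"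
  by simp
lift_definition minus_sv_endo :: "'a sv_endo \<Rightarrow> 'a sv_endo \<Rightarrow> 'a sv_endo" is "\<lambda>S T f k. S f k - T f k"
  by (simp add: algebra_simps)
lift_definition times_sv_endo :: "'a sv_endo \<Rightarrow> 'a sv_endo \<Rightarrow> 'a sv_endo" is "\<lambda>S T f. S (T f)"
  by simp

instance
proof
  show "(0 :: 'a sv_endo) \<noteq> 1"
    by transfer (metis zero_neq_one)
qed (transfer, simp add: fun_eq_iff algebra_simps)+

end

lift_definition endo_scalar :: "'a::field_char_0 \<Rightarrow> 'a sv_endo" is "\<lambda>c f k. c * f k"
  by (simp add: algebra_simps)

lemma scalar_map_endo: "scalar_map endo_scalar"
  unfolding scalar_map_def
  by (intro conjI allI; transfer) (simp_all add: algebra_simps)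

text \<open>The value at a basis element is read off from the single basis element that ad L_n sends
  to a multiple of it, as in [L_n, L_{k-n}] = (k - 2n) L_k. Hence the formula applies to arbitrary
  functions; \<open>ad_Y\<close> and \<open>ad_M\<close> are built the same way.\<close>

lift_definition ad_L :: "int \<Rightarrow> 'a::field_char_0 sv_endo" is "\<lambda>n f g. case g of
    GenL k \<Rightarrow> of_int (k - 2 * n) * f (GenL (k - n))
  | GenY j \<Rightarrow> (half (j - n) - of_int n / 2) * f (GenY (j - n))
  | GenM k \<Rightarrow> of_int (k - n) * f (GenM (k - n))"
  by (auto simp: fun_eq_iff algebra_simps split: sv_gen.split)

lift_definition ad_Y :: "int \<Rightarrow> 'a::field_char_0 sv_endo" is "\<lambda>i f g. case g of
    GenL k \<Rightarrow> 0
  | GenY j \<Rightarrow> - (half i - of_int (j - i) / 2) * f (GenL (j - i))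
  | GenM k \<Rightarrow> (half (k - i - 1) - half i) * f (GenY (k - i - 1))"
  by (auto simp: fun_eq_iff algebra_simps split: sv_gen.split)

lift_definition ad_M :: "int \<Rightarrow> 'a::field_char_0 sv_endo" is "\<lambda>n f g. case g of
    GenL k \<Rightarrow> 0 | GenY j \<Rightarrow> 0 | GenM k \<Rightarrow> - of_int n * f (GenL (k - n))"
  by (auto simp: fun_eq_iff algebra_simps split: sv_gen.split)

lemma ad_relations: "sv_relations endo_scalar ad_L ad_Y (ad_M :: int \<Rightarrow> 'a::field_char_0 sv_endo)"
  unfolding sv_relations_def
  by (intro conjI allI; transfer; intro ext)
     (auto simp: half_def field_simps split: sv_gen.split)

text \<open>The coefficient of M_k after u acts on L_0. Since [M_k, L_0] = -k M_k, it detects M_k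
  precisely when k is nonzero.\<close>

definition M_coord :: "int \<Rightarrow> 'a::field_char_0 sv_uea \<Rightarrow> 'a" where
  "M_coord k u = endo_apply (uea_lift endo_scalar ad_L ad_Y ad_M u) (\<lambda>g. if g =
      GenL 0 then 1 else 0) (GenM k)"

lemma M_coord_M: "M_coord k (sv_M j) = (if j = k then - of_int k else 0)"
  unfolding M_coord_def uea_lift_gen[OF scalar_map_endo ad_relations]
  by (simp add: ad_M.rep_eq)

lemma M_coord_add: "M_coord k (u + v) = M_coord k u + M_coord k v"
  unfolding M_coord_def uea_lift_add[OF scalar_map_endo ad_relations]
  by (simp add: plus_sv_endo.rep_eq)

lemma M_coord_scalar: "M_coord k (uea_scalar c * v) = c * M_coord k v"
  unfolding M_coord_def uea_lift_mult[OF scalar_map_endo ad_relations]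
      uea_lift_scalar[OF scalar_map_endo ad_relations]
  by (simp add: times_sv_endo.rep_eq endo_scalar.rep_eq)

text \<open>The functional \<open>M_coord i\<close> \<otimes> \<open>M_coord j\<close> takes the
  value c i j on the left and 0 on the right.\<close>

lemma tensor_M_neq:
  assumes "i \<noteq> j" "i \<noteq> 0" "j \<noteq> 0" "c \<noteq> (0::'a::field_char_0)"
  shows "tensor2 (uea_scalar c * sv_M i) (sv_M j) \<noteq> tensor2 (sv_M j) (uea_scalar c * sv_M i)"
proof
  let ?b = "\<lambda>u v. M_coord i u * M_coord j v"
  have b: "bilinear_over uea_scalar uea_scalar (\<lambda>c. c) ?b"
    by (simp add: bilinear_over_def M_coord_add M_coord_scalar algebra_simps)
  note t = tensor2_lift_tensor2[OF scalar_map_id b]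
  assume "tensor2 (uea_scalar c * sv_M i) (sv_M j) = tensor2 (sv_M j) (uea_scalar c * sv_M i)"
  then have "?b (uea_scalar c * sv_M i) (sv_M j) = ?b (sv_M j) (uea_scalar c * sv_M i)"
    using t by metis
  then show False using assms by (simp add: M_coord_M M_coord_scalar)
qed

lemma fps_noncommutative: "\<exists>f g :: 'a::field_char_0 sv_uea fps. f * g \<noteq> g * f"
proof (rule ccontr)
  assume "\<not> ?thesis"
  then have "lie (fps_const (sv_L 0)) (fps_const (sv_M 1 :: 'a sv_uea)) = 0"
    by (simp add: lie_def)
  moreover have "lie (fps_const (sv_L 0)) (fps_const (sv_M 1 :: 'a sv_uea)) = fps_const (sv_M 1)"
    using sv_relations_uea[where 'a = 'a] unfolding sv_relations_def
    by (simp add: lie_def scalar_mapD(3)[OF scalar_map_uea_scalar])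
  ultimately have "M_coord 1 (sv_M 1 :: 'a sv_uea) = M_coord 1 0" by simp
  moreover have "M_coord 1 (0 :: 'a sv_uea) = 0"
    using M_coord_add[of 1 0 "0 :: 'a sv_uea"] by simp
  ultimately show False by (simp add: M_coord_M)
qed

section \<open>Counit, antipode and the main theorem\<close>

lemma tensor2_lift_tensor2_id: "tensor2_lift uea2_scalar tensor2 w = w"
proof -
  have b: "bilinear_over uea_scalar uea_scalar uea2_scalar tensor2"
    by (simp add: bilinear_over_def tensor2_simps)
  show ?thesis
    by (induction w rule: sv_uea2_induct)
       (simp_all add: tensor2_lift_tensor2[OF scalar_map_uea2_scalar b]
           tensor2_lift_add[OF scalar_map_uea2_scalar b])
qed

lemma fps_flip_tensor:
  "fps_lin fps_X (fps_flip :: 'a::field_char_0 sv_uea2 fps \<Rightarrow> _)"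
  "fps_flip (f \<otimes>\<^sub>t g :: 'a sv_uea2 fps) = g \<otimes>\<^sub>t f"
proof -
  have b: "fps_bilinear uea2_scalar (\<lambda>f g :: 'a sv_uea fps. g \<otimes>\<^sub>t f)"
    unfolding fps_bilinear_def
    by (intro conjI allI fps_bilin_lin[OF biadditive_tensor(1)]) (simp_all only:
        tensor_smul[unfolded smul_def])
  have "fps_flip = fps_tensor_lift uea2_scalar (\<lambda>u v :: 'a sv_uea. fps_const v \<otimes>\<^sub>t fps_const u)"
    by (simp add: fps_flip_def const_tensor2)
  then show "fps_lin fps_X (fps_flip :: 'a sv_uea2 fps \<Rightarrow> _)"
      "fps_flip (f \<otimes>\<^sub>t g :: 'a sv_uea2 fps) = g \<otimes>\<^sub>t f"
    using fps_tensor_lift_bilinear[OF scalar_map_uea2_scalar b] by simp_all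
qed

context sv_twist
begin

lemma counit_mult:
  "counit_left (x * x') = counit_left x * counit_left x'"
  "counit_right (x * x') = counit_right x * counit_right x'"
proof -
  have c: "a * (fps_scalar uea_scalar d * b) = fps_scalar uea_scalar d * (a * b)"
      for a b :: "'b::field_char_0 sv_uea fps" and d
    by (metis fps_scalar_central[OF scalar_map_uea_scalar] mult.assoc)
  show "counit_left (x * x') = counit_left x * counit_left x'"
    by (rule fps_lin_tensor_hom[OF counit_antipode_maps(1)])
       (simp add: counit_antipode_maps fps_counit_mult fps_scalar_mult[OF scalar_map_uea_scalar]
           mult.assoc, metis c)
  show "counit_right (x * x') = counit_right x * counit_right x'"
    by (rule fps_lin_tensor_hom[OF counit_antipode_maps(3)])
       (simp add: counit_antipode_maps fps_counit_mult fps_scalar_mult[OF scalar_map_uea_scalar]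
           mult.assoc, metis c)
qed

lemmas counit_antipode_simps =
  counit_antipode_maps(2,4,6,8) counit_antipode_maps(1,3,5,7)[THEN fps_lin_add]
  counit_antipode_maps(1,3,5,7)[THEN lin_Xmul]
  fps_counit_1 counit_E counit_gen fps_scalar_1[OF scalar_map_uea_scalar]
  fps_lin_0[OF fps_scalar_lin[OF scalar_map_uea_scalar]] fps_counit_mult Xmul_simps

lemma counit_axioms: "counit_left (\<Delta> f) = f" "counit_right (\<Delta> f) = f"
proof -
  have s: "counit_left (fps_const (uea2_scalar c)) = fps_const (uea_scalar c)"
    "counit_right (fps_const (uea2_scalar c)) = fps_const (uea_scalar c)" for c :: 'a
    by (simp_all add: const_scalar2(1) counit_antipode_simps fps_counit_const sv_counit_simps
        fps_scalar_const[OF scalar_map_uea_scalar])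
  have g: "counit_left (DL n) = l n" "counit_left (DY n) = y n" "counit_left (DM n) = m n"
    "counit_right (DL n) = l n" "counit_right (DY n) = y n" "counit_right (DM n) = m n" for n
    by (simp_all add: DL_def DY_def DM_def counit_antipode_simps)
  have "counit_left (\<Delta> (fps_const u)) = fps_const u"
      "counit_right (\<Delta> (fps_const u)) = fps_const u" for u :: "'a sv_uea"
    by (induction u rule: sv_uea_induct)
       (simp_all add: Delta_scalar s sv_gen_incl Delta_mult counit_mult fps_lin_add[OF Delta_lin]
        fps_lin_add[OF counit_antipode_maps(1)] fps_lin_add[OF counit_antipode_maps(3)]
        Delta_gen[unfolded l_def y_def m_def] g[unfolded l_def y_def m_def]
        flip: fps_const_add fps_const_mult split: sv_gen.split)
  then show "counit_left (\<Delta> f) = f" "counit_right (\<Delta> f) = f"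
    by (intro fps_lin_eqI[where z = fps_X and f = f, OF _
        fps_lin_comp[OF counit_antipode_maps(1) Delta_lin] fps_lin_id]
          fps_lin_eqI[where z = fps_X and f = f, OF _
              fps_lin_comp[OF counit_antipode_maps(3) Delta_lin] fps_lin_id],
        simp_all)+
qed

text \<open>
  Convolution with an antihomomorphism satisfies \<open>S(a f) b g = S f (S a b) g\<close>, so it is
  multiplicative as soon as the inner factor is central.
\<close>

lemma antipode_mult:
  assumes "antipode_left x = fps_scalar uea_scalar c"
  shows "antipode_left (x * x') = fps_scalar uea_scalar c * antipode_left x'"
proof (rule fps_lin_tensor_eqI[OF fps_lin_premult[OF counit_antipode_maps(5)]
    fps_lin_mult_left[OF counit_antipode_maps(5) X_central[symmetric]]])
  fix u v :: "'a sv_uea"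
  let ?u = "fps_const u" and ?v = "fps_const v"
  have "antipode_left (x * (?u \<otimes>\<^sub>t ?v)) = S ?u * antipode_left x * ?v"
    by (rule fps_lin_tensor_eqI[OF fps_lin_postmult[OF counit_antipode_maps(5)]
          fps_lin_mult_right[OF fps_lin_mult_left[OF counit_antipode_maps(5)
              X_central[symmetric]]]])
       (simp only: const_tensor2 fps_tensor_mult counit_antipode_maps S_mult mult.assoc)
  also have "\<dots> = fps_scalar uea_scalar c * antipode_left (?u \<otimes>\<^sub>t ?v)"
    by (simp add: assms counit_antipode_maps fps_scalar_central[OF scalar_map_uea_scalar, of "S ?u"]
        mult.assoc)
  finally show "antipode_left (x * fps_const (tensor2 u v)) =
      fps_scalar uea_scalar c * antipode_left (fps_const (tensor2 u v))"
    by (simp only: const_tensor2)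
qed

text \<open>The mirror image: a f S(b g) = a (f S(g)) S(b), so the central inner factor now comes
  from the right multiplicand.\<close>

lemma antipode_right_mult:
  assumes "antipode_right x = fps_scalar uea_scalar c"
  shows "antipode_right (x' * x) = antipode_right x' * fps_scalar uea_scalar c"
proof (rule fps_lin_tensor_eqI[OF fps_lin_postmult[OF counit_antipode_maps(7)]
    fps_lin_mult_right[OF counit_antipode_maps(7)]])
  fix u v :: "'a sv_uea"
  let ?u = "fps_const u" and ?v = "fps_const v"
  have "antipode_right ((?u \<otimes>\<^sub>t ?v) * x) = ?u * antipode_right x * S ?v"
    by (rule fps_lin_tensor_eqI[OF fps_lin_premult[OF counit_antipode_maps(7)]
          fps_lin_mult_right[OF fps_lin_mult_left[OF counit_antipode_maps(7)
              X_central[symmetric]]]])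
       (simp only: const_tensor2 fps_tensor_mult counit_antipode_maps S_mult mult.assoc)
  also have "\<dots> = antipode_right (?u \<otimes>\<^sub>t ?v) * fps_scalar uea_scalar c"
    by (simp add: assms counit_antipode_maps fps_scalar_central[OF scalar_map_uea_scalar, of "S ?v"]
        mult.assoc)
  finally show "antipode_right (fps_const (tensor2 u v) * x) =
      antipode_right (fps_const (tensor2 u v)) * fps_scalar uea_scalar c"
    by (simp only: const_tensor2)
qed

lemma mult_swap: "x * z = z * x + lie x z"
  by (simp add: lie_def)

text \<open>From [L_0, e] = n0 e it follows that \<open>A 0\<close> is L_0 (1 - et). The factor
  \<open>E (- of_int n0)\<close> therefore cancels and the product is L_0 M_k, here with L_0 moved
  to the right. It arises from the third summand of \<open>DL\<close> under
  \<open>antipode_left\<close>.\<close>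

lemma A_0_mult: "A 0 * (E (- of_int n0) * m k) =
    smul uea_scalar (of_int k) (m k) + m k * (l 0 :: 'a::field_char_0 sv_uea fps)"
proof -
  have e: "Xmul (E (- of_int n0) * (m n0 * x)) = E (- of_int n0) * x - x" for x :: "'a sv_uea fps"
    using Xmul_E_mm[of 0 x] by (simp add: E_0)
  have e': "Xmul (E (- of_int n0) * (m k * (m n0 * x))) = E (- of_int n0) * (m k * x) - m k * x"
    "Xmul (E (- of_int n0) * (m k * m n0)) = E (- of_int n0) * m k - (m k :: 'a sv_uea fps)"
        for x :: "'a sv_uea fps"
    using e[of "m k * x"] e[of "m k"] by (simp_all only: order_simps(8,9)[of k n0])
  have "A 0 * (E (- of_int n0) * m k) = (E (- of_int n0) * m k) * A 0 + lie (A 0) (E (- of_int n0) *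
      m k)"
    by (rule mult_swap)
  also have "lie (A 0) (E (- of_int n0) * m k) =
      smul uea_scalar (of_int n0) (E (- of_int n0) * m k - m k) +
          smul uea_scalar (of_int k) (m k :: 'a sv_uea fps)"
    by (simp add: lie_simps lie_A_E lie_A_m smul1_simps Xmul_simps mult.assoc e algebra_simps)
  also have "(E (- of_int n0) * m k) * A 0 = m k * (l 0 :: 'a sv_uea fps) -
      smul uea_scalar (of_int n0) (E (- of_int n0) * m k - m k)"
    unfolding A_def by (simp add: smul1_simps Xmul_simps order_simps e e' mult.assoc
        right_diff_distrib distrib_left)
  finally show ?thesis by simp
qed

lemma antipode_gens:
  "antipode_left (DL n :: 'a::field_char_0 sv_uea2 fps) = 0"
  "antipode_left (DY n :: 'a sv_uea2 fps) = 0"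
  "antipode_left (DM n :: 'a sv_uea2 fps) = 0" "antipode_right (DL n :: 'a sv_uea2 fps) = 0"
  "antipode_right (DY n :: 'a sv_uea2 fps) = 0" "antipode_right (DM n :: 'a sv_uea2 fps) = 0"
proof -
  note c = counit_antipode_simps S_1 S_gen S_E S_mult
  show "antipode_left (DY n :: 'a sv_uea2 fps) = 0" "antipode_left (DM n :: 'a sv_uea2 fps) = 0"
    by (simp_all add: DY_def DM_def c RY_def RM_def mult.assoc order_simps E_add E_0)
  show "antipode_right (DY n :: 'a sv_uea2 fps) = 0" "antipode_right (DM n :: 'a sv_uea2 fps) = 0"
    by (simp_all add: DY_def DM_def c RY_def RM_def mult.assoc order_simps E_add E_0)
  \<comment> \<open>Moving the power on the right past \<open>A n\<close> cancels the prefactor of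
    \<open>RL n\<close> and leaves one commutator.\<close>
  have RE: "RL n * E (of_int n) = A n - smul uea_scalar (of_int n) (Xmul (m (n +
      n0) :: 'a sv_uea fps))" for n
    unfolding RL_def mult.assoc mult_swap[of "A n"] lie_A_E
    by (simp add: distrib_left order_simps E_0 right_diff_distrib smul1_simps Xmul_simps E_add
        mult.assoc[symmetric])
  have R0: "RL 0 = (A 0 :: 'a sv_uea fps)" by (simp add: RL_def E_0)
  \<comment> \<open>By \<open>RE\<close> and \<open>A_0_mult\<close> the value is L_n -
    \<open>A n\<close> + n t M_{n+n0} - t ((n + n0) M_{n+n0} + M_{n+n0} L_0), which vanishes by the
    definition of \<open>A\<close>.\<close>
  show "antipode_left (DL n :: 'a sv_uea2 fps) = 0"
    by (simp add: DL_def c RE R0 A_0_mult) (simp add: A_def smul1_simps Xmul_simps algebra_simps)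
  have lE: "l i * E d = E d * l i - smul uea_scalar d (Xmul (E (d - of_int n0) * m (i + n0)))"
      for i and d :: 'a
    using mult_swap[of "l i" "E d"] by (simp add: lie_E_l)
  have lm: "l i * m k = m k * l i + smul uea_scalar (of_int k) (m (k + i) :: 'a sv_uea fps)" for i k
    using mult_swap[of "l i" "m k"] by (simp add: lie_gen)
  have lEx: "l i * (E d * x) = E d * (l i * x) - smul uea_scalar d (Xmul (E (d - of_int n0) *
      (m (i + n0) * x)))"
    for i and d :: 'a and x
    by (simp add: mult.assoc[symmetric] lE left_diff_distrib smul1_simps Xmul_simps)
  have e: "Xmul (E (- of_int n - of_int n0) * (m n0 * x)) =
      E (- of_int n - of_int n0) * x - E (- of_int n) * x" for x :: "'a sv_uea fps"
    using Xmul_E_mm[of "- of_int n" x] by simp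
  have "antipode_right (DL n :: 'a sv_uea2 fps) =
      - RL n + l n * E (- of_int n) - Xmul (l 0 * (RM (n + n0) * E (of_int n0)))"
    by (simp add: DL_def c)
  also have "RM (n + n0) * E (of_int n0) = E (- of_int n) * (m (n + n0) :: 'a sv_uea fps)"
    by (simp add: RM_def mult.assoc order_simps)
  also have "- RL n + l n * E (- of_int n) - Xmul (l 0 * (E (- of_int n) * m (n + n0))) =
      (0 :: 'a sv_uea fps)"
    unfolding RL_def A_def
    by (simp add: lE lEx lm smul1_simps Xmul_simps e algebra_simps order_simps)
  finally show "antipode_right (DL n :: 'a sv_uea2 fps) = 0" .
qed

lemma antipode_axioms:
  "antipode_left (\<Delta> f) = fps_scalar uea_scalar (fps_sv_counit f)"
  "antipode_right (\<Delta> f) = fps_scalar uea_scalar (fps_sv_counit f)"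
proof -
  have s: "antipode_left (fps_const (uea2_scalar c)) = fps_const (uea_scalar c)"
    "antipode_right (fps_const (uea2_scalar c)) = fps_const (uea_scalar c)" for c :: 'a
    by (simp_all add: const_scalar2(1) counit_antipode_maps S_1 S_scalar)
  note sc = fps_scalar_const[OF scalar_map_uea_scalar]
  have "antipode_left (\<Delta> (fps_const u)) = fps_scalar uea_scalar (fps_sv_counit (fps_const u)) \<and>
    antipode_right (\<Delta> (fps_const u)) = fps_scalar uea_scalar (fps_sv_counit (fps_const u))"
        for u :: "'a sv_uea"
  proof (induction u rule: sv_uea_induct)
    case (scalar c)
    then show ?case by (simp add: Delta_scalar s fps_counit_const sv_counit_simps sc)
  next
    case (gen g)
    then show ?case
      by (cases g) (simp_all add: sv_gen_incl Delta_gen[unfolded l_def y_def m_def] antipode_gens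
          counit_gen[unfolded l_def y_def m_def] fps_lin_0[OF
              fps_scalar_lin[OF scalar_map_uea_scalar]])
  next
    case (add u v)
    then show ?case
      by (simp add: fps_lin_add[OF Delta_lin] fps_lin_add[OF counit_antipode_maps(5)]
          fps_lin_add[OF counit_antipode_maps(7)]
          fps_lin_add[OF fps_lin_counit] fps_lin_add[OF fps_scalar_lin[OF scalar_map_uea_scalar]]
              flip: fps_const_add)
  next
    \<comment> \<open>By the induction hypothesis the inner convolution is a scalar series, which is
      the centrality that \<open>antipode_mult\<close> and \<open>antipode_right_mult\<close>
      require.\<close>
    case (mult u v)
    then show ?case
      by (simp add: Delta_mult antipode_mult antipode_right_mult fps_counit_mult
          fps_scalar_mult[OF scalar_map_uea_scalar] flip: fps_const_mult)
  qed
  then show "antipode_left (\<Delta> f) = fps_scalar uea_scalar (fps_sv_counit f)"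
    "antipode_right (\<Delta> f) = fps_scalar uea_scalar (fps_sv_counit f)"
    by (intro fps_lin_eqI[where z = fps_X and f = f, OF _
        fps_lin_comp[OF counit_antipode_maps(5) Delta_lin] scalar_counit_lin]
          fps_lin_eqI[where z = fps_X and f = f, OF _
              fps_lin_comp[OF counit_antipode_maps(7) Delta_lin] scalar_counit_lin],
        simp_all)+
qed

lemma Delta_fps_scalar: "\<Delta> (fps_scalar uea_scalar c) = fps_scalar uea2_scalar c"
  by (rule fps_lin_eqI[OF _ fps_lin_comp[OF Delta_lin fps_scalar_lin[OF scalar_map_uea_scalar]]
        fps_scalar_lin[OF scalar_map_uea2_scalar], of c])
     (simp_all add: fps_scalar_const scalar_map_uea_scalar scalar_map_uea2_scalar Delta_scalar)

lemma S_fps_scalar: "S (fps_scalar uea_scalar c) = fps_scalar uea_scalar c"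
  by (rule fps_lin_eqI[OF _ fps_lin_comp[OF S_lin fps_scalar_lin[OF scalar_map_uea_scalar]]
        fps_scalar_lin[OF scalar_map_uea_scalar], of c])
     (simp_all add: fps_scalar_const scalar_map_uea_scalar S_scalar)

lemma counit_fps_scalar: "fps_sv_counit (fps_scalar uea_scalar c) = c"
  by (rule fps_lin_eqI[OF _ fps_lin_comp[OF fps_lin_counit fps_scalar_lin[OF scalar_map_uea_scalar]]
      fps_lin_id, of c])
     (simp_all add: fps_scalar_const scalar_map_uea_scalar fps_counit_const sv_counit_simps)

lemma Delta_S_hopf_algebra: "sv_topological_hopf_algebra \<Delta> fps_sv_counit S"
proof
  fix f g :: "'a sv_uea fps" and c
  show "\<Delta> (f + g) = \<Delta> f + \<Delta> g" by (rule fps_lin_add[OF Delta_lin])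
  show "\<Delta> (fps_scalar uea_scalar c * f) = fps_scalar uea2_scalar c * \<Delta> f"
    by (simp add: Delta_mult Delta_fps_scalar)
  show "\<Delta> 1 = 1" by (rule Delta_1)
  show "\<Delta> (f * g) = \<Delta> f * \<Delta> g" by (rule Delta_mult)
  show "fps_sv_counit (f + g) = fps_sv_counit f + fps_sv_counit g"
  by (rule fps_lin_add[OF fps_lin_counit])
  show "fps_sv_counit (fps_scalar uea_scalar c * f) = c * fps_sv_counit f"
    by (simp add: fps_counit_mult counit_fps_scalar)
  show "fps_sv_counit 1 = 1" by (rule fps_counit_1)
  show "fps_sv_counit (f * g) = fps_sv_counit f * fps_sv_counit g" by (rule fps_counit_mult)
  show "S (f + g) = S f + S g" by (rule fps_lin_add[OF S_lin])
  show "S (fps_scalar uea_scalar c * f) = fps_scalar uea_scalar c * S f"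
    by (simp add: S_mult S_fps_scalar fps_scalar_central[OF scalar_map_uea_scalar])
  show "S 1 = 1" by (rule S_1)
  show "S (f * g) = S g * S f" by (rule S_mult)
qed (rule coassoc[unfolded coassoc_left_def coassoc_right_def]
      counit_axioms(1)[unfolded counit_left_def] counit_axioms(2)[unfolded counit_right_def]
      antipode_axioms(1)[unfolded antipode_left_def]
          antipode_axioms(2)[unfolded antipode_right_def])+

lemma not_cocommutative: "\<not> cocommutative (\<Delta> :: 'a::field_char_0 sv_uea fps \<Rightarrow> _)"
proof
  assume "cocommutative (\<Delta> :: 'a sv_uea fps \<Rightarrow> _)"
  \<comment> \<open>The witness M_{2 n0} comes with the factor (1 - et)^2, whose t-coefficient is
    -2e. The resulting M_{2 n0} \<otimes> (-2e) is not symmetric, whereas for M_{n0} the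
    t-coefficient would be the symmetric -e \<otimes> e.\<close>
  then have "fps_flip (\<Delta> (m (2 * n0))) = \<Delta> (m (2 * n0) :: 'a sv_uea fps)"
    by (simp add: cocommutative_def)
  then have "m (2 * n0) \<otimes>\<^sub>t 1 + E (of_int (2 * n0)) \<otimes>\<^sub>t m (2 * n0) =
      1 \<otimes>\<^sub>t m (2 * n0) + m (2 * n0) \<otimes>\<^sub>t E (of_int (2 * n0) :: 'a)"
    by (simp add: Delta_gen DM_def fps_lin_add[OF fps_flip_tensor(1)] fps_flip_tensor(2))
  then have "(m (2 * n0) \<otimes>\<^sub>t 1 + E (of_int (2 * n0)) \<otimes>\<^sub>t m (2 * n0)) $ 1 =
      (1 \<otimes>\<^sub>t m (2 * n0) + m (2 * n0) \<otimes>\<^sub>t E (of_int (2 * n0) :: 'a)) $ 1"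
    by (rule arg_cong)
  moreover have "E (of_int (2 * n0) :: 'a) $ 1 = uea_scalar (- 2) * sv_M n0"
    using n0 by (simp add: E_def one_minus_powr_def)
  ultimately have "tensor2 (uea_scalar (- 2) * sv_M n0) (sv_M (2 * n0)) =
      tensor2 (sv_M (2 * n0)) (uea_scalar (- 2 :: 'a) * sv_M n0)"
    by (simp add: fps_bilin_def m_def biadditive_0[OF biadditive_tensor(1)])
  then show False
    using tensor_M_neq[of n0 "2 * n0" "- 2 :: 'a"] n0 by simp
qed

lemma quotient_iso: "quotient_iso_standard_hopf \<Delta> fps_sv_counit (S :: 'a::field_char_0 sv_uea fps \<Rightarrow>
    _)"
  unfolding quotient_iso_standard_hopf_def
proof (intro exI[of _ "\<lambda>f. f $ 0"] conjI allI)
  show "surj (\<lambda>f :: 'a sv_uea fps. f $ 0)"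
    by (rule surjI[of _ fps_const]) simp
  fix f g :: "'a sv_uea fps" and c
  show "(f $ 0 = 0) = (\<exists>g. f = fps_X * g)"
  proof
    assume "f $ 0 = 0"
    then show "\<exists>g. f = fps_X * g" using fps_decomp[of f] by auto
  qed auto
  show "(fps_scalar uea_scalar c * f) $ 0 = uea_scalar (c $ 0) * f $ 0"
    by (simp add: fps_scalar_def)
  have "sv_coproduct u = \<Delta> (fps_const u) $ 0" for u :: "'a sv_uea"
  proof (induction u rule: sv_uea_hom_eqI)
    show "sv_coproduct (sv_L n) = \<Delta> (fps_const (sv_L n)) $ 0"
      "sv_coproduct (sv_Y n) = \<Delta> (fps_const (sv_Y n)) $ 0"
      "sv_coproduct (sv_M n) = \<Delta> (fps_const (sv_M n :: 'a sv_uea)) $ 0" for n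
      by (simp_all only: Delta_gen flip: l_def y_def m_def)
         (simp_all add: DL_def DY_def DM_def Xmul_nth_0 fps_bilin_def l_def y_def m_def E_def
             one_minus_powr_def
           scalar_mapD(3)[OF scalar_map_uea_scalar], simp_all add: sv_L_def sv_Y_def sv_M_def
               sv_coproduct_incl)
  qed (simp_all add: sv_coproduct_add sv_coproduct_mult sv_coproduct_scalar Delta_scalar Delta_mult
      fps_lin_add[OF Delta_lin] flip: fps_const_add fps_const_mult)
  \<comment> \<open>Linearity over t: modulo t only the constant coefficient of f matters.\<close>
  moreover have "\<Delta> f $ 0 = \<Delta> (fps_const (f $ 0)) $ 0"
    by (subst fps_decomp[of f]) (simp add: fps_lin_add[OF Delta_lin] fps_lin_X[OF Delta_lin])
  ultimately show "sv_coproduct (f $ 0) =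
      tensor2_lift uea2_scalar (\<lambda>u v. tensor2 (fps_const u $ 0) (fps_const v $ 0)) (\<Delta> f $ 0)"
    by (simp add: tensor2_lift_tensor2_id)
  show "sv_counit (f $ 0) = fps_sv_counit f $ 0" by (simp add: fps_sv_counit_def)
  \<comment> \<open>Modulo t the homomorphism \<rho> is the identity, so S = \<rho> \<circ> S_0
    reduces to S_0.\<close>
  have "u = \<rho> u $ 0" for u :: "'a sv_uea"
  proof (induction u rule: sv_uea_hom_eqI)
    show "sv_L n = \<rho> (sv_L n) $ 0" "sv_Y n = \<rho> (sv_Y n) $ 0"
        "sv_M n = \<rho> (sv_M n :: 'a sv_uea) $ 0" for n
      by (simp_all add: rho_gen RL_def RY_def RM_def A_def Xmul_nth_0 l_def y_def m_def E_def
          one_minus_powr_def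
          scalar_mapD(3)[OF scalar_map_uea_scalar])
  qed (simp_all add: rho_add rho_mult rho_scalar)
  then have "sv_antipode (f $ 0) = S (fps_const (f $ 0)) $ 0"
    by (simp only: S_const)
  moreover have "S f $ 0 = S (fps_const (f $ 0)) $ 0"
    by (subst fps_decomp[of f]) (simp add: fps_lin_add[OF S_lin] fps_lin_X[OF S_lin])
  ultimately show "sv_antipode (f $ 0) = S f $ 0" by simp
qed simp_all

end

theorem theorem1:
  fixes n0 :: int and h e :: "'a::field_char_0 sv_uea"
  assumes "n0 \<noteq> 0"
    and "h = uea_scalar (1 / of_int n0) * sv_L 0"
    and "e = sv_M n0"
  shows "\<exists>(\<Delta> :: 'a sv_uea fps \<Rightarrow> 'a sv_uea2 fps) (S :: 'a sv_uea fps \<Rightarrow> 'a sv_uea fps).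
    sv_topological_hopf_algebra \<Delta> fps_sv_counit S \<and>
    (\<exists>f g :: 'a sv_uea fps. f * g \<noteq> g * f) \<and>
    \<not> cocommutative \<Delta> \<and>
    quotient_iso_standard_hopf \<Delta> fps_sv_counit S \<and>
    (\<forall>n. \<Delta> (fps_const (sv_L n)) =
      1 \<otimes>\<^sub>t fps_const (sv_L n)
      + fps_const (sv_L n) \<otimes>\<^sub>t one_minus_powr e (of_int n / of_int n0)
      + fps_const (of_int n0 * h) \<otimes>\<^sub>t
          one_minus_powr e (-1) * fps_const (sv_M (n + n0)) * fps_X) \<and>
    (\<forall>k. \<Delta> (fps_const (sv_M k)) =
      1 \<otimes>\<^sub>t fps_const (sv_M k)
      + fps_const (sv_M k) \<otimes>\<^sub>t one_minus_powr e (of_int k / of_int n0)) \<and>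
    (\<forall>j. \<Delta> (fps_const (sv_Y j)) =
      1 \<otimes>\<^sub>t fps_const (sv_Y j)
      + fps_const (sv_Y j) \<otimes>\<^sub>t one_minus_powr e (half j / of_int n0)) \<and>
    (\<forall>n. S (fps_const (sv_L n)) =
      - (one_minus_powr e (- (of_int n / of_int n0)) *
         (fps_const (sv_L n)
          - of_int n0 * fps_const (sv_M (n + n0)) * fps_const (shifted_falling h 1 1) * fps_X))) \<and>
    (\<forall>k. S (fps_const (sv_M k)) =
      - (one_minus_powr e (- (of_int k / of_int n0)) * fps_const (sv_M k))) \<and>
    (\<forall>j. S (fps_const (sv_Y j)) =
      - (one_minus_powr e (- (half j / of_int n0)) * fps_const (sv_Y j)))"
proof -
  interpret sv_twist n0 by standard (rule assms)
  note sm = scalar_mapD[OF scalar_map_uea_scalar]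
  have n: "of_int n0 = uea_scalar (of_int n0 :: 'a)"
    by (rule scalar_map_of_int[OF scalar_map_uea_scalar, symmetric])
  have nf: "of_int n0 = fps_const (uea_scalar (of_int n0 :: 'a))"
    by (rule scalar_map_of_int[OF scalar_map_const[OF scalar_map_uea_scalar], symmetric])
  have h: "of_int n0 * h = sv_L 0"
    using assms(1) by (simp add: n assms(2) sm(3) flip: mult.assoc sm(2))
  have E: "one_minus_powr e (c / of_int n0) = E c" "one_minus_powr e (- (c / of_int n0)) = E (- c)"
    "one_minus_powr e (- 1) = E (- of_int n0)" for c
    using assms(1) by (simp_all add: E_def assms(3))
  have g: "fps_const (sv_L i) = l i" "fps_const (sv_M i) = m i" "fps_const (sv_Y i) = y i" for i
    by (simp_all add: l_def m_def y_def)
  have X: "x * fps_X = Xmul x" for x :: "'a sv_uea fps"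
    by (simp add: Xmul_def X_central)
  \<comment> \<open>The product for n = 1 and a = 1 is h + 1, and n0 (h + 1) = L_0 + n0 is the
    factor used in \<open>A\<close>.\<close>
  have sf: "of_int n0 * m k * fps_const (shifted_falling h 1 1) =
      m k * (l 0 + smul uea_scalar (of_int n0) 1)" for k
  proof -
    have "of_int n0 * m k * fps_const (shifted_falling h 1 1) =
        m k * (of_int n0 * fps_const (shifted_falling h 1 1))"
      unfolding nf by (simp only: mult.assoc const_scalar_left)
    also have "of_int n0 * fps_const (shifted_falling h 1 1) = fps_const (of_int n0 * (h + 1))"
      by (simp add: nf n shifted_falling_def sm(3))
    also have "\<dots> = l 0 + smul uea_scalar (of_int n0) 1"
      by (simp add: distrib_left h[unfolded n] l_def smul_def n flip: fps_const_add)
    finally show ?thesis .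
  qed
  show ?thesis
  proof (intro exI[of _ \<Delta>] exI[of _ S] conjI allI)
    show "\<exists>f g :: 'a sv_uea fps. f * g \<noteq> g * f" by (rule fps_noncommutative)
  qed (simp_all only: Delta_S_hopf_algebra not_cocommutative quotient_iso g E h X sf Delta_gen
      DL_def DM_def DY_def S_gen RL_def RM_def RY_def A_def tensor_simps,
       simp_all)
qed

end
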